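(* Let $G$ be a countable discrete abelian group and let $\mathbf X=(X,\mathcal B,\mu,(T_g)_{g\in G})$ be an ergodic measure-preserving $G$-system with Kronecker factor $\mathbf Z$ and factor map $\pi:X\to Z$. Let $\varphi,\psi:G\to G$ be homomorphisms such that $\varphi(G)$, $\psi(G)$ and $(\psi-\varphi)(G)$ have finite index in $G$. Then for $f_1,f_2\in L^\infty(\mu)$ the limit $$\text{UC-}\lim_{g\in G} f_1(T_{\varphi(g)}x)\,f_2(T_{\psi(g)}x)$$ exists in $L^2(\mu)$ and is equal to $$\text{UC-}\lim_{g\in G}\tilde f_1\big(z+\widehat{\varphi(g)}\big)\tilde f_2\big(z+\widehat{\psi(g)}\big)=\int_{Z^2}\tilde f_1(z+w_1)\tilde f_2(z+w_2)\,d\nu_{\varphi,\psi}(w_1,w_2),$$ where $z=\pi(x)$ and $\nu_{\varphi,\psi}$ is the Haar probability measure on the closed subgroup $Z_{\varphi,\psi}:=\overline{\{(\widehat{\varphi(g)},\widehat{\psi(g)}):g\in G\}}$ of $Z^2$.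
   Context: The Kronecker factor of an ergodic system is its maximal factor isomorphic to a system of the form: a compact metrizable abelian group $Z$ with Haar measure and the action $z\mapsto z+\hat g$, where $g\mapsto\hat g$ is a homomorphism $G\to Z$ (with dense image). For $f\in L^2(\mu)$, $\tilde f$ denotes the function on $Z$ with $\mathbb E[f\mid Z]=\tilde f\circ\pi$. A sequence $(u_g)_{g\in G}$ in a Hilbert space has uniform Cesàro limit $u$, written $\text{UC-}\lim_{g\in G}u_g=u$, if $\frac1{|F_N|}\sum_{g\in F_N}u_g\to u$ for every Følner sequence $(F_N)$ in $G$ (finite sets with $|(F_N+g)\triangle F_N|/|F_N|\to0$ for all $g$). *)

theory Defs
  imports "HOL-Analysis.Analysis" "HOL-Probability.Probability" "HOL-Library.Product_Plus"
begin

definition additive_hom :: "('g::ab_group_add \<Rightarrow> 'h::ab_group_add) \<Rightarrow> bool" where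
  "additive_hom f \<longleftrightarrow> (\<forall>g h. f (g + h) = f g + f h)"

definition finite_index :: "'g::ab_group_add set \<Rightarrow> bool" where
  "finite_index H \<longleftrightarrow> finite (range (\<lambda>g. (\<lambda>h. g + h) ` H))"

definition haar_on :: "'z::{topological_space,plus} set \<Rightarrow> 'z measure \<Rightarrow> bool" where
  "haar_on K \<nu> \<longleftrightarrow> sets \<nu> = sets borel \<and> prob_space \<nu> \<and> emeasure \<nu> K = 1 \<and>
     (\<forall>k\<in>K. \<forall>A\<in>sets borel. emeasure \<nu> ((\<lambda>z. k + z) ` A) = emeasure \<nu> A)"

definition circle_seq :: "(nat \<Rightarrow> complex) set" where
  "circle_seq = {z. \<forall>n. norm (z n) = 1}"

definition cmult :: "(nat \<Rightarrow> complex) \<Rightarrow> (nat \<Rightarrow> complex) \<Rightarrow> (nat \<Rightarrow> complex)" where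
  "cmult a b = (\<lambda>n. a n * b n)"

definition closed_circle_subgroup :: "(nat \<Rightarrow> complex) set \<Rightarrow> bool" where
  "closed_circle_subgroup K \<longleftrightarrow> K \<subseteq> circle_seq \<and> closed K \<and> (\<lambda>n. 1) \<in> K \<and>
     (\<forall>a\<in>K. \<forall>b\<in>K. cmult a b \<in> K) \<and> (\<forall>a\<in>K. (\<lambda>n. inverse (a n)) \<in> K)"

definition haar_on_circle :: "(nat \<Rightarrow> complex) set \<Rightarrow> (nat \<Rightarrow> complex) measure \<Rightarrow> bool" where
  "haar_on_circle K \<nu> \<longleftrightarrow> sets \<nu> = sets borel \<and> prob_space \<nu> \<and> emeasure \<nu> K = 1 \<and>
     (\<forall>k\<in>K. \<forall>A\<in>sets borel. emeasure \<nu> (cmult k ` A) = emeasure \<nu> A)"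

definition mp_action :: "'a measure \<Rightarrow> ('g::ab_group_add \<Rightarrow> 'a \<Rightarrow> 'a) \<Rightarrow> bool" where
  "mp_action M T \<longleftrightarrow> prob_space M \<and>
     (\<forall>g. T g \<in> measurable M M \<and> distr M M (T g) = M) \<and>
     (\<forall>x\<in>space M. T 0 x = x) \<and>
     (\<forall>g h. \<forall>x\<in>space M. T (g + h) x = T g (T h x))"

definition ergodic_action :: "'a measure \<Rightarrow> ('g::ab_group_add \<Rightarrow> 'a \<Rightarrow> 'a) \<Rightarrow> bool" where
  "ergodic_action M T \<longleftrightarrow> mp_action M T \<and>
     (\<forall>A\<in>sets M. (\<forall>g. T g -` A \<inter> space M = A) \<longrightarrow> emeasure M A = 0 \<or> emeasure M A = 1)"

definition rotation_factor ::
  "'a measure \<Rightarrow> ('g::ab_group_add \<Rightarrow> 'a \<Rightarrow> 'a) \<Rightarrow> 'z::{topological_ab_group_add,metric_space} measure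
   \<Rightarrow> ('g \<Rightarrow> 'z) \<Rightarrow> ('a \<Rightarrow> 'z) \<Rightarrow> bool" where
  "rotation_factor M T m \<alpha> \<pi> \<longleftrightarrow> compact (UNIV :: 'z set) \<and> haar_on UNIV m \<and>
     additive_hom \<alpha> \<and> closure (range \<alpha>) = UNIV \<and>
     \<pi> \<in> measurable M borel \<and> distr M borel \<pi> = m \<and>
     (\<forall>g. AE x in M. \<pi> (T g x) = \<pi> x + \<alpha> g)"

text \<open>Same notion for rotations on closed subgroups of the circle product T^N (every compact
  metrizable abelian group is isomorphic to such a subgroup).\<close>
definition circle_rotation_factor ::
  "'a measure \<Rightarrow> ('g::ab_group_add \<Rightarrow> 'a \<Rightarrow> 'a) \<Rightarrow> (nat \<Rightarrow> complex) set \<Rightarrow> (nat \<Rightarrow> complex) measure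
   \<Rightarrow> ('g \<Rightarrow> nat \<Rightarrow> complex) \<Rightarrow> ('a \<Rightarrow> nat \<Rightarrow> complex) \<Rightarrow> bool" where
  "circle_rotation_factor M T K m \<alpha> \<pi> \<longleftrightarrow> closed_circle_subgroup K \<and> haar_on_circle K m \<and>
     range \<alpha> \<subseteq> K \<and> (\<forall>g h. \<alpha> (g + h) = cmult (\<alpha> g) (\<alpha> h)) \<and> closure (range \<alpha>) = K \<and>
     \<pi> \<in> measurable M borel \<and> distr M borel \<pi> = m \<and>
     (\<forall>g. AE x in M. \<pi> (T g x) = cmult (\<pi> x) (\<alpha> g))"

text \<open>Kronecker factor: a rotation factor which is maximal, i.e. every rotation factor is
  (mod null sets) a factor of it.\<close>
definition kronecker_factor ::
  "'a measure \<Rightarrow> ('g::ab_group_add \<Rightarrow> 'a \<Rightarrow> 'a) \<Rightarrow> 'z::{topological_ab_group_add,metric_space} measure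
   \<Rightarrow> ('g \<Rightarrow> 'z) \<Rightarrow> ('a \<Rightarrow> 'z) \<Rightarrow> bool" where
  "kronecker_factor M T m \<alpha> \<pi> \<longleftrightarrow> rotation_factor M T m \<alpha> \<pi> \<and>
     (\<forall>K m' \<alpha>' \<pi>'. circle_rotation_factor M T K m' \<alpha>' \<pi>' \<longrightarrow>
        (\<forall>B\<in>sets (borel :: (nat \<Rightarrow> complex) measure). \<exists>A\<in>sets (borel :: 'z measure).
            emeasure M ((\<pi>' -` B \<inter> space M) - (\<pi> -` A \<inter> space M)) = 0 \<and>
            emeasure M ((\<pi> -` A \<inter> space M) - (\<pi>' -` B \<inter> space M)) = 0))"

definition cond_exp_on_factor ::
  "'a measure \<Rightarrow> ('a \<Rightarrow> 'z::topological_space) \<Rightarrow> ('a \<Rightarrow> complex) \<Rightarrow> ('z \<Rightarrow> complex) \<Rightarrow> bool" where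
  "cond_exp_on_factor M \<pi> f ft \<longleftrightarrow> ft \<in> borel_measurable borel \<and> integrable M (\<lambda>x. ft (\<pi> x)) \<and>
     (\<forall>A\<in>sets (borel :: 'z measure).
        (LINT x:(\<pi> -` A \<inter> space M)|M. f x) = (LINT x:(\<pi> -` A \<inter> space M)|M. ft (\<pi> x)))"

definition Linfty :: "'a measure \<Rightarrow> ('a \<Rightarrow> complex) \<Rightarrow> bool" where
  "Linfty M f \<longleftrightarrow> f \<in> borel_measurable M \<and> (\<exists>C. AE x in M. norm (f x) \<le> C)"

definition folner :: "(nat \<Rightarrow> 'g::ab_group_add set) \<Rightarrow> bool" where
  "folner F \<longleftrightarrow> (\<forall>N. finite (F N) \<and> F N \<noteq> {}) \<and>
     (\<forall>g. (\<lambda>N. real (card (((\<lambda>h. h + g) ` F N - F N) \<union> (F N - (\<lambda>h. h + g) ` F N)))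
                 / real (card (F N))) \<longlonglongrightarrow> 0)"

definition L2_tendsto :: "'a measure \<Rightarrow> (nat \<Rightarrow> 'a \<Rightarrow> complex) \<Rightarrow> ('a \<Rightarrow> complex) \<Rightarrow> bool" where
  "L2_tendsto M u v \<longleftrightarrow> (\<lambda>N. \<integral>\<^sup>+ x. ennreal ((norm (u N x - v x))\<^sup>2) \<partial>M) \<longlonglongrightarrow> 0"

definition UC_lim :: "'a measure \<Rightarrow> ('g::ab_group_add \<Rightarrow> 'a \<Rightarrow> complex) \<Rightarrow> ('a \<Rightarrow> complex) \<Rightarrow> bool" where
  "UC_lim M u v \<longleftrightarrow> (\<forall>F. folner F \<longrightarrow>
      L2_tendsto M (\<lambda>N x. (\<Sum>g\<in>F N. u g x) / of_nat (card (F N))) v)"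

end

theory Submission
  imports Defs "HOL-Library.Function_Algebras" "HOL-Computational_Algebra.Fundamental_Theorem_Algebra"
begin

text \<open>
  Write \<open>f\<^sub>i = E[f\<^sub>i | Z] + b\<^sub>i\<close>. The averages in which some \<open>b\<^sub>i\<close> occurs tend to zero, and the remaining ones live
  on \<open>Z\<close>.

  For the first claim, van der Corput's inequality bounds the norm of the average by averages of the
  nonnegative quantities \<open>B ((\<psi> - \<phi>) g)\<close>. Summing over all cosets of the finite index subgroup \<open>(\<psi> - \<phi>)(G)\<close> and
  using ergodicity of \<open>G\<close>, one is left with averages of the squared correlations
  \<open>|\<langle>T\<^sub>g b, T\<^sub>h b\<rangle>|\<^sup>2\<close>. The rank one projections onto the vectors \<open>T\<^sub>g b\<close> average, by the mean ergodic theorem on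
  \<open>X \<times> X\<close>, to a positive Hilbert-Schmidt operator commuting with the action. If the correlations do not tend
  to zero on average, this operator is nonzero, and its top eigenspace is finite dimensional and invariant,
  hence contains a common eigenfunction \<open>e\<close> of the action with \<open>\<langle>e, b\<rangle> \<noteq> 0\<close>. But \<open>e\<close> generates a rotation factor
  on a closed subgroup of the circle, so it is measurable with respect to the Kronecker factor and orthogonal
  to \<open>b\<close>.

  On \<open>Z\<close>, the measure \<open>\<nu>\<close> is ergodic under translation by the dense subgroup of \<open>Z\<^sub>\<phi>\<^sub>,\<^sub>\<psi>\<close>. The mean ergodic theorem
  therefore gives convergence after averaging over a starting point \<open>w\<close> in \<open>Z\<^sub>\<phi>\<^sub>,\<^sub>\<psi>\<close>; since translations are
  continuous in \<open>L\<^sup>1\<close>, uniformly along the orbit, it holds for the starting point \<open>0\<close>.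
\<close>

section \<open>Averages and the mean ergodic theorem\<close>

text \<open>Vectors are functions, not classes modulo null sets, and bounded functions are not
  complete in norm. So the Hilbert space arguments work with a semidefinite form on an incomplete
  space: equality becomes distance zero, minimisers become near-minimisers, and limits are taken
  only where a common sup bound is at hand. The homomorphisms need be neither injective nor onto:
  the image of a Folner sequence need not be Folner, nor \<phi>(G) ergodic. Averages therefore run
  over an index family \<open>\<gamma>\<close> into the group, and \<open>asymp_inv\<close> tests
  invariance against bounded functions, so multiplicities are counted. Attaching a finite
  transversal to the index set makes the family asymptotically invariant under the whole group;
  since the averaged quantities are nonnegative, dropping the added terms costs a power of the
  index. On the compact group the functions are merely measurable and the starting point 0 may be
  \<nu>-null, so an almost everywhere statement on the orbit closure says nothing about it.
  Integration over the base point \<open>z\<close> is what makes nearby starting points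
  comparable.\<close>

definition asymp_inv :: "(nat \<Rightarrow> 'i set) \<Rightarrow> ('i \<Rightarrow> 'g::ab_group_add) \<Rightarrow> bool" where
  "asymp_inv I \<gamma> \<longleftrightarrow> (\<forall>N. finite (I N) \<and> I N \<noteq> {}) \<and>
    (\<forall>h. \<exists>\<epsilon>. \<epsilon> \<longlonglongrightarrow> 0 \<and> (\<forall>N (b :: 'g \<Rightarrow> complex). (\<forall>x. norm (b x) \<le> 1) \<longrightarrow>
       norm (\<Sum>i\<in>I N. b (\<gamma> i) - b (\<gamma> i + h)) \<le> \<epsilon> N * real (card (I N))))"

lemma asymp_inv_finite: "asymp_inv I \<gamma> \<Longrightarrow> finite (I N)" "asymp_inv I \<gamma> \<Longrightarrow> I N \<noteq> {}"
  "asymp_inv I \<gamma> \<Longrightarrow> card (I N) > 0"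
  by (auto simp: asymp_inv_def card_gt_0_iff)

lemma asymp_inv_bound:
  assumes "asymp_inv I (\<gamma> :: 'i \<Rightarrow> 'g::ab_group_add)"
  obtains \<epsilon> where "\<epsilon> \<longlonglongrightarrow> 0" "\<And>N. 0 \<le> \<epsilon> N"
    "\<forall>N (b :: 'g \<Rightarrow> complex) D. (\<forall>x. norm (b x) \<le> D) \<longrightarrow>
       norm (\<Sum>i\<in>I N. b (\<gamma> i) - b (\<gamma> i + h)) \<le> \<epsilon> N * D * real (card (I N))"
proof -
  obtain \<epsilon> where e: "\<epsilon> \<longlonglongrightarrow> 0" and b: "\<And>N (b :: 'g \<Rightarrow> complex). (\<forall>x. norm (b x) \<le> 1) \<Longrightarrow>
       norm (\<Sum>i\<in>I N. b (\<gamma> i) - b (\<gamma> i + h)) \<le> \<epsilon> N * real (card (I N))"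
    using assms unfolding asymp_inv_def by metis
  have pos: "0 \<le> \<epsilon> N" for N
    using b[of "\<lambda>_. 0" N] asymp_inv_finite(3)[OF assms, of N] by (simp add: zero_le_mult_iff)
  moreover have "norm (\<Sum>i\<in>I N. b' (\<gamma> i) - b' (\<gamma> i + h)) \<le> \<epsilon> N * D * real (card (I N))"
    if D: "\<And>x. norm (b' x) \<le> D" for N and b' :: "'g \<Rightarrow> complex" and D
  proof (cases "D = 0")
    case True
    then show ?thesis using D by simp
  next
    case False
    have "0 \<le> D" using D[of 0] norm_ge_zero[of "b' 0"] by linarith
    then have "D > 0" using False by simp
    have "norm (\<Sum>i\<in>I N. b' (\<gamma> i) / D - b' (\<gamma> i + h) / D) \<le> \<epsilon> N * real (card (I N))"
      by (rule b) (use D \<open>D > 0\<close> in \<open>simp add: norm_divide\<close>)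
    also have "(\<Sum>i\<in>I N. b' (\<gamma> i) / D - b' (\<gamma> i + h) / D) = (\<Sum>i\<in>I N. b' (\<gamma> i) - b' (\<gamma> i + h)) / D"
      by (simp add: sum_divide_distrib diff_divide_distrib)
    finally show ?thesis using \<open>D > 0\<close> by (simp add: norm_divide field_simps)
  qed
  ultimately show thesis using that e by blast
qed

lemma null_squeeze:
  fixes f g :: "nat \<Rightarrow> real"
  shows "g \<longlonglongrightarrow> 0 \<Longrightarrow> (\<And>n. f n \<le> g n) \<Longrightarrow> (\<And>n. 0 \<le> f n) \<Longrightarrow> f \<longlonglongrightarrow> 0"
  by (rule tendsto_sandwich[of "\<lambda>_. 0" f sequentially g 0]) auto

lemma tendsto_0_le_approx:
  fixes f :: "nat \<Rightarrow> real"
  assumes "\<And>n. 0 \<le> f n" "\<And>e. e > 0 \<Longrightarrow> \<forall>\<^sub>F n in sequentially. f n \<le> e"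
  shows "f \<longlonglongrightarrow> 0"
proof (rule LIMSEQ_I)
  fix r :: real assume "r > 0"
  have "\<forall>\<^sub>F n in sequentially. f n \<le> r/2" using assms(2)[of "r/2"] \<open>r > 0\<close> by simp
  then show "\<exists>no. \<forall>n\<ge>no. norm (f n - 0) < r"
    unfolding eventually_sequentially using assms(1) \<open>r > 0\<close> by (metis abs_of_nonneg diff_zero field_sum_of_halves less_add_same_cancel1 order_le_less_trans real_norm_def half_gt_zero)
qed

text \<open>The form is only semidefinite because the intended vectors are functions modulo nothing.
  It is a parameter rather than a class operation since two forms on the same \<open>V\<close> are
  needed: the L2 product and later the form \<open>sig\<close> of the limit operator.\<close>

locale complex_semi_inner = vector_space scale
  for scale :: "complex \<Rightarrow> 'v::ab_group_add \<Rightarrow> 'v" (infixr \<open>*s\<close> 75) +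
  fixes V :: "'v set" and ip :: "'v \<Rightarrow> 'v \<Rightarrow> complex"
  assumes V_subspace: "subspace V"
    and ip_add_left: "\<lbrakk>u \<in> V; v \<in> V; w \<in> V\<rbrakk> \<Longrightarrow> ip (u + v) w = ip u w + ip v w"
    and ip_scale_left: "\<lbrakk>u \<in> V; w \<in> V\<rbrakk> \<Longrightarrow> ip (c *s u) w = c * ip u w"
    and ip_herm: "\<lbrakk>u \<in> V; v \<in> V\<rbrakk> \<Longrightarrow> ip v u = cnj (ip u v)"
    and ip_nonneg: "v \<in> V \<Longrightarrow> 0 \<le> Re (ip v v)"
begin

lemma V_closed [simp, intro]:
  "0 \<in> V" "u \<in> V \<Longrightarrow> v \<in> V \<Longrightarrow> u + v \<in> V" "u \<in> V \<Longrightarrow> v \<in> V \<Longrightarrow> u - v \<in> V"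
  "u \<in> V \<Longrightarrow> c *s u \<in> V" "(\<And>i. i \<in> J \<Longrightarrow> x i \<in> V) \<Longrightarrow> sum x J \<in> V"
  using V_subspace subspace_0 subspace_add subspace_diff subspace_scale subspace_sum by blast+

lemma ip_diff_left: "\<lbrakk>u \<in> V; v \<in> V; w \<in> V\<rbrakk> \<Longrightarrow> ip (u - v) w = ip u w - ip v w"
  using ip_add_left[of "u - v" v w] by simp

lemma ip_zero_left [simp]: "w \<in> V \<Longrightarrow> ip 0 w = 0"
  using ip_scale_left[of 0 w 0] by simp

lemma ip_sum_left: "(\<forall>i\<in>J. x i \<in> V) \<Longrightarrow> w \<in> V \<Longrightarrow> ip (sum x J) w = (\<Sum>i\<in>J. ip (x i) w)"
  by (induction J rule: infinite_finite_induct) (auto simp: ip_add_left)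

lemma ip_add_right: "\<lbrakk>u \<in> V; v \<in> V; w \<in> V\<rbrakk> \<Longrightarrow> ip w (u + v) = ip w u + ip w v"
  using ip_herm[of "u + v" w] ip_herm[of u w] ip_herm[of v w] ip_add_left by simp

lemma ip_scale_right: "\<lbrakk>u \<in> V; w \<in> V\<rbrakk> \<Longrightarrow> ip w (c *s u) = cnj c * ip w u"
  using ip_herm[of "c *s u" w] ip_herm[of u w] ip_scale_left by simp

lemma ip_diff_right: "\<lbrakk>u \<in> V; v \<in> V; w \<in> V\<rbrakk> \<Longrightarrow> ip w (u - v) = ip w u - ip w v"
  using ip_add_right[of "u - v" v w] by simp

lemma ip_zero_right [simp]: "w \<in> V \<Longrightarrow> ip w 0 = 0"
  using ip_scale_right[of 0 w 0] by simp

lemma ip_sum_right: "(\<forall>i\<in>J. x i \<in> V) \<Longrightarrow> w \<in> V \<Longrightarrow> ip w (sum x J) = (\<Sum>i\<in>J. ip w (x i))"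
  by (induction J rule: infinite_finite_induct) (auto simp: ip_add_right)

definition nrm :: "'v \<Rightarrow> real" where "nrm v = sqrt (Re (ip v v))"

lemma nrm_nonneg [simp]: "0 \<le> nrm v" if "v \<in> V"
  using that by (simp add: nrm_def ip_nonneg)

lemma nrm_sq: "v \<in> V \<Longrightarrow> (nrm v)\<^sup>2 = Re (ip v v)"
  by (simp add: nrm_def ip_nonneg)

lemma ip_self: "v \<in> V \<Longrightarrow> ip v v = of_real ((nrm v)\<^sup>2)"
  using ip_herm[of v v] by (auto simp: nrm_sq complex_eq_iff)

lemma nrm_add_sq: "u \<in> V \<Longrightarrow> v \<in> V \<Longrightarrow> (nrm (u + v))\<^sup>2 = (nrm u)\<^sup>2 + 2 * Re (ip u v) + (nrm v)\<^sup>2"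
  using ip_herm[of u v] by (simp add: nrm_sq ip_add_left ip_add_right)

lemma nrm_diff_sq: "u \<in> V \<Longrightarrow> v \<in> V \<Longrightarrow> (nrm (u - v))\<^sup>2 = (nrm u)\<^sup>2 - 2 * Re (ip u v) + (nrm v)\<^sup>2"
  using ip_herm[of u v] by (simp add: nrm_sq ip_diff_left ip_diff_right)

lemma nrm_scale: "v \<in> V \<Longrightarrow> nrm (c *s v) = cmod c * nrm v"
proof -
  assume v: "v \<in> V"
  have "(nrm (c *s v))\<^sup>2 = Re (c * cnj c * ip v v)"
    using v by (simp only: nrm_sq V_closed ip_scale_left ip_scale_right mult_ac)
  also have "\<dots> = (cmod c * nrm v)\<^sup>2"
    by (simp only: ip_self[OF v] complex_norm_square[symmetric] of_real_mult[symmetric] Re_complex_of_real power_mult_distrib)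
  finally show ?thesis using v by (simp add: power2_eq_iff_nonneg)
qed

text \<open>The quadratic \<open>*\<close> in \<open>t\<close> loses its leading term when
  \<open>nrm v = 0\<close>, which does not mean \<open>v = 0\<close> here; a large \<open>t\<close>
  then forces \<open>ip u v = 0\<close>. Otherwise \<open>t = 1 / (nrm v)\<^sup>2\<close> is the
  minimiser.\<close>

lemma cauchy_schwarz: assumes u: "u \<in> V" and v: "v \<in> V" shows "norm (ip u v) \<le> nrm u * nrm v"
proof -
  have *: "0 \<le> (nrm u)\<^sup>2 - 2 * t * (cmod (ip u v))\<^sup>2 + t\<^sup>2 * (cmod (ip u v))\<^sup>2 * (nrm v)\<^sup>2" for t :: real
  proof -
    let ?c = "of_real t * ip u v"
    have "0 \<le> (nrm (u - ?c *s v))\<^sup>2" by simp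
    also have "\<dots> = (nrm u)\<^sup>2 - 2 * Re (cnj ?c * ip u v) + (cmod ?c * nrm v)\<^sup>2"
      using u v by (simp add: nrm_diff_sq ip_scale_right nrm_scale)
    also have "Re (cnj ?c * ip u v) = t * (cmod (ip u v))\<^sup>2"
      by (simp add: cmod_power2) (simp add: power2_eq_square algebra_simps)
    finally show ?thesis by (simp add: norm_mult power_mult_distrib)
  qed
  have "(cmod (ip u v))\<^sup>2 \<le> (nrm u * nrm v)\<^sup>2"
  proof (cases "nrm v = 0")
    case True
    have "(cmod (ip u v))\<^sup>2 = 0"
    proof (rule ccontr)
      assume "(cmod (ip u v))\<^sup>2 \<noteq> 0"
      then have "((nrm u)\<^sup>2 + 1) / (cmod (ip u v))\<^sup>2 * (cmod (ip u v))\<^sup>2 = (nrm u)\<^sup>2 + 1" by (rule nonzero_eq_divide_eq[THEN iffD1]) (rule refl)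
      then have "2 * (((nrm u)\<^sup>2 + 1) / (cmod (ip u v))\<^sup>2) * (cmod (ip u v))\<^sup>2 = 2 * ((nrm u)\<^sup>2 + 1)"
        by (simp only: mult.assoc)
      then have "0 \<le> (nrm u)\<^sup>2 - 2 * ((nrm u)\<^sup>2 + 1)"
        using *[of "((nrm u)\<^sup>2 + 1) / (cmod (ip u v))\<^sup>2"] True by (simp only: True) simp
      then have "(nrm u)\<^sup>2 + 2 \<le> 0" by (simp add: algebra_simps)
      moreover have "0 \<le> (nrm u)\<^sup>2" by (rule zero_le_power2)
      ultimately show False by linarith
    qed
    then show ?thesis by simp
  next
    case False
    then have p: "0 < (nrm v)\<^sup>2" by simp
    have "0 \<le> (nrm u)\<^sup>2 - (cmod (ip u v))\<^sup>2 / (nrm v)\<^sup>2"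
    proof -
      have "(1 / b)\<^sup>2 * a * b = a / b" "2 * (1 / b) * a = 2 * (a / b)" if "b > 0" for a b :: real
        using that by (simp_all add: power2_eq_square)
      note eq = this(1)[OF p] this(2)[OF p]
      show ?thesis using *[of "1 / (nrm v)\<^sup>2"] unfolding eq by linarith
    qed
    then show ?thesis using p by (simp add: field_simps power_mult_distrib)
  qed
  then show ?thesis using u v by (meson mult_nonneg_nonneg nrm_nonneg power2_le_imp_le)
qed

lemma nrm_triangle: assumes "u \<in> V" "v \<in> V" shows "nrm (u + v) \<le> nrm u + nrm v"
proof (rule power2_le_imp_le)
  have "Re (ip u v) \<le> nrm u * nrm v"
    using cauchy_schwarz[OF assms] complex_Re_le_cmod order_trans by blast
  then show "(nrm (u + v))\<^sup>2 \<le> (nrm u + nrm v)\<^sup>2"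
    using assms by (simp add: nrm_add_sq power2_sum)
qed (use assms in simp)

lemma nrm_zero [simp]: "nrm 0 = 0" by (simp add: nrm_def)

lemma nrm_minus_commute: "u \<in> V \<Longrightarrow> v \<in> V \<Longrightarrow> nrm (u - v) = nrm (v - u)"
  using nrm_scale[of "v - u" "-1"] by (simp add: scale_minus_left)

lemma nrm_triangle_minus: "u \<in> V \<Longrightarrow> v \<in> V \<Longrightarrow> nrm (u - v) \<le> nrm u + nrm v"
  using nrm_triangle[of u "(-1) *s v"] nrm_scale[of v "-1"] V_closed(4)[of v "-1"] by simp

lemma nrm_triangle3: "u \<in> V \<Longrightarrow> v \<in> V \<Longrightarrow> w \<in> V \<Longrightarrow> nrm (u - w) \<le> nrm (u - v) + nrm (v - w)"
  using nrm_triangle[of "u - v" "v - w"] by simp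

lemma nrm_sum: "(\<And>i. i \<in> J \<Longrightarrow> x i \<in> V) \<Longrightarrow> nrm (sum x J) \<le> (\<Sum>i\<in>J. nrm (x i))"
proof (induction J rule: infinite_finite_induct)
  case (insert a J)
  then show ?case using nrm_triangle[of "x a" "sum x J"] by (simp add: order_trans)
qed auto

text \<open>Replaces the passage to the quotient by null vectors.\<close>

lemma ip_eq_of_nrm_zero: "u \<in> V \<Longrightarrow> v \<in> V \<Longrightarrow> w \<in> V \<Longrightarrow> nrm (u - v) = 0 \<Longrightarrow> ip u w = ip v w"
  using cauchy_schwarz[of "u - v" w] by (simp add: ip_diff_left)

definition avg :: "'i set \<Rightarrow> ('i \<Rightarrow> 'v) \<Rightarrow> 'v" where
  "avg J x = (1 / of_nat (card J)) *s sum x J"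

lemma avg_V [simp, intro]: "(\<And>i. i \<in> J \<Longrightarrow> x i \<in> V) \<Longrightarrow> avg J x \<in> V"
  by (simp add: avg_def)

lemma avg_cong: "(\<And>i. i \<in> J \<Longrightarrow> x i = y i) \<Longrightarrow> avg J x = avg J y"
  by (simp add: avg_def cong: sum.cong)

lemma avg_diff: "avg J x - avg J y = avg J (\<lambda>i. x i - y i)"
  by (simp add: avg_def sum_subtractf scale_right_diff_distrib)

lemma avg_swap: "avg J (\<lambda>j. avg K (\<lambda>k. x j k)) = avg K (\<lambda>k. avg J (\<lambda>j. x j k))"
  by (simp add: avg_def scale_sum_right mult.commute) (rule sum.swap)

lemma avg_const: "finite J \<Longrightarrow> J \<noteq> {} \<Longrightarrow> avg J (\<lambda>_. v) = v"
  by (simp add: avg_def sum_constant_scale scale_scale)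

lemma ip_avg_left: "(\<And>i. i \<in> J \<Longrightarrow> x i \<in> V) \<Longrightarrow> w \<in> V \<Longrightarrow> ip (avg J x) w = (\<Sum>i\<in>J. ip (x i) w) / of_nat (card J)"
  by (simp add: avg_def ip_scale_left ip_sum_left)

lemma ip_avg_right: "(\<And>i. i \<in> J \<Longrightarrow> x i \<in> V) \<Longrightarrow> w \<in> V \<Longrightarrow> ip w (avg J x) = (\<Sum>i\<in>J. ip w (x i)) / of_nat (card J)"
  by (simp add: avg_def ip_scale_right ip_sum_right)

lemma nrm_avg: "(\<And>i. i \<in> J \<Longrightarrow> x i \<in> V) \<Longrightarrow> nrm (avg J x) \<le> (\<Sum>i\<in>J. nrm (x i)) / real (card J)"
  using nrm_sum[of J x] by (simp add: avg_def nrm_scale norm_divide divide_right_mono)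

lemma nrm_avg_le:
  assumes "finite J" "J \<noteq> {}" "\<And>i. i \<in> J \<Longrightarrow> x i \<in> V" "\<And>i. i \<in> J \<Longrightarrow> nrm (x i) \<le> C"
  shows "nrm (avg J x) \<le> C"
proof -
  have "(\<Sum>i\<in>J. nrm (x i)) \<le> real (card J) * C" by (rule sum_bounded_above) (rule assms(4))
  then have "(\<Sum>i\<in>J. nrm (x i)) / real (card J) \<le> C" using assms by (simp add: field_simps card_gt_0_iff)
  then show ?thesis using nrm_avg[of J x] assms(3) by fastforce
qed

lemma nrm_avg_sq:
  assumes "finite J" "J \<noteq> {}" "\<And>i. i \<in> J \<Longrightarrow> x i \<in> V"
  shows "(nrm (avg J x))\<^sup>2 \<le> (\<Sum>i\<in>J. (nrm (x i))\<^sup>2) / real (card J)"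
proof -
  have "(nrm (avg J x))\<^sup>2 \<le> ((\<Sum>i\<in>J. nrm (x i)) / real (card J))\<^sup>2"
    using nrm_avg[OF assms(3)] by (intro power_mono) (use assms(3) in auto)
  also have "\<dots> \<le> (real (card J) * (\<Sum>i\<in>J. (nrm (x i))\<^sup>2)) / (real (card J))\<^sup>2"
    unfolding power_divide
  proof (intro divide_right_mono)
    show "(\<Sum>i\<in>J. nrm (x i))\<^sup>2 \<le> real (card J) * (\<Sum>i\<in>J. (nrm (x i))\<^sup>2)"
      using Cauchy_Schwarz_ineq_sum[of "\<lambda>_. 1" "\<lambda>i. nrm (x i)" J] by simp
  qed simp
  also have "\<dots> = (\<Sum>i\<in>J. (nrm (x i))\<^sup>2) / real (card J)"
    using assms by (simp add: power2_eq_square)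
  finally show ?thesis .
qed

text \<open>The vector-valued form of asymptotic invariance follows from the scalar one by pairing with the
  difference itself.\<close>
lemma avg_shift:
  assumes ai: "asymp_inv I (\<gamma> :: 'i \<Rightarrow> 'g::ab_group_add)"
    and u: "\<And>g. u g \<in> V" and C: "\<And>g. nrm (u g) \<le> C"
  shows "(\<lambda>N. nrm (avg (I N) (\<lambda>i. u (\<gamma> i)) - avg (I N) (\<lambda>i. u (\<gamma> i + h)))) \<longlonglongrightarrow> 0"
proof -
  obtain \<epsilon> where e: "\<epsilon> \<longlonglongrightarrow> 0" and ep: "\<And>N. 0 \<le> \<epsilon> N" and b: "\<forall>N (b :: 'g \<Rightarrow> complex) D. (\<forall>x. norm (b x) \<le> D) \<longrightarrow>
       norm (\<Sum>i\<in>I N. b (\<gamma> i) - b (\<gamma> i + h)) \<le> \<epsilon> N * D * real (card (I N))"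
    by (rule asymp_inv_bound[OF ai, where h = h]) (rule that, assumption+)
  have C0: "0 \<le> C" using C[of 0] u[of 0] nrm_nonneg[of "u 0"] by linarith
  have **: "nrm (avg (I N) (\<lambda>i. u (\<gamma> i)) - avg (I N) (\<lambda>i. u (\<gamma> i + h))) \<le> \<epsilon> N * C" for N
  proof -
    define w where "w = avg (I N) (\<lambda>i. u (\<gamma> i)) - avg (I N) (\<lambda>i. u (\<gamma> i + h))"
    have w: "w \<in> V" using u by (simp add: w_def)
    have "norm (ip (u g) w) \<le> C * nrm w" for g
      using cauchy_schwarz[OF u w, of g] C[of g] w by (meson mult_right_mono nrm_nonneg order_trans)
    then have 1: "norm (\<Sum>i\<in>I N. ip (u (\<gamma> i)) w - ip (u (\<gamma> i + h)) w) \<le> \<epsilon> N * (C * nrm w) * real (card (I N))"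
      using b[rule_format, of "\<lambda>g. ip (u g) w" "C * nrm w" N] by blast
    have "ip w w = (\<Sum>i\<in>I N. ip (u (\<gamma> i)) w - ip (u (\<gamma> i + h)) w) / of_nat (card (I N))"
      using u w by (subst (1) w_def) (simp add: ip_diff_left ip_avg_left diff_divide_distrib sum_subtractf)
    then have "(nrm w)\<^sup>2 = norm (\<Sum>i\<in>I N. ip (u (\<gamma> i)) w - ip (u (\<gamma> i + h)) w) / card (I N)"
      using ip_self[OF w] by (metis norm_divide norm_of_nat norm_of_real abs_power2)
    also have "\<dots> \<le> \<epsilon> N * C * nrm w"
      using 1 asymp_inv_finite(3)[OF ai, of N] by (simp add: field_simps)
    finally have *: "nrm w * nrm w \<le> (\<epsilon> N * C) * nrm w" by (simp add: power2_eq_square)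
    have "nrm w \<le> \<epsilon> N * C"
    proof (cases "nrm w = 0")
      case True
      then show ?thesis using ep C0 by simp
    next
      case False
      then have "0 < nrm w" using nrm_nonneg[OF w] by simp
      then show ?thesis using * by simp
    qed
    then show ?thesis by (simp add: w_def)
  qed
  have "(\<lambda>N. \<epsilon> N * C) \<longlonglongrightarrow> 0 * C" by (intro tendsto_intros e)
  then have *: "(\<lambda>N. \<epsilon> N * C) \<longlonglongrightarrow> 0" by simp
  show ?thesis
    by (rule null_squeeze[OF * **]) (use u in simp)
qed

text \<open>By \<open>avg_shift\<close>, averaging each term over its translates by a finite window
  \<open>E\<close> changes the average by o(1), and Jensen's inequality then moves the square
  inside. The squared window averages stay unexpanded here; their correlations are computed where
  the vectors are products.\<close>

lemma van_der_corput:
  assumes ai: "asymp_inv I (\<gamma> :: 'i \<Rightarrow> 'g::ab_group_add)"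
    and u: "\<And>g. u g \<in> V" and C: "\<And>g. nrm (u g) \<le> C"
    and E: "\<And>e. e > 0 \<Longrightarrow> \<exists>E. finite E \<and> E \<noteq> {} \<and> (\<forall>\<^sub>F N in sequentially.
        (\<Sum>i\<in>I N. (nrm (avg E (\<lambda>h. u (\<gamma> i + h))))\<^sup>2) / real (card (I N)) \<le> e)"
  shows "(\<lambda>N. nrm (avg (I N) (\<lambda>i. u (\<gamma> i)))) \<longlonglongrightarrow> 0"
proof (rule tendsto_0_le_approx)
  show "0 \<le> nrm (avg (I n) (\<lambda>i. u (\<gamma> i)))" for n using u by simp
  fix e :: real assume e: "e > 0"
  then obtain E where E: "finite E" "E \<noteq> {}" and ev: "\<forall>\<^sub>F N in sequentially.
        (\<Sum>i\<in>I N. (nrm (avg E (\<lambda>h. u (\<gamma> i + h))))\<^sup>2) / real (card (I N)) \<le> (e/2)\<^sup>2"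
    using assms(4)[of "(e/2)\<^sup>2"] by auto
  have sh: "(\<lambda>N. nrm (avg (I N) (\<lambda>i. u (\<gamma> i)) - avg (I N) (\<lambda>i. u (\<gamma> i + h)))) \<longlonglongrightarrow> 0" for h
    by (rule avg_shift[OF ai u C])
  have "(\<lambda>N. (\<Sum>h\<in>E. nrm (avg (I N) (\<lambda>i. u (\<gamma> i)) - avg (I N) (\<lambda>i. u (\<gamma> i + h)))) / real (card E)) \<longlonglongrightarrow> (\<Sum>h\<in>E. 0) / real (card E)"
    by (intro tendsto_intros sh) (use E in simp)
  then have "\<forall>\<^sub>F N in sequentially. (\<Sum>h\<in>E. nrm (avg (I N) (\<lambda>i. u (\<gamma> i)) - avg (I N) (\<lambda>i. u (\<gamma> i + h)))) / real (card E) < e/2"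
    by (rule order_tendstoD(2)) (use e in simp)
  with ev show "\<forall>\<^sub>F N in sequentially. nrm (avg (I N) (\<lambda>i. u (\<gamma> i))) \<le> e"
  proof eventually_elim
    case (elim N)
    let ?a = "avg (I N) (\<lambda>i. u (\<gamma> i))" and ?b = "avg (I N) (\<lambda>i. avg E (\<lambda>h. u (\<gamma> i + h)))"
    \<comment> \<open>Written as the average over \<open>E\<close> of the constant
      \<open>?a\<close>, with the two averages in \<open>?b\<close> swapped, the difference is an
      average of the shift errors.\<close>
    have "?a - ?b = avg E (\<lambda>h. ?a - avg (I N) (\<lambda>i. u (\<gamma> i + h)))"
      using E by (subst avg_swap) (simp add: avg_const flip: avg_diff)
    then have "nrm (?a - ?b) \<le> e/2"
      using order_trans[OF nrm_avg less_imp_le[OF elim(2)]] u by simp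
    moreover have "(nrm ?b)\<^sup>2 \<le> (e/2)\<^sup>2"
      by (rule order_trans[OF nrm_avg_sq elim(1)]) (use asymp_inv_finite[OF ai] u in auto)
    then have "nrm ?b \<le> e/2" by (rule power2_le_imp_le) (use e in simp)
    moreover have "nrm ?a \<le> nrm (?a - ?b) + nrm ?b"
      using nrm_triangle[of "?a - ?b" ?b] u by simp
    ultimately show ?case by linarith
  qed
qed

section \<open>Orthonormal systems, Bessel's inequality and Gram-Schmidt\<close>

definition orthonormal :: "(nat \<Rightarrow> 'v) \<Rightarrow> nat \<Rightarrow> bool" where
  "orthonormal e k \<longleftrightarrow> (\<forall>i<k. e i \<in> V) \<and> (\<forall>i<k. \<forall>j<k. ip (e i) (e j) = (if i = j then 1 else 0))"

definition resid :: "(nat \<Rightarrow> 'v) \<Rightarrow> nat \<Rightarrow> 'v \<Rightarrow> 'v" where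
  "resid e k v = v - (\<Sum>i<k. ip v (e i) *s e i)"

lemma ip_resid:
  assumes "orthonormal e k" "v \<in> V" "j < k"
  shows "ip (resid e k v) (e j) = 0"
proof -
  have V: "\<And>i. i < k \<Longrightarrow> e i \<in> V" using assms by (simp add: orthonormal_def)
  have S: "(\<Sum>i<k. ip v (e i) *s e i) \<in> V" using V by (intro V_closed) auto
  have "ip (resid e k v) (e j) = ip v (e j) - (\<Sum>i<k. ip v (e i) * ip (e i) (e j))"
    using assms V S by (auto simp: resid_def ip_diff_left ip_sum_left ip_scale_left intro!: sum.cong)
  also have "(\<Sum>i<k. ip v (e i) * ip (e i) (e j)) = (\<Sum>i<k. if i = j then ip v (e j) else 0)"
    by (rule sum.cong) (use assms in \<open>auto simp: orthonormal_def\<close>)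
  finally show ?thesis using assms by simp
qed

lemma resid_V: "orthonormal e k \<Longrightarrow> v \<in> V \<Longrightarrow> resid e k v \<in> V"
  unfolding resid_def orthonormal_def by (intro V_closed) auto

lemma bessel:
  assumes o: "orthonormal e k" and v: "v \<in> V"
  shows "(\<Sum>i<k. (cmod (ip v (e i)))\<^sup>2) \<le> (nrm v)\<^sup>2"
proof -
  have V: "\<And>i. i < k \<Longrightarrow> e i \<in> V" using o by (simp add: orthonormal_def)
  let ?y = "resid e k v"
  have y: "?y \<in> V" using resid_V[OF assms] .
  have S: "(\<Sum>i<k. ip v (e i) *s e i) \<in> V" using V by (intro V_closed) auto
  have "ip ?y ?y = ip ?y v - (\<Sum>i<k. cnj (ip v (e i)) * ip ?y (e i))"
    using y v V S by (subst (2) resid_def) (auto simp: ip_diff_right ip_sum_right ip_scale_right intro!: sum.cong)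
  also have "(\<Sum>i<k. cnj (ip v (e i)) * ip ?y (e i)) = 0"
    by (rule sum.neutral) (use ip_resid[OF o v] in auto)
  also have "ip ?y v = ip v v - (\<Sum>i<k. ip v (e i) * ip (e i) v)"
    using v V S by (auto simp: resid_def ip_diff_left ip_sum_left ip_scale_left intro!: sum.cong)
  also have "(\<Sum>i<k. ip v (e i) * ip (e i) v) = of_real (\<Sum>i<k. (cmod (ip v (e i)))\<^sup>2)"
    unfolding of_real_sum
  proof (rule sum.cong[OF refl])
    fix i assume "i \<in> {..<k}"
    then have "ip (e i) v = cnj (ip v (e i))" using ip_herm[of v "e i"] v V by simp
    then show "ip v (e i) * ip (e i) v = of_real ((cmod (ip v (e i)))\<^sup>2)" by (simp only: complex_norm_square)
  qed
  finally have "(nrm ?y)\<^sup>2 = (nrm v)\<^sup>2 - (\<Sum>i<k. (cmod (ip v (e i)))\<^sup>2)"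
    by (simp add: nrm_sq y v)
  then show ?thesis by (smt (verit) zero_le_power2)
qed

text \<open>One Gram-Schmidt step. Independence of \<open>v\<close> must be positivity of the
  residual norm: a nonzero residual could still be a null vector.\<close>

lemma orthonormal_extend:
  assumes o: "orthonormal e k" and v: "v \<in> V" and p: "nrm (resid e k v) > 0"
  shows "orthonormal (e(k := (1 / of_real (nrm (resid e k v))) *s resid e k v)) (Suc k)"
proof -
  let ?y = "resid e k v"
  have V: "\<And>i. i < k \<Longrightarrow> e i \<in> V" using o by (simp add: orthonormal_def)
  have y: "?y \<in> V" using resid_V[OF o v] .
  have 1: "ip ?y (e i) = 0" "ip (e i) ?y = 0" if "i < k" for i
    using ip_resid[OF o v that] ip_herm[of ?y "e i"] y V that by auto
  have 2: "ip ((1 / of_real (nrm ?y)) *s ?y) ((1 / of_real (nrm ?y)) *s ?y) = 1"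
    using p y by (simp add: ip_self nrm_scale norm_divide)
  show ?thesis
    unfolding orthonormal_def
    using o V y 1 2 by (auto simp: less_Suc_eq orthonormal_def ip_scale_left ip_scale_right)
qed

end

section \<open>Unitary actions of an abelian group and the mean ergodic theorem\<close>

locale unitary_action = complex_semi_inner scale V ip
  for scale :: "complex \<Rightarrow> 'v::ab_group_add \<Rightarrow> 'v" (infixr \<open>*s\<close> 75) and V ip +
  fixes U :: "'g::{countable,ab_group_add} \<Rightarrow> 'v \<Rightarrow> 'v"
  assumes U_V [simp, intro]: "v \<in> V \<Longrightarrow> U g v \<in> V"
    and U_add: "u \<in> V \<Longrightarrow> v \<in> V \<Longrightarrow> U g (u + v) = U g u + U g v"
    and U_scale: "v \<in> V \<Longrightarrow> U g (c *s v) = c *s U g v"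
    and U_ip [simp]: "u \<in> V \<Longrightarrow> v \<in> V \<Longrightarrow> ip (U g u) (U g v) = ip u v"
    and U_plus: "v \<in> V \<Longrightarrow> U (g + h) v = U g (U h v)"
    and U_0 [simp]: "v \<in> V \<Longrightarrow> U 0 v = v"
begin

lemma nrm_U [simp]: "v \<in> V \<Longrightarrow> nrm (U g v) = nrm v"
  by (simp add: nrm_def)

lemma U_diff: "u \<in> V \<Longrightarrow> v \<in> V \<Longrightarrow> U g (u - v) = U g u - U g v"
  using U_add[of "u - v" v g] by simp

lemma U_zero [simp]: "U g 0 = 0"
  using U_scale[of 0 g 0] by simp

lemma U_sum: "(\<And>i. i \<in> J \<Longrightarrow> x i \<in> V) \<Longrightarrow> U g (sum x J) = (\<Sum>i\<in>J. U g (x i))"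
  by (induction J rule: infinite_finite_induct) (auto simp: U_add)

lemma U_avg: "(\<And>i. i \<in> J \<Longrightarrow> x i \<in> V) \<Longrightarrow> U g (avg J x) = avg J (\<lambda>i. U g (x i))"
  by (simp add: avg_def U_scale U_sum)

lemma U_commute: "v \<in> V \<Longrightarrow> U g (U h v) = U h (U g v)"
  by (metis U_plus add.commute)

lemma ip_U_swap: "u \<in> V \<Longrightarrow> v \<in> V \<Longrightarrow> ip (U g u) v = ip u (U (- g) v)"
  using U_ip[of u "U (- g) v" g] U_plus[of v g "- g"] by (metis U_0 U_V add.right_inverse)

text \<open>Stands in for the closed convex hull of the orbit of \<open>v\<close>: it contains
  \<open>v\<close> and is stable under the action and under finite averages, and any member may
  replace \<open>v\<close> when the averages are computed.\<close>

definition equi_avg :: "(nat \<Rightarrow> 'i set) \<Rightarrow> ('i \<Rightarrow> 'g) \<Rightarrow> 'v \<Rightarrow> 'v set" where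
  "equi_avg I \<gamma> v = {c \<in> V. (\<lambda>N. nrm (avg (I N) (\<lambda>i. U (\<gamma> i) v) - avg (I N) (\<lambda>i. U (\<gamma> i) c))) \<longlonglongrightarrow> 0}"

lemma equi_avg_U:
  assumes ai: "asymp_inv I \<gamma>" and v: "v \<in> V" and c: "c \<in> equi_avg I \<gamma> v"
  shows "U h c \<in> equi_avg I \<gamma> v"
proof -
  let ?A = "\<lambda>N w. avg (I N) (\<lambda>i. U (\<gamma> i) w)"
  have cV: "c \<in> V" and lim: "(\<lambda>N. nrm (?A N v - ?A N c)) \<longlonglongrightarrow> 0" using c by (auto simp: equi_avg_def)
  have "(\<lambda>N. nrm (?A N c - avg (I N) (\<lambda>i. U (\<gamma> i + h) c))) \<longlonglongrightarrow> 0"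
    by (rule avg_shift[OF ai, where C = "nrm c"]) (use cV in auto)
  then have "(\<lambda>N. nrm (?A N v - ?A N c) + nrm (?A N c - avg (I N) (\<lambda>i. U (\<gamma> i + h) c))) \<longlonglongrightarrow> 0 + 0"
    by (intro tendsto_intros lim)
  then have *: "(\<lambda>N. nrm (?A N v - ?A N c) + nrm (?A N c - avg (I N) (\<lambda>i. U (\<gamma> i + h) c))) \<longlonglongrightarrow> 0" by simp
  have **: "nrm (?A N v - ?A N (U h c)) \<le> nrm (?A N v - ?A N c) + nrm (?A N c - avg (I N) (\<lambda>i. U (\<gamma> i + h) c))" for N
    using nrm_triangle3[of "?A N v" "?A N c" "?A N (U h c)"] cV v by (simp add: U_plus)
  have "(\<lambda>N. nrm (?A N v - ?A N (U h c))) \<longlonglongrightarrow> 0"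
    by (rule null_squeeze[OF * **]) (use cV v in simp)
  then show ?thesis using cV by (simp add: equi_avg_def)
qed

lemma equi_avg_avg:
  assumes v: "v \<in> V" and J: "finite J" "J \<noteq> {}" and c: "\<And>j. j \<in> J \<Longrightarrow> x j \<in> equi_avg I \<gamma> v"
  shows "avg J x \<in> equi_avg I \<gamma> v"
proof -
  let ?A = "\<lambda>N w. avg (I N) (\<lambda>i. U (\<gamma> i) w)"
  have cV: "x j \<in> V" and lim: "(\<lambda>N. nrm (?A N v - ?A N (x j))) \<longlonglongrightarrow> 0" if "j \<in> J" for j
    using c[OF that] by (auto simp: equi_avg_def)
  have "(\<lambda>N. (\<Sum>j\<in>J. nrm (?A N v - ?A N (x j))) / real (card J)) \<longlonglongrightarrow> (\<Sum>j\<in>J. 0) / real (card J)"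
    by (intro tendsto_intros lim) (use J in auto)
  then have *: "(\<lambda>N. (\<Sum>j\<in>J. nrm (?A N v - ?A N (x j))) / real (card J)) \<longlonglongrightarrow> 0" by simp
  have **: "nrm (?A N v - ?A N (avg J x)) \<le> (\<Sum>j\<in>J. nrm (?A N v - ?A N (x j))) / real (card J)" for N
  proof -
    have "?A N (avg J x) = avg J (\<lambda>j. ?A N (x j))"
      using cV by (subst avg_swap) (intro avg_cong, simp add: U_avg)
    then have "?A N v - ?A N (avg J x) = avg J (\<lambda>j. ?A N v - ?A N (x j))"
      using J by (simp add: avg_const flip: avg_diff)
    then show ?thesis using nrm_avg[of J "\<lambda>j. ?A N v - ?A N (x j)"] cV v by simp
  qed
  have "(\<lambda>N. nrm (?A N v - ?A N (avg J x))) \<longlonglongrightarrow> 0"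
    by (rule null_squeeze[OF * **]) (use cV v in \<open>auto intro!: nrm_nonneg\<close>)
  then show ?thesis using cV by (simp add: equi_avg_def)
qed

text \<open>A near-minimiser of the norm among the vectors with the same averages as \<open>v\<close> is almost fixed by
  averaging (parallelogram law), hence is an approximate limit of the averages of \<open>v\<close>.\<close>
lemma mean_ergodic_Cauchy:
  assumes ai: "asymp_inv I \<gamma>" and v: "v \<in> V" and e: "e > 0"
  shows "\<exists>N0. \<forall>N\<ge>N0. \<forall>M\<ge>N0. nrm (avg (I N) (\<lambda>i. U (\<gamma> i) v) - avg (I M) (\<lambda>i. U (\<gamma> i) v)) \<le> e"
proof -
  let ?A = "\<lambda>N w. avg (I N) (\<lambda>i. U (\<gamma> i) w)"
  let ?D = "equi_avg I \<gamma> v"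
  have vD: "v \<in> ?D" using v by (simp add: equi_avg_def)
  define d where "d = Inf ((\<lambda>c. (nrm c)\<^sup>2) ` ?D)"
  have bdd: "bdd_below ((\<lambda>c. (nrm c)\<^sup>2) ` ?D)" by (rule bdd_belowI[of _ 0]) auto
  have d_le: "d \<le> (nrm c)\<^sup>2" if "c \<in> ?D" for c
    unfolding d_def using bdd that by (rule cINF_lower)
  \<comment> \<open>The parallelogram law below bounds a squared distance by
    \<open>4 * \<eta>\<close>, which is \<open>(e/4)\<^sup>2\<close>.\<close>
  define \<eta> where "\<eta> = (e/8)\<^sup>2"
  have "\<eta> > 0" using e by (simp add: \<eta>_def)
  then obtain c where c: "c \<in> ?D" "(nrm c)\<^sup>2 < d + \<eta>"
    using cInf_lessD[of "(\<lambda>c. (nrm c)\<^sup>2) ` ?D" "d + \<eta>"] vD d_def by auto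
  have cV: "c \<in> V" and lim: "(\<lambda>N. nrm (?A N v - ?A N c)) \<longlonglongrightarrow> 0" using c by (auto simp: equi_avg_def)
  have fin: "finite (I N)" "I N \<noteq> {}" for N using asymp_inv_finite[OF ai] by auto
  have AD: "?A N c \<in> ?D" for N
    by (rule equi_avg_avg[OF v fin]) (use equi_avg_U[OF ai v c(1)] in auto)
  \<comment> \<open>Valid for every \<open>N\<close>, large or not: averaging does not increase the
    norm, and both \<open>?A N c\<close> and its midpoint with \<open>c\<close> remain in the set
    over which the infimum is taken.\<close>
  have "nrm (?A N c - c) \<le> e/4" for N
  proof -
    let ?a = "?A N c"
    have a: "?a \<in> V" "nrm ?a \<le> nrm c" using cV nrm_avg_le[OF fin, of N "\<lambda>i. U (\<gamma> i) c"] by auto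
    \<comment> \<open>The midpoint is an average over the two booleans, so
      \<open>equi_avg_avg\<close> covers it.\<close>
    have "(1/2) *s (?a + c) \<in> ?D"
      using equi_avg_avg[OF v, of "UNIV :: bool set" "\<lambda>b. if b then ?a else c" I \<gamma>] AD c(1)
      by (simp add: avg_def UNIV_bool add.commute)
    from d_le[OF this] have "d \<le> (nrm (?a + c))\<^sup>2 / 4" using a cV by (simp add: nrm_scale power_divide norm_divide)
    moreover have "(nrm (?a - c))\<^sup>2 + (nrm (?a + c))\<^sup>2 = 2 * (nrm ?a)\<^sup>2 + 2 * (nrm c)\<^sup>2"
      using a cV by (simp add: nrm_add_sq nrm_diff_sq)
    moreover have "(nrm ?a)\<^sup>2 \<le> (nrm c)\<^sup>2" using a by (intro power_mono) auto
    ultimately have "(nrm (?a - c))\<^sup>2 \<le> 4 * \<eta>" using c(2) by linarith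
    also have "\<dots> = (e/4)\<^sup>2" by (simp add: \<eta>_def power2_eq_square)
    finally show ?thesis by (rule power2_le_imp_le) (use e in simp)
  qed
  have "\<forall>\<^sub>F N in sequentially. nrm (?A N v - ?A N c) < e/4"
    by (rule order_tendstoD(2)[OF lim]) (use e in simp)
  then obtain N0 where N0: "\<And>N. N \<ge> N0 \<Longrightarrow> nrm (?A N v - ?A N c) < e/4" by (auto simp: eventually_sequentially)
  have *: "nrm (?A N v - c) \<le> e/2" if "N \<ge> N0" for N
  proof -
    have "nrm (?A N v - c) \<le> nrm (?A N v - ?A N c) + nrm (?A N c - c)"
      by (rule nrm_triangle3) (use cV v in auto)
    then show ?thesis using N0[OF that] \<open>\<And>N. nrm (?A N c - c) \<le> e/4\<close>[of N] by simp
  qed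
  have "nrm (?A N v - ?A M v) \<le> e" if "N \<ge> N0" "M \<ge> N0" for N M
    using *[OF that(1)] *[OF that(2)] nrm_triangle3[of "?A N v" c "?A M v"] nrm_minus_commute[of "?A M v" c] cV v by simp
  then show ?thesis by blast
qed

lemma mean_ergodic_limit_invariant:
  assumes ai: "asymp_inv I \<gamma>" and v: "v \<in> V" and l: "l \<in> V"
    and lim: "(\<lambda>N. nrm (avg (I N) (\<lambda>i. U (\<gamma> i) v) - l)) \<longlonglongrightarrow> 0"
  shows "nrm (U h l - l) = 0"
proof -
  let ?A = "\<lambda>N. avg (I N) (\<lambda>i. U (\<gamma> i) v)"
  define \<epsilon> where "\<epsilon> = (\<lambda>N. nrm (?A N - avg (I N) (\<lambda>i. U (\<gamma> i + h) v)))"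
  have ep: "\<epsilon> \<longlonglongrightarrow> 0" unfolding \<epsilon>_def
    by (rule avg_shift[OF ai, where C = "nrm v"]) (use v in auto)
  have "nrm (U h l - l) \<le> \<epsilon> N + 2 * nrm (?A N - l)" for N
  proof -
    have "avg (I N) (\<lambda>i. U (\<gamma> i + h) v) = U h (?A N)"
      using v by (subst U_avg) (auto intro!: avg_cong simp: add.commute U_plus)
    then have "nrm (U h (?A N) - ?A N) \<le> \<epsilon> N" using v by (simp add: nrm_minus_commute \<epsilon>_def)
    moreover have "nrm (U h l - U h (?A N)) = nrm (?A N - l)"
      using l v nrm_U[of "?A N - l" h] by (simp add: U_diff nrm_minus_commute)
    moreover have "nrm (U h l - l) \<le> nrm (U h l - U h (?A N)) + nrm (U h (?A N) - l)"
      "nrm (U h (?A N) - l) \<le> nrm (U h (?A N) - ?A N) + nrm (?A N - l)"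
      using l v by (auto intro!: nrm_triangle3)
    ultimately show ?thesis by linarith
  qed
  moreover have "(\<lambda>N. \<epsilon> N + 2 * nrm (?A N - l)) \<longlonglongrightarrow> 0 + 2 * 0"
    by (intro tendsto_intros ep lim)
  ultimately have "nrm (U h l - l) \<le> 0"
    by (intro LIMSEQ_le_const[of "\<lambda>N. \<epsilon> N + 2 * nrm (?A N - l)"]) auto
  then show ?thesis using l nrm_nonneg[of "U h l - l"] by (simp add: order_antisym)
qed

end

section \<open>Eigenvectors of the limit operator\<close>

context complex_semi_inner
begin

lemma nrm_pos: "v \<in> V \<Longrightarrow> nrm v \<noteq> 0 \<Longrightarrow> 0 < nrm v"
  by (simp add: less_le)

lemma nrm_zeroI: "v \<in> V \<Longrightarrow> nrm v \<le> 0 \<Longrightarrow> nrm v = 0"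
  by (meson nrm_nonneg order_antisym)

end

context unitary_action
begin

section \<open>Invariant subspaces, polynomials in one operator, common eigenvectors\<close>

definition inv_sub :: "'v set \<Rightarrow> bool" where
  "inv_sub W \<longleftrightarrow> W \<subseteq> V \<and> subspace W \<and> (\<forall>g. \<forall>w\<in>W. U g w \<in> W)"

text \<open>This is \<open>p(U g) v\<close>. Annihilating polynomials of a vector replace the
  characteristic polynomial, for which a basis modulo null vectors would have to be set up.\<close>

definition pact :: "'g \<Rightarrow> complex poly \<Rightarrow> 'v \<Rightarrow> 'v" where
  "pact g p v = (\<Sum>i\<le>degree p. coeff p i *s (U g ^^ i) v)"

lemma pact_bound: "degree p \<le> n \<Longrightarrow> pact g p v = (\<Sum>i\<le>n. coeff p i *s (U g ^^ i) v)"
  unfolding pact_def by (rule sum.mono_neutral_left) (auto simp: coeff_eq_0)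

lemma pact_add: "pact g (p + q) v = pact g p v + pact g q v"
proof -
  let ?n = "max (degree p) (degree q)"
  have "degree (p + q) \<le> ?n" by (rule degree_add_le) auto
  then show ?thesis
    by (simp add: pact_bound[of _ ?n] scale_left_distrib sum.distrib)
qed

lemma pact_smult: "pact g (smult c p) v = c *s pact g p v"
  using pact_bound[OF degree_smult_le[of c p], of g v] by (simp add: pact_def scale_sum_right)

lemma pact_diff: "pact g (p - q) v = pact g p v - pact g q v"
  using pact_add[of g p "smult (-1) q" v] pact_smult[of g "-1" q v] by simp

lemma pact_0: "pact g 0 v = 0"
  by (simp add: pact_def)

lemma pact_sum: "pact g (sum P J) v = (\<Sum>i\<in>J. pact g (P i) v)"
  by (induction J rule: infinite_finite_induct) (auto simp: pact_add pact_0)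

lemma pact_monom: "pact g (monom 1 k) v = (U g ^^ k) v"
proof -
  have "pact g (monom 1 k) v = (\<Sum>i\<le>k. (if i = k then (U g ^^ k) v else 0))"
    unfolding pact_bound[OF degree_monom_le[of 1 k]] by (rule sum.cong) auto
  then show ?thesis by simp
qed

lemma inv_sub_funpow: "inv_sub W \<Longrightarrow> v \<in> W \<Longrightarrow> (U g ^^ i) v \<in> W"
  by (induction i) (auto simp: inv_sub_def)

lemma inv_sub_pact: "inv_sub W \<Longrightarrow> v \<in> W \<Longrightarrow> pact g p v \<in> W"
  unfolding pact_def using inv_sub_funpow[of W v _ g]
  by (auto simp: inv_sub_def intro!: subspace_sum subspace_scale)

lemma inv_sub_V: "inv_sub V"
  using V_subspace by (auto simp: inv_sub_def)

lemma pact_pCons: assumes v: "v \<in> V" shows "pact g (pCons 0 p) v = U g (pact g p v)"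
proof -
  have fV: "(U g ^^ i) v \<in> V" for i using inv_sub_funpow[OF inv_sub_V v] .
  have "pact g (pCons 0 p) v = (\<Sum>i\<le>Suc (degree p). coeff (pCons 0 p) i *s (U g ^^ i) v)"
    by (rule pact_bound) (rule degree_pCons_le)
  also have "\<dots> = (\<Sum>i\<le>degree p. coeff p i *s U g ((U g ^^ i) v))"
    by (subst sum.atMost_Suc_shift) simp
  also have "\<dots> = U g (pact g p v)"
    unfolding pact_def using fV by (simp add: U_sum U_scale)
  finally show ?thesis .
qed

lemma pact_linear_factor:
  "v \<in> V \<Longrightarrow> pact g ([:- c, 1:] * q) v = U g (pact g q v) - c *s pact g q v"
proof -
  assume v: "v \<in> V"
  have "[:- c, 1:] * q = pCons 0 q - smult c q" by simp
  then show ?thesis using v by (simp only: pact_diff pact_pCons pact_smult)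
qed

text \<open>Gram-Schmidt on \<open>v\<close>, \<open>U g v\<close>, and so on, carried out on the
  polynomials. At stage \<open>k\<close> the residual is \<open>p(U g) v\<close> with
  \<open>p\<close> monic of degree \<open>k\<close>, because only polynomials of smaller degree are
  subtracted; hence it is not null.\<close>

lemma gram_schmidt_poly:
  assumes v: "v \<in> V" and nz: "\<And>p. p \<noteq> 0 \<Longrightarrow> degree p < k \<Longrightarrow> nrm (pact g p v) \<noteq> 0"
  shows "\<exists>P. (\<forall>i<k. degree (P i) < k) \<and> orthonormal (\<lambda>i. pact g (P i) v) k"
  using nz
proof (induction k)
  case 0
  then show ?case by (simp add: orthonormal_def)
next
  case (Suc k)
  then obtain P where P: "\<And>i. i < k \<Longrightarrow> degree (P i) < k" and o: "orthonormal (\<lambda>i. pact g (P i) v) k"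
    by (metis less_SucI)
  let ?e = "\<lambda>i. pact g (P i) v"
  let ?v = "(U g ^^ k) v"
  have vV: "?v \<in> V" using inv_sub_funpow[OF inv_sub_V v] .
  define p where "p = monom 1 k - (\<Sum>i<k. smult (ip ?v (?e i)) (P i))"
  have r: "resid ?e k ?v = pact g p v"
    by (simp add: resid_def p_def pact_diff pact_monom pact_sum pact_smult)
  have "coeff (P i) k = 0" if "i < k" for i using P[OF that] coeff_eq_0 by blast
  then have "coeff p k = 1" by (simp add: p_def coeff_sum)
  then have "p \<noteq> 0" by auto
  moreover have d: "degree p \<le> k"
    unfolding p_def
    by (intro degree_diff_le degree_monom_le degree_sum_le order_trans[OF degree_smult_le]) (use P in \<open>auto simp: less_imp_le\<close>)
  ultimately have "nrm (pact g p v) \<noteq> 0" using Suc.prems[of p] by simp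
  then have pos: "nrm (resid ?e k ?v) > 0" using nrm_pos[OF resid_V[OF o vV]] r by simp
  let ?P = "P(k := smult (1 / of_real (nrm (pact g p v))) p)"
  have "(\<lambda>i. pact g (?P i) v) = ?e(k := (1 / of_real (nrm (resid ?e k ?v))) *s resid ?e k ?v)"
    unfolding r by (auto simp: pact_smult)
  then have "orthonormal (\<lambda>i. pact g (?P i) v) (Suc k)"
    using orthonormal_extend[OF o vV pos] by simp
  moreover have "\<forall>i<Suc k. degree (?P i) < Suc k"
    using P d degree_smult_le[of _ p] by (auto simp: less_Suc_eq intro: le_less_trans)
  ultimately show ?case by blast
qed

text \<open>The bound on orthonormal systems forces a nonzero polynomial to annihilate
  \<open>v\<close> up to a null vector. Take one of least degree and split off a root
  \<open>c\<close>: by minimality the cofactor applied to \<open>v\<close> is not null, and it is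
  the eigenvector.\<close>

lemma eigenvector_in_finite_dim:
  assumes W: "inv_sub W" and v: "v \<in> W" "nrm v \<noteq> 0"
    and dim: "\<And>e k. orthonormal e k \<Longrightarrow> (\<And>i. i < k \<Longrightarrow> e i \<in> W) \<Longrightarrow> k \<le> n"
  shows "\<exists>w\<in>W. \<exists>c. nrm w \<noteq> 0 \<and> nrm (U g w - c *s w) = 0"
proof -
  have vV: "v \<in> V" using W v by (auto simp: inv_sub_def)
  have "\<exists>p. p \<noteq> 0 \<and> nrm (pact g p v) = 0"
  proof (rule ccontr)
    assume "\<not> ?thesis"
    then obtain P where o: "orthonormal (\<lambda>i. pact g (P i) v) (Suc n)"
      using gram_schmidt_poly[OF vV, of "Suc n" g] by auto
    from dim[OF o] inv_sub_pact[OF W v(1)] show False by simp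
  qed
  then have ex: "\<exists>d p. p \<noteq> 0 \<and> degree p = d \<and> nrm (pact g p v) = 0" by blast
  define d where "d = (LEAST d. \<exists>p. p \<noteq> 0 \<and> degree p = d \<and> nrm (pact g p v) = 0)"
  obtain p where p: "p \<noteq> 0" "degree p = d" "nrm (pact g p v) = 0"
    using LeastI_ex[OF ex] unfolding d_def by blast
  have least: "d \<le> degree q" if "q \<noteq> 0" "nrm (pact g q v) = 0" for q
    unfolding d_def by (rule Least_le) (use that in blast)
  have "degree p \<noteq> 0"
  proof
    assume "degree p = 0"
    then obtain a where a: "p = [:a:]" by (rule degree_eq_zeroE)
    then have "pact g p v = a *s v" by (simp add: pact_def)
    then show False using p a v(2) vV by (simp add: nrm_scale)
  qed
  then have "\<not> constant (poly p)" by (simp add: constant_degree)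
  then obtain c where "poly p c = 0" using fundamental_theorem_of_algebra by blast
  then obtain q where q: "p = [:- c, 1:] * q" by (auto simp: poly_eq_0_iff_dvd elim: dvdE)
  then have "q \<noteq> 0" using p by auto
  then have "degree p = Suc (degree q)" unfolding q by (subst degree_mult_eq) auto
  then have nz: "nrm (pact g q v) \<noteq> 0" using least[OF \<open>q \<noteq> 0\<close>] p(2) by auto
  have "nrm (U g (pact g q v) - c *s pact g q v) = 0"
    using p(3) unfolding q pact_linear_factor[OF vV] .
  then show ?thesis using nz inv_sub_pact[OF W v(1)] by blast
qed

lemma nrm_zero_add: "x \<in> V \<Longrightarrow> y \<in> V \<Longrightarrow> nrm x = 0 \<Longrightarrow> nrm y = 0 \<Longrightarrow> nrm (x + y) = 0"
  using nrm_triangle[of x y] nrm_zeroI[of "x + y"] by simp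

lemma inv_sub_eigenspace:
  assumes W: "inv_sub W" shows "inv_sub {w \<in> W. nrm (U g w - c *s w) = 0}" (is "inv_sub ?E")
proof -
  have WV: "W \<subseteq> V" and sW: "subspace W" and UW: "\<And>g w. w \<in> W \<Longrightarrow> U g w \<in> W"
    using W by (auto simp: inv_sub_def)
  have "subspace ?E"
  proof (rule subspaceI)
    show "0 \<in> ?E" using sW by (simp add: subspace_0)
    fix x y assume x: "x \<in> ?E" and y: "y \<in> ?E"
    then have V: "x \<in> V" "y \<in> V" using WV by auto
    have "U g (x + y) - c *s (x + y) = (U g x - c *s x) + (U g y - c *s y)"
      using V by (simp add: U_add scale_right_distrib)
    then have "nrm (U g (x + y) - c *s (x + y)) = 0"
      using nrm_zero_add[of "U g x - c *s x" "U g y - c *s y"] x y V by simp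
    then show "x + y \<in> ?E" using x y sW by (simp add: subspace_add)
  next
    fix a x assume x: "x \<in> ?E"
    then have V: "x \<in> V" using WV by auto
    have "U g (a *s x) - c *s (a *s x) = a *s (U g x - c *s x)"
      using V by (simp add: U_scale scale_right_diff_distrib mult.commute)
    then show "a *s x \<in> ?E" using x sW V by (simp add: subspace_scale nrm_scale)
  qed
  moreover have "U h w \<in> ?E" if w: "w \<in> ?E" for h w
  proof -
    have V: "w \<in> V" using WV w by auto
    have "U g (U h w) - c *s U h w = U h (U g w - c *s w)"
      using V by (simp add: U_diff U_scale U_commute)
    then show ?thesis using w V UW by simp
  qed
  ultimately show ?thesis using WV by (auto simp: inv_sub_def)
qed

text \<open>If \<open>v\<close> is not yet a common eigenvector, some \<open>U g\<close> does not
  act on it as a scalar. An eigenspace of \<open>U g\<close> in \<open>W\<close> is invariant since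
  the group is abelian, and it is smaller than \<open>W\<close>: it misses \<open>v\<close>, so the
  residual of \<open>v\<close> enlarges each of its orthonormal systems.\<close>

lemma common_eigenvector_finite_dim:
  assumes "inv_sub W" "v \<in> W" "nrm v \<noteq> 0"
    and "\<And>e k. orthonormal e k \<Longrightarrow> (\<And>i. i < k \<Longrightarrow> e i \<in> W) \<Longrightarrow> k \<le> n"
  shows "\<exists>w\<in>W. nrm w \<noteq> 0 \<and> (\<forall>g. \<exists>c. nrm (U g w - c *s w) = 0)"
  using assms
proof (induction n arbitrary: W v)
  case 0
  have V: "v \<in> V" using 0 by (auto simp: inv_sub_def)
  then have pos: "nrm v > 0" using 0(3) nrm_pos by blast
  have "orthonormal (\<lambda>_. 0) 0" by (simp add: orthonormal_def)
  from orthonormal_extend[OF this V] pos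
  have o: "orthonormal ((\<lambda>_. 0)(0 := (1 / of_real (nrm v)) *s v)) (Suc 0)" by (simp add: resid_def)
  have "Suc 0 \<le> 0" using 0(4)[OF o] 0(1,2) by (simp add: inv_sub_def subspace_scale)
  then show ?case by simp
next
  case (Suc n)
  show ?case
  proof (cases "\<forall>g. \<exists>c. nrm (U g v - c *s v) = 0")
    case True
    then show ?thesis using Suc.prems by blast
  next
    case False
    then obtain g where g: "\<And>c. nrm (U g v - c *s v) \<noteq> 0" by blast
    have "\<exists>w\<in>W. \<exists>c. nrm w \<noteq> 0 \<and> nrm (U g w - c *s w) = 0"
      by (rule eigenvector_in_finite_dim[OF Suc.prems(1-3)]) (rule Suc.prems(4))
    then obtain w c where w: "w \<in> W" "nrm w \<noteq> 0" "nrm (U g w - c *s w) = 0"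
      by blast
    let ?E = "{w \<in> W. nrm (U g w - c *s w) = 0}"
    have E: "inv_sub ?E" by (rule inv_sub_eigenspace[OF Suc.prems(1)])
    have WV: "W \<subseteq> V" and sW: "subspace W" using Suc.prems(1) by (auto simp: inv_sub_def)
    have sE: "subspace ?E" using E by (simp add: inv_sub_def)
    have vV: "v \<in> V" using WV Suc.prems by auto
    have dim: "k \<le> n" if o: "orthonormal e k" and e: "\<And>i. i < k \<Longrightarrow> e i \<in> ?E" for e k
    proof -
      let ?y = "resid e k v"
      have yV: "?y \<in> V" by (rule resid_V[OF o vV])
      have yW: "?y \<in> W" unfolding resid_def using e sW Suc.prems(2)
        by (intro subspace_diff subspace_sum subspace_scale) auto
      \<comment> \<open>Null vectors lie in every eigenspace, so a null residual would put
        \<open>v\<close> itself into \<open>?E\<close>.\<close>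
      have "nrm ?y \<noteq> 0"
      proof
        assume 0: "nrm ?y = 0"
        have "nrm (U g ?y - c *s ?y) \<le> nrm (U g ?y) + nrm (c *s ?y)"
          by (rule nrm_triangle_minus) (use yV in auto)
        also have "\<dots> = 0" using 0 yV by (simp add: nrm_scale)
        finally have "nrm (U g ?y - c *s ?y) = 0" using nrm_zeroI[of "U g ?y - c *s ?y"] yV by simp
        then have "?y \<in> ?E" using yW by simp
        moreover have "(\<Sum>i<k. ip v (e i) *s e i) \<in> ?E"
          by (intro subspace_sum[OF sE] subspace_scale[OF sE] e) simp
        ultimately have "?y + (\<Sum>i<k. ip v (e i) *s e i) \<in> ?E" by (rule subspace_add[OF sE])
        then have "v \<in> ?E" by (simp add: resid_def)
        then show False using g by simp
      qed
      then have pos: "nrm ?y > 0" using nrm_pos[OF yV] by simp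
      have "Suc k \<le> Suc n"
        by (rule Suc.prems(4)[OF orthonormal_extend[OF o vV pos]])
          (use e yW sW in \<open>auto simp: less_Suc_eq subspace_scale\<close>)
      then show ?thesis by simp
    qed
    have "\<exists>w\<in>?E. nrm w \<noteq> 0 \<and> (\<forall>g. \<exists>c. nrm (U g w - c *s w) = 0)"
      by (rule Suc.IH[OF E _ w(2)], use w in simp) (rule dim)
    then show ?thesis by blast
  qed
qed

end

text \<open>The operators \<open>S N\<close> average the rank-one projections onto the vectors \<open>U (\<gamma> i) f\<close>; their limit is a
  positive compact operator commuting with the action, represented by its sesquilinear form \<open>sig\<close>.\<close>
locale orbit_form = unitary_action scale V ip U
  for scale :: "complex \<Rightarrow> 'v::ab_group_add \<Rightarrow> 'v" (infixr \<open>*s\<close> 75) and V ip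
    and U :: "'g::{countable,ab_group_add} \<Rightarrow> 'v \<Rightarrow> 'v" +
  fixes I :: "nat \<Rightarrow> 'i set" and \<gamma> :: "'i \<Rightarrow> 'g" and f :: 'v and S :: "nat \<Rightarrow> 'v \<Rightarrow> 'v"
  assumes ai: "asymp_inv I \<gamma>" and f: "f \<in> V"
    and S_eq: "\<And>N u. S N u = avg (I N) (\<lambda>i. ip u (U (\<gamma> i) f) *s U (\<gamma> i) f)"
    and S_Cauchy: "\<And>e. e > 0 \<Longrightarrow> \<exists>N0. \<forall>N\<ge>N0. \<forall>M\<ge>N0. \<forall>u\<in>V. nrm (S N u - S M u) \<le> e * nrm u"
    and S_complete: "\<And>v k. (\<And>n. v n \<in> V) \<Longrightarrow> (\<And>n. nrm (v n) \<le> 1) \<Longrightarrow>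
       (\<And>e. e > 0 \<Longrightarrow> \<exists>n0. \<forall>n\<ge>n0. \<forall>m\<ge>n0. nrm (S (k n) (v n) - S (k m) (v m)) \<le> e) \<Longrightarrow>
       \<exists>w\<in>V. (\<lambda>n. nrm (S (k n) (v n) - w)) \<longlonglongrightarrow> 0"
begin

lemma S_V [simp, intro]: "S N u \<in> V"
  unfolding S_eq using f by simp

lemma ip_S: "w \<in> V \<Longrightarrow> ip (S N u) w = (\<Sum>i\<in>I N. ip u (U (\<gamma> i) f) * ip (U (\<gamma> i) f) w) / of_nat (card (I N))"
  unfolding S_eq using f by (subst ip_avg_left) (auto simp: ip_scale_left)

definition sig :: "'v \<Rightarrow> 'v \<Rightarrow> complex" where "sig u w = lim (\<lambda>N. ip (S N u) w)"

lemma ip_S_diff: "u \<in> V \<Longrightarrow> w \<in> V \<Longrightarrow> nrm (S N u - S M u) \<le> e * nrm u \<Longrightarrow>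
    norm (ip (S N u) w - ip (S M u) w) \<le> e * nrm u * nrm w"
  using cauchy_schwarz[of "S N u - S M u" w] by (simp add: ip_diff_left mult_right_mono order_trans)

lemma sig_lim: assumes u: "u \<in> V" and w: "w \<in> V" shows "(\<lambda>N. ip (S N u) w) \<longlonglongrightarrow> sig u w"
proof -
  have "Cauchy (\<lambda>N. ip (S N u) w)"
  proof (rule CauchyI)
    fix e :: real assume e: "e > 0"
    have p: "0 \<le> nrm u * nrm w" using u w by simp
    then have "e / (nrm u * nrm w + 1) > 0" using e by simp
    then obtain N0 where N0: "\<forall>N\<ge>N0. \<forall>M\<ge>N0. \<forall>u'\<in>V. nrm (S N u' - S M u') \<le> e / (nrm u * nrm w + 1) * nrm u'"
      using S_Cauchy by blast
    have "norm (ip (S N u) w - ip (S M u) w) < e" if "N \<ge> N0" "M \<ge> N0" for N M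
    proof -
      have "norm (ip (S N u) w - ip (S M u) w) \<le> e / (nrm u * nrm w + 1) * nrm u * nrm w"
        using ip_S_diff[OF u w] N0 that u by blast
      also have "\<dots> = e * ((nrm u * nrm w) / (nrm u * nrm w + 1))" by simp
      also have "\<dots> < e * 1" by (rule mult_strict_left_mono[OF _ e]) (use p in simp)
      finally show ?thesis by simp
    qed
    then show "\<exists>N0. \<forall>m\<ge>N0. \<forall>n\<ge>N0. norm (ip (S m u) w - ip (S n u) w) < e" by blast
  qed
  then show ?thesis unfolding sig_def by (simp add: Cauchy_convergent_iff convergent_LIMSEQ_iff)
qed

text \<open>The estimate is uniform over the unit ball: \<open>sig\<close> is a norm limit of the
  finite rank operators \<open>S N\<close>, which is the compactness used below.\<close>

lemma sig_approx: assumes e: "e > 0"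
  shows "\<exists>N0. \<forall>N\<ge>N0. \<forall>u\<in>V. \<forall>w\<in>V. norm (ip (S N u) w - sig u w) \<le> e * nrm u * nrm w"
proof -
  obtain N0 where N0: "\<forall>N\<ge>N0. \<forall>M\<ge>N0. \<forall>u\<in>V. nrm (S N u - S M u) \<le> e * nrm u"
    using S_Cauchy[OF e] by blast
  have "norm (ip (S N u) w - sig u w) \<le> e * nrm u * nrm w" if N: "N \<ge> N0" and u: "u \<in> V" and w: "w \<in> V" for N u w
  proof (rule LIMSEQ_le_const2)
    show "(\<lambda>M. norm (ip (S N u) w - ip (S M u) w)) \<longlonglongrightarrow> norm (ip (S N u) w - sig u w)"
      by (intro tendsto_intros sig_lim u w)
    show "\<exists>M0. \<forall>M\<ge>M0. norm (ip (S N u) w - ip (S M u) w) \<le> e * nrm u * nrm w"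
      using ip_S_diff[OF u w] N0 N u by blast
  qed
  then show ?thesis by blast
qed

lemma ip_S_self: "u \<in> V \<Longrightarrow> ip (S N u) u = of_real ((\<Sum>i\<in>I N. (cmod (ip u (U (\<gamma> i) f)))\<^sup>2) / real (card (I N)))"
proof -
  assume u: "u \<in> V"
  have "ip u (U (\<gamma> i) f) * ip (U (\<gamma> i) f) u = of_real ((cmod (ip u (U (\<gamma> i) f)))\<^sup>2)" for i
    using ip_herm[of u "U (\<gamma> i) f"] u f by (simp only: U_V complex_norm_square)
  then show ?thesis using u by (simp add: ip_S)
qed

text \<open>Seen as a second semi-inner product, \<open>sig\<close> has its own Cauchy-Schwarz
  inequality, which drives both \<open>near_maximiser\<close> and \<open>sig_bound\<close>.\<close>

lemma sig_semi_inner: "complex_semi_inner scale V sig"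
proof
  show "subspace V" by (rule V_subspace)
  show "sig (u + v) w = sig u w + sig v w" if "u \<in> V" "v \<in> V" "w \<in> V" for u v w
  proof (rule LIMSEQ_unique[OF sig_lim])
    have "ip (S N (u + v)) w = ip (S N u) w + ip (S N v) w" for N
      using that f by (simp add: ip_S ip_add_left ring_distribs sum.distrib add_divide_distrib)
    then show "(\<lambda>N. ip (S N (u + v)) w) \<longlonglongrightarrow> sig u w + sig v w"
      using that by (simp add: tendsto_add sig_lim)
  qed (use that in auto)
  show "sig (c *s u) w = c * sig u w" if "u \<in> V" "w \<in> V" for u w c
  proof (rule LIMSEQ_unique[OF sig_lim])
    have "ip (S N (c *s u)) w = c * ip (S N u) w" for N
      using that f by (simp add: ip_S ip_scale_left mult.assoc sum_distrib_left)
    then show "(\<lambda>N. ip (S N (c *s u)) w) \<longlonglongrightarrow> c * sig u w"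
      using that by (simp add: tendsto_mult_left sig_lim)
  qed (use that in auto)
  show "sig v u = cnj (sig u v)" if "u \<in> V" "v \<in> V" for u v
  proof (rule LIMSEQ_unique[OF sig_lim])
    have "ip (S N v) u = cnj (ip (S N u) v)" for N
    proof -
      have "cnj (ip u (U (\<gamma> i) f) * ip (U (\<gamma> i) f) v) = ip v (U (\<gamma> i) f) * ip (U (\<gamma> i) f) u" for i
        using that f ip_herm[of u "U (\<gamma> i) f"] ip_herm[of "U (\<gamma> i) f" v] by simp
      then show ?thesis using that by (simp add: ip_S)
    qed
    then show "(\<lambda>N. ip (S N v) u) \<longlonglongrightarrow> cnj (sig u v)"
      using that by (simp add: tendsto_cnj sig_lim)
  qed (use that in auto)
  show "0 \<le> Re (sig v v)" if "v \<in> V" for v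
  proof (rule LIMSEQ_le_const)
    show "(\<lambda>N. Re (ip (S N v) v)) \<longlonglongrightarrow> Re (sig v v)" by (intro tendsto_intros sig_lim that)
    show "\<exists>N. \<forall>n\<ge>N. 0 \<le> Re (ip (S n v) v)" using that by (simp add: ip_S_self sum_nonneg)
  qed
qed

lemma ip_S_self_le: assumes u: "u \<in> V" shows "Re (ip (S N u) u) \<le> (nrm f)\<^sup>2 * (nrm u)\<^sup>2"
proof -
  have "(cmod (ip u (U (\<gamma> i) f)))\<^sup>2 \<le> (nrm f)\<^sup>2 * (nrm u)\<^sup>2" for i
    using power_mono[OF cauchy_schwarz[OF u, of "U (\<gamma> i) f"], of 2] u f by (simp add: power_mult_distrib mult.commute)
  then have "(\<Sum>i\<in>I N. (cmod (ip u (U (\<gamma> i) f)))\<^sup>2) \<le> real (card (I N)) * ((nrm f)\<^sup>2 * (nrm u)\<^sup>2)"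
    by (intro sum_bounded_above)
  then show ?thesis using u asymp_inv_finite(3)[OF ai, of N] by (simp add: ip_S_self field_simps)
qed

lemma sig_self_le: assumes u: "u \<in> V" shows "Re (sig u u) \<le> (nrm f)\<^sup>2 * (nrm u)\<^sup>2"
proof (rule LIMSEQ_le_const2)
  show "(\<lambda>N. Re (ip (S N u) u)) \<longlonglongrightarrow> Re (sig u u)" by (intro tendsto_intros sig_lim u)
  show "\<exists>N. \<forall>n\<ge>N. Re (ip (S n u) u) \<le> (nrm f)\<^sup>2 * (nrm u)\<^sup>2" using ip_S_self_le[OF u] by blast
qed

text \<open>Replacing the index \<open>\<gamma> i\<close> by \<open>\<gamma> i + h\<close> moves the
  operator from the left argument to the right one, and asymptotic invariance makes this shift free
  in the limit. So the limit operator commutes with the action.\<close>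

lemma sig_U: assumes u: "u \<in> V" and w: "w \<in> V" shows "sig (U h u) w = sig u (U (- h) w)"
proof -
  define b where "b = (\<lambda>x. ip (U h u) (U x f) * ip (U x f) w)"
  define D where "D = (nrm u * nrm f) * (nrm f * nrm w)"
  have bD: "norm (b x) \<le> D" for x
    unfolding b_def D_def norm_mult
    by (intro mult_mono) (use u w f cauchy_schwarz[of "U h u" "U x f"] cauchy_schwarz[of "U x f" w] in auto)
  obtain \<epsilon> where e: "\<epsilon> \<longlonglongrightarrow> 0" and ep: "\<And>N. 0 \<le> \<epsilon> N" and b: "\<forall>N (b :: 'g \<Rightarrow> complex) D. (\<forall>x. norm (b x) \<le> D) \<longrightarrow>
       norm (\<Sum>i\<in>I N. b (\<gamma> i) - b (\<gamma> i + h)) \<le> \<epsilon> N * D * real (card (I N))"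
    by (rule asymp_inv_bound[OF ai, where h = h]) (rule that, assumption+)
  have 1: "ip (S N (U h u)) w = (\<Sum>i\<in>I N. b (\<gamma> i)) / of_nat (card (I N))" for N
    using w by (simp add: ip_S b_def)
  have 2: "ip (S N u) (U (- h) w) = (\<Sum>i\<in>I N. b (\<gamma> i + h)) / of_nat (card (I N))" for N
  proof -
    have "ip u (U x f) * ip (U x f) (U (- h) w) = b (x + h)" for x
    proof -
      have "ip (U h u) (U (x + h) f) = ip u (U x f)"
        using u f by (simp add: add.commute[of x h] U_plus)
      moreover have "ip (U (x + h) f) w = ip (U x f) (U (- h) w)"
        using ip_U_swap[of "U x f" w h] w f by (simp add: add.commute[of x h] U_plus)
      ultimately show ?thesis by (simp add: b_def)
    qed
    then show ?thesis using w by (simp add: ip_S)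
  qed
  have "norm (ip (S N (U h u)) w - ip (S N u) (U (- h) w)) \<le> \<epsilon> N * D" for N
  proof -
    have "norm (\<Sum>i\<in>I N. b (\<gamma> i) - b (\<gamma> i + h)) \<le> \<epsilon> N * D * real (card (I N))"
      using b[rule_format, of b D N] bD by blast
    then show ?thesis using asymp_inv_finite(3)[OF ai, of N] unfolding 1 2
      by (simp add: sum_subtractf norm_divide divide_le_eq flip: diff_divide_distrib)
  qed
  note le = this
  have "(\<lambda>N. \<epsilon> N * D) \<longlonglongrightarrow> 0 * D" by (intro tendsto_intros e)
  then have "(\<lambda>N. \<epsilon> N * D) \<longlonglongrightarrow> 0" by simp
  from null_squeeze[OF this le] have "(\<lambda>N. ip (S N (U h u)) w - ip (S N u) (U (- h) w)) \<longlonglongrightarrow> 0"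
    by (simp add: tendsto_norm_zero_iff)
  moreover have "(\<lambda>N. ip (S N (U h u)) w - ip (S N u) (U (- h) w)) \<longlonglongrightarrow> sig (U h u) w - sig u (U (- h) w)"
    by (intro tendsto_intros sig_lim) (use u w in auto)
  ultimately show ?thesis using LIMSEQ_unique by fastforce
qed

text \<open>The variational principle with error terms: a vector almost attaining the maximum
  \<open>l\<close> of the quadratic form is almost an eigenvector. Cauchy-Schwarz for
  \<open>sig\<close>, tested at \<open>S N v\<close> itself, gives
  \<open>nrm (S N v) \<le> l + q\<close>, and the rest is the expansion of a square. Here
  \<open>q\<close> is the distance of \<open>S N\<close> from its limit.\<close>

lemma near_maximiser:
  assumes v: "v \<in> V" "nrm v \<le> 1" and l: "l > 0" and ub: "\<And>v. v \<in> V \<Longrightarrow> Re (sig v v) \<le> l * (nrm v)\<^sup>2"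
    and q: "q \<ge> 0" "\<And>u w. u \<in> V \<Longrightarrow> w \<in> V \<Longrightarrow> norm (ip (S N u) w - sig u w) \<le> q * nrm u * nrm w"
  shows "(nrm (S N v - of_real l *s v))\<^sup>2 \<le> (l + q)\<^sup>2 - 2 * l * (Re (sig v v) - q) + l\<^sup>2"
proof -
  interpret sg: complex_semi_inner scale V sig by (rule sig_semi_inner)
  let ?y = "S N v"
  have sn: "sg.nrm u \<le> sqrt l * nrm u" if "u \<in> V" for u
  proof (rule power2_le_imp_le)
    show "(sg.nrm u)\<^sup>2 \<le> (sqrt l * nrm u)\<^sup>2"
      using ub[OF that] l that by (simp add: sg.nrm_sq power_mult_distrib)
  qed (use that l in simp)
  have "norm (sig v ?y) \<le> sg.nrm v * sg.nrm ?y" by (rule sg.cauchy_schwarz) (use v in auto)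
  also have "\<dots> \<le> (sqrt l * nrm v) * (sqrt l * nrm ?y)"
    by (intro mult_mono sn) (use v l in auto)
  also have "\<dots> = l * nrm ?y * nrm v" using l by simp
  also have "\<dots> \<le> l * nrm ?y * 1" by (intro mult_left_mono) (use v l in auto)
  finally have 1: "norm (sig v ?y) \<le> l * nrm ?y" by simp
  have 2: "norm (ip ?y u - sig v u) \<le> q * nrm u" if "u \<in> V" for u
  proof -
    have "norm (ip ?y u - sig v u) \<le> q * nrm v * nrm u" by (rule q(2)) (use v that in auto)
    also have "\<dots> \<le> q * 1 * nrm u" by (intro mult_mono) (use v q that in auto)
    finally show ?thesis by simp
  qed
  have "(nrm ?y)\<^sup>2 = norm (ip ?y ?y)" by (simp only: ip_self S_V norm_of_real abs_power2)
  also have "\<dots> \<le> norm (sig v ?y) + norm (ip ?y ?y - sig v ?y)" by (rule norm_triangle_sub)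
  also have "\<dots> \<le> (l + q) * nrm ?y" using 1 2[of ?y] by (simp add: algebra_simps)
  finally have "nrm ?y * nrm ?y \<le> (l + q) * nrm ?y" by (simp add: power2_eq_square)
  then have "nrm ?y \<le> l + q"
    using nrm_pos[of ?y] l q(1) by (cases "nrm ?y = 0") auto
  then have 3: "(nrm ?y)\<^sup>2 \<le> (l + q)\<^sup>2" by (intro power_mono) auto
  have "norm (ip ?y v - sig v v) \<le> q * 1" using 2[OF v(1)] v q by (meson mult_left_mono order_trans)
  then have "Re (sig v v) - q \<le> Re (ip ?y v)"
    using abs_Re_le_cmod[of "ip ?y v - sig v v"] by simp
  then have 4: "2 * l * (Re (sig v v) - q) \<le> 2 * l * Re (ip ?y v)" using l by simp
  have "(nrm v)\<^sup>2 \<le> 1" using v by (simp add: power_le_one)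
  then have 5: "l\<^sup>2 * (nrm v)\<^sup>2 \<le> l\<^sup>2" by (simp add: mult_left_le)
  have "(nrm (?y - of_real l *s v))\<^sup>2 = (nrm ?y)\<^sup>2 - 2 * l * Re (ip ?y v) + l\<^sup>2 * (nrm v)\<^sup>2"
    using v l by (simp add: nrm_diff_sq ip_scale_right nrm_scale power_mult_distrib)
  then show ?thesis using 3 4 5 by linarith
qed

text \<open>A substitute for weak compactness of the unit ball. Only the coefficients against the
  countably many vectors \<open>U g f\<close> are made to converge, and \<open>S N\<close> depends
  on its argument through these alone.\<close>

lemma coefficient_subsequence:
  fixes v :: "nat \<Rightarrow> 'v"
  assumes v: "\<And>n. v n \<in> V" "\<And>n. nrm (v n) \<le> 1"
  shows "\<exists>r. strict_mono r \<and> (\<forall>g. Cauchy (\<lambda>n. ip (v (r n)) (U g f)))"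
proof -
  \<comment> \<open>A product of discs, compact by Tychonoff. The countable index type makes the
    function space first countable, so compactness gives convergent subsequences.\<close>
  define K where "K = (PiE UNIV (\<lambda>_::'g. cball (0::complex) (nrm f)))"
  have "compactin (product_topology (\<lambda>_. euclidean) (UNIV :: 'g set)) K"
    unfolding K_def by (subst compactin_PiE) auto
  then have "compact K" by (simp add: euclidean_product_topology)
  then have sc: "seq_compact K" by (rule compact_imp_seq_compact)
  have inK: "(\<lambda>g. ip (v n) (U g f)) \<in> K" for n
  proof -
    have "norm (ip (v n) (U g f)) \<le> nrm f" for g
    proof -
      have "norm (ip (v n) (U g f)) \<le> nrm (v n) * nrm f" using cauchy_schwarz[of "v n" "U g f"] v f by simp
      also have "\<dots> \<le> 1 * nrm f" by (intro mult_right_mono) (use v f in auto)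
      finally show ?thesis by simp
    qed
    then show ?thesis by (auto simp: K_def)
  qed
  obtain l r where r: "strict_mono r" and l: "((\<lambda>n g. ip (v n) (U g f)) \<circ> r) \<longlonglongrightarrow> l"
    by (rule seq_compactE[OF sc, of "\<lambda>n g. ip (v n) (U g f)"]) (use inK in auto)
  have "Cauchy (\<lambda>n. ip (v (r n)) (U g f))" for g
  proof -
    have "continuous_on UNIV (\<lambda>x::'g \<Rightarrow> complex. x g)" by (rule continuous_on_product_coordinates)
    then have "(\<lambda>n. (((\<lambda>n g. ip (v n) (U g f)) \<circ> r) n) g) \<longlonglongrightarrow> l g"
      by (rule continuous_on_tendsto_compose[OF _ l]) auto
    then have "(\<lambda>n. ip (v (r n)) (U g f)) \<longlonglongrightarrow> l g" by (simp add: o_def)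
    then show ?thesis using LIMSEQ_imp_Cauchy by blast
  qed
  then show ?thesis using r by blast
qed

lemma sig_bound: assumes "a \<in> V" "u \<in> V" shows "norm (sig a u) \<le> (nrm f)\<^sup>2 * nrm a * nrm u"
proof -
  interpret sg: complex_semi_inner scale V sig by (rule sig_semi_inner)
  have sn: "sg.nrm u \<le> nrm f * nrm u" if "u \<in> V" for u
  proof (rule power2_le_imp_le)
    show "(sg.nrm u)\<^sup>2 \<le> (nrm f * nrm u)\<^sup>2"
      using sig_self_le[OF that] that by (simp add: sg.nrm_sq power_mult_distrib)
  qed (use that f in simp)
  have "norm (sig a u) \<le> sg.nrm a * sg.nrm u" by (rule sg.cauchy_schwarz[OF assms])
  also have "\<dots> \<le> (nrm f * nrm a) * (nrm f * nrm u)" by (intro mult_mono sn) (use assms f in auto)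
  finally show ?thesis by (simp add: power2_eq_square mult_ac)
qed

text \<open>All late \<open>S (k n)\<close> are uniformly close to one fixed \<open>S N\<close>, and
  \<open>S N\<close> involves only finitely many coefficients of its argument, each of them
  Cauchy.\<close>

lemma S_Cauchy_subsequence:
  assumes v: "\<And>n. v n \<in> V" "\<And>n. nrm (v n) \<le> 1"
    and C: "\<And>g. Cauchy (\<lambda>n. ip (v n) (U g f))" and k: "\<And>n. n \<le> k n" and e: "e > 0"
  shows "\<exists>n0. \<forall>n\<ge>n0. \<forall>m\<ge>n0. nrm (S (k n) (v n) - S (k m) (v m)) \<le> e"
proof -
  have "e / 3 > 0" using e by simp
  then obtain N where N: "\<forall>M\<ge>N. \<forall>M'\<ge>N. \<forall>u\<in>V. nrm (S M u - S M' u) \<le> e / 3 * nrm u"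
    using S_Cauchy by blast
  \<comment> \<open>Chosen so that \<open>d * nrm f \<le> e / 3\<close>; the added 1 covers
    \<open>nrm f = 0\<close>.\<close>
  define d where "d = e / (3 * (nrm f + 1))"
  have f0: "0 \<le> nrm f" using f by simp
  then have d: "d > 0" using e by (simp add: d_def)
  have "\<exists>n0. \<forall>n\<ge>n0. \<forall>m\<ge>n0. norm (ip (v n) (U (\<gamma> i) f) - ip (v m) (U (\<gamma> i) f)) < d" for i
    using CauchyD[OF C d] .
  then obtain n0 where n0: "\<And>i n m. n \<ge> n0 i \<Longrightarrow> m \<ge> n0 i \<Longrightarrow> norm (ip (v n) (U (\<gamma> i) f) - ip (v m) (U (\<gamma> i) f)) < d"
    by metis
  \<comment> \<open>The sum dominates each of the finitely many thresholds \<open>n0 i\<close> as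
    well as \<open>N\<close>.\<close>
  define K where "K = N + (\<Sum>i\<in>I N. n0 i)"
  have "nrm (S (k n) (v n) - S (k m) (v m)) \<le> e" if n: "n \<ge> K" and m: "m \<ge> K" for n m
  proof -
    have a: "nrm (S (k j) (v j) - S N (v j)) \<le> e / 3" if "j \<ge> K" for j
    proof -
      have "k j \<ge> N" using k[of j] that unfolding K_def by linarith
      then have "nrm (S (k j) (v j) - S N (v j)) \<le> e / 3 * nrm (v j)" using N v by blast
      also have "\<dots> \<le> e / 3 * 1" by (intro mult_left_mono v) (use e in simp)
      finally show ?thesis by simp
    qed
    have "S N (v n) - S N (v m) = avg (I N) (\<lambda>i. (ip (v n) (U (\<gamma> i) f) - ip (v m) (U (\<gamma> i) f)) *s U (\<gamma> i) f)"
      by (simp add: S_eq avg_diff scale_left_diff_distrib)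
    moreover have "nrm (avg (I N) (\<lambda>i. (ip (v n) (U (\<gamma> i) f) - ip (v m) (U (\<gamma> i) f)) *s U (\<gamma> i) f)) \<le> d * nrm f"
    proof (rule nrm_avg_le)
      fix i assume i: "i \<in> I N"
      have "n0 i \<le> (\<Sum>i\<in>I N. n0 i)" using i asymp_inv_finite(1)[OF ai] by (simp add: member_le_sum)
      then have "norm (ip (v n) (U (\<gamma> i) f) - ip (v m) (U (\<gamma> i) f)) < d"
        using n m unfolding K_def by (intro n0) linarith+
      then show "nrm ((ip (v n) (U (\<gamma> i) f) - ip (v m) (U (\<gamma> i) f)) *s U (\<gamma> i) f) \<le> d * nrm f"
        using f f0 by (simp add: nrm_scale mult_right_mono)
    qed (use asymp_inv_finite[OF ai] f in auto)
    moreover have "d * nrm f \<le> e / 3"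
      using e f0 by (simp add: d_def field_simps)
    ultimately have b: "nrm (S N (v n) - S N (v m)) \<le> e / 3" by (metis order_trans)
    have "nrm (S (k n) (v n) - S (k m) (v m)) \<le> nrm (S (k n) (v n) - S N (v n)) + nrm (S N (v n) - S (k m) (v m))"
      "nrm (S N (v n) - S (k m) (v m)) \<le> nrm (S N (v n) - S N (v m)) + nrm (S N (v m) - S (k m) (v m))"
      "nrm (S N (v m) - S (k m) (v m)) = nrm (S (k m) (v m) - S N (v m))"
      by (auto intro!: nrm_triangle3 nrm_minus_commute)
    then show ?thesis using a[OF n] a[OF m] b by linarith
  qed
  then show ?thesis by blast
qed

text \<open>Along near-maximisers \<open>v n\<close> with convergent coefficients,
  \<open>x n = S (k n) (v n)\<close> is Cauchy and so converges to some \<open>w\<close>. As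
  \<open>x n\<close> is close to \<open>l\<close> times \<open>v n\<close>, these multiples converge
  to \<open>w\<close> too, and the eigenvalue equation passes to the limit. Completeness is thus
  invoked only on images under the operators \<open>S N\<close>.\<close>

lemma top_eigenvector:
  assumes l: "l > 0" and ub: "\<And>v. v \<in> V \<Longrightarrow> Re (sig v v) \<le> l * (nrm v)\<^sup>2"
    and app: "\<And>e. e > 0 \<Longrightarrow> \<exists>v\<in>V. nrm v \<le> 1 \<and> Re (sig v v) > l - e"
  shows "\<exists>w\<in>V. nrm w \<noteq> 0 \<and> (\<forall>u\<in>V. sig w u = of_real l * ip w u)"
proof -
  interpret sg: complex_semi_inner scale V sig by (rule sig_semi_inner)
  define q where "q = (\<lambda>n. 1 / real (Suc n))"
  have q0: "q n > 0" for n by (simp add: q_def)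
  have qlim: "q \<longlonglongrightarrow> 0" unfolding q_def by (rule LIMSEQ_Suc[OF lim_1_over_n])
  have "\<exists>v. v \<in> V \<and> nrm v \<le> 1 \<and> Re (sig v v) > l - q n" for n using app[OF q0] by blast
  then obtain v0 where v0: "\<And>n. v0 n \<in> V" "\<And>n. nrm (v0 n) \<le> 1" "\<And>n. Re (sig (v0 n) (v0 n)) > l - q n"
    by metis
  obtain r where r: "strict_mono r" and Cr: "\<And>g. Cauchy (\<lambda>n. ip (v0 (r n)) (U g f))"
    using coefficient_subsequence[of v0] v0(1,2) by blast
  define v where "v = (\<lambda>n. v0 (r n))"
  have v: "v n \<in> V" "nrm (v n) \<le> 1" for n using v0 by (auto simp: v_def)
  have vq: "Re (sig (v n) (v n)) > l - q n" for n
  proof -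
    have "q (r n) \<le> q n" unfolding q_def using seq_suble[OF r, of n] by (simp add: frac_le)
    then show ?thesis using v0(3)[of "r n"] by (simp add: v_def)
  qed
  have "\<exists>k. \<forall>N\<ge>k. \<forall>u\<in>V. \<forall>w\<in>V. norm (ip (S N u) w - sig u w) \<le> q n * nrm u * nrm w" for n
    using sig_approx[OF q0] .
  then obtain k0 where k0: "\<And>n N u w. N \<ge> k0 n \<Longrightarrow> u \<in> V \<Longrightarrow> w \<in> V \<Longrightarrow> norm (ip (S N u) w - sig u w) \<le> q n * nrm u * nrm w"
    by metis
  \<comment> \<open>The part \<open>k0 n\<close> secures accuracy \<open>q n\<close> for
    \<open>S (k n)\<close>, the part \<open>n\<close> the growth required by
    \<open>S_Cauchy_subsequence\<close>.\<close>
  define k where "k = (\<lambda>n. max n (k0 n))"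
  define x where "x = (\<lambda>n. S (k n) (v n))"
  have xV: "x n \<in> V" for n by (simp add: x_def)
  have ks: "norm (ip (S (k n) u) w - sig u w) \<le> q n * nrm u * nrm w" if "u \<in> V" "w \<in> V" for n u w
    using k0[of n "k n"] that by (simp add: k_def)
  have "nrm (x n - of_real l *s v n) \<le> sqrt (6 * l * q n + (q n)\<^sup>2)" for n
  proof (rule real_le_rsqrt)
    have "(nrm (x n - of_real l *s v n))\<^sup>2 \<le> (l + q n)\<^sup>2 - 2 * l * (Re (sig (v n) (v n)) - q n) + l\<^sup>2"
      unfolding x_def by (rule near_maximiser[OF v l ub less_imp_le[OF q0] ks])
    also have "\<dots> \<le> (l + q n)\<^sup>2 - 2 * l * (l - q n - q n) + l\<^sup>2"
      using vq[of n] l by (simp add: less_imp_le)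
    also have "\<dots> = 6 * l * q n + (q n)\<^sup>2" by (simp add: power2_eq_square algebra_simps)
    finally show "(nrm (x n - of_real l *s v n))\<^sup>2 \<le> 6 * l * q n + (q n)\<^sup>2" .
  qed
  note le = this
  have "(\<lambda>n. sqrt (6 * l * q n + (q n)\<^sup>2)) \<longlonglongrightarrow> sqrt (6 * l * 0 + 0\<^sup>2)"
    by (intro tendsto_intros qlim)
  then have lim0: "(\<lambda>n. sqrt (6 * l * q n + (q n)\<^sup>2)) \<longlonglongrightarrow> 0" by simp
  have xv: "(\<lambda>n. nrm (x n - of_real l *s v n)) \<longlonglongrightarrow> 0"
    by (rule null_squeeze[OF lim0 le]) (use xV v in simp)
  have "\<exists>w\<in>V. (\<lambda>n. nrm (S (k n) (v n) - w)) \<longlonglongrightarrow> 0"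
  proof (rule S_complete[OF v])
    fix e :: real assume "e > 0"
    show "\<exists>n0. \<forall>n\<ge>n0. \<forall>m\<ge>n0. nrm (S (k n) (v n) - S (k m) (v m)) \<le> e"
      by (rule S_Cauchy_subsequence[OF v _ _ \<open>e > 0\<close>]) (use Cr in \<open>auto simp: v_def k_def\<close>)
  qed
  then obtain w where w: "w \<in> V" and xw: "(\<lambda>n. nrm (x n - w)) \<longlonglongrightarrow> 0" unfolding x_def by blast
  have lim1: "(\<lambda>n. nrm (x n - of_real l *s v n) + nrm (x n - w)) \<longlonglongrightarrow> 0"
    using tendsto_add[OF xv xw] by simp
  have vw: "(\<lambda>n. nrm (of_real l *s v n - w)) \<longlonglongrightarrow> 0"
  proof (rule null_squeeze[OF lim1])
    fix n
    show "nrm (of_real l *s v n - w) \<le> nrm (x n - of_real l *s v n) + nrm (x n - w)"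
      using nrm_triangle3[of "of_real l *s v n" "x n" w] nrm_minus_commute[of "x n" "of_real l *s v n"] xV v w by simp
  qed (use v w in simp)
  \<comment> \<open>Both sides are limits of \<open>l * sig (v n) u\<close>: on the left since
    \<open>l\<close> times \<open>v n\<close> tends to \<open>w\<close>, on the right since
    \<open>S (k n) (v n)\<close> tends to \<open>w\<close> while approximating
    \<open>sig\<close>.\<close>
  have eig: "sig w u = of_real l * ip w u" if u: "u \<in> V" for u
  proof (rule LIMSEQ_unique)
    have "(\<lambda>n. sig (of_real l *s v n) u - sig w u) \<longlonglongrightarrow> 0"
    proof (rule tendsto_norm_zero_cancel, rule null_squeeze)
      have "(\<lambda>n. (nrm f)\<^sup>2 * nrm (of_real l *s v n - w) * nrm u) \<longlonglongrightarrow> (nrm f)\<^sup>2 * 0 * nrm u"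
        by (intro tendsto_intros vw)
      then show "(\<lambda>n. (nrm f)\<^sup>2 * nrm (of_real l *s v n - w) * nrm u) \<longlonglongrightarrow> 0" by simp
      show "norm (sig (of_real l *s v n) u - sig w u) \<le> (nrm f)\<^sup>2 * nrm (of_real l *s v n - w) * nrm u" for n
        using sig_bound[of "of_real l *s v n - w" u] v w u by (simp add: sg.ip_diff_left)
    qed simp
    then have "(\<lambda>n. sig (of_real l *s v n) u - sig w u + sig w u) \<longlonglongrightarrow> 0 + sig w u"
      by (intro tendsto_intros)
    then show "(\<lambda>n. of_real l * sig (v n) u) \<longlonglongrightarrow> sig w u" using v u by (simp add: sg.ip_scale_left)
    have "(\<lambda>n. sig (v n) u - ip w u) \<longlonglongrightarrow> 0"
    proof (rule tendsto_norm_zero_cancel, rule null_squeeze)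
      have "(\<lambda>n. q n * nrm u + nrm (x n - w) * nrm u) \<longlonglongrightarrow> 0 * nrm u + 0 * nrm u"
        by (intro tendsto_intros qlim xw)
      then show "(\<lambda>n. q n * nrm u + nrm (x n - w) * nrm u) \<longlonglongrightarrow> 0" by simp
      show "norm (sig (v n) u - ip w u) \<le> q n * nrm u + nrm (x n - w) * nrm u" for n
      proof -
        have "norm (ip (x n) u - sig (v n) u) \<le> q n * nrm (v n) * nrm u" unfolding x_def by (rule ks) (use v u in auto)
        also have "\<dots> \<le> q n * 1 * nrm u" by (intro mult_mono) (use v u less_imp_le[OF q0[of n]] in auto)
        finally have 1: "norm (ip (x n) u - sig (v n) u) \<le> q n * nrm u" by simp
        have 2: "norm (ip (x n) u - ip w u) \<le> nrm (x n - w) * nrm u"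
          using cauchy_schwarz[of "x n - w" u] xV w u by (simp add: ip_diff_left)
        have "sig (v n) u - ip w u = (ip (x n) u - ip w u) - (ip (x n) u - sig (v n) u)" by simp
        then show ?thesis using 1 2 norm_triangle_ineq4[of "ip (x n) u - ip w u" "ip (x n) u - sig (v n) u"] by simp
      qed
    qed simp
    then have "(\<lambda>n. of_real l * (sig (v n) u - ip w u + ip w u)) \<longlonglongrightarrow> of_real l * (0 + ip w u)"
      by (intro tendsto_intros)
    then show "(\<lambda>n. of_real l * sig (v n) u) \<longlonglongrightarrow> of_real l * ip w u" by simp
  qed
  \<comment> \<open>Near-maximality keeps the norm of \<open>l\<close> times \<open>v n\<close>
    above \<open>l - q n\<close>, so its limit cannot be null.\<close>
  have "nrm w \<noteq> 0"
  proof
    assume 0: "nrm w = 0"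
    have le: "l - q n \<le> nrm (of_real l *s v n - w)" for n
    proof -
      have "l - q n \<le> l * (nrm (v n))\<^sup>2" using vq[of n] ub[OF v(1), of n] by linarith
      also have "\<dots> \<le> l * nrm (v n)" using v[of n] l by (intro mult_left_mono) (auto simp: power2_eq_square mult_left_le)
      also have "\<dots> = nrm (of_real l *s v n)" using v l by (simp add: nrm_scale)
      finally have "l - q n \<le> nrm (of_real l *s v n)" .
      moreover have "nrm (of_real l *s v n) \<le> nrm (of_real l *s v n - w) + nrm w"
        using nrm_triangle[of "of_real l *s v n - w" w] v w by simp
      ultimately show ?thesis using 0 by linarith
    qed
    have "(\<lambda>n. l - q n) \<longlonglongrightarrow> l - 0" by (intro tendsto_intros qlim)
    then have "l - 0 \<le> 0" by (rule LIMSEQ_le[OF _ vw]) (use le in blast)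
    then show False using l by simp
  qed
  then show ?thesis using w eig by blast
qed

text \<open>The form has finite trace: by Bessel's inequality its trace over any orthonormal system
  is at most \<open>(nrm f)\<^sup>2\<close>. This limits the dimension of the eigenspace of a
  positive eigenvalue. The largest eigenvalue is the supremum \<open>l\<close> of the quadratic form
  on the unit ball.\<close>

theorem common_eigenvector:
  assumes nz: "\<not> (\<lambda>N. (\<Sum>i\<in>I N. \<Sum>j\<in>I N. (cmod (ip (U (\<gamma> i) f) (U (\<gamma> j) f)))\<^sup>2) / (real (card (I N)))\<^sup>2) \<longlonglongrightarrow> 0"
  shows "\<exists>e\<in>V. nrm e \<noteq> 0 \<and> ip e f \<noteq> 0 \<and> (\<forall>g. \<exists>c. nrm (U g e - c *s e) = 0)"
proof -
  interpret sg: complex_semi_inner scale V sig by (rule sig_semi_inner)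
  let ?X = "{Re (sig v v) | v. v \<in> V \<and> nrm v \<le> 1}"
  define l where "l = Sup ?X"
  have bdd: "bdd_above ?X"
  proof (rule bdd_aboveI)
    fix x assume "x \<in> ?X"
    then obtain v where v: "x = Re (sig v v)" "v \<in> V" "nrm v \<le> 1" by blast
    have "x \<le> (nrm f)\<^sup>2 * (nrm v)\<^sup>2" using sig_self_le v by simp
    also have "\<dots> \<le> (nrm f)\<^sup>2 * 1" using v by (intro mult_left_mono) (auto simp: power_le_one)
    finally show "x \<le> (nrm f)\<^sup>2" by simp
  qed
  have ne: "?X \<noteq> {}" by (rule ex_in_conv[THEN iffD1]) (rule exI[of _ "Re (sig 0 0)"], auto intro!: exI[of _ 0])
  have ub1: "Re (sig v v) \<le> l" if "v \<in> V" "nrm v \<le> 1" for v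
    unfolding l_def by (rule cSup_upper[OF _ bdd]) (use that in blast)
  have ub: "Re (sig v v) \<le> l * (nrm v)\<^sup>2" if v: "v \<in> V" for v
  proof (cases "nrm v = 0")
    case True
    then show ?thesis using sig_self_le[OF v] by simp
  next
    case False
    let ?c = "1 / of_real (nrm v)"
    have "Re (sig (?c *s v) (?c *s v)) \<le> l"
      by (rule ub1) (use v False in \<open>auto simp: nrm_scale norm_divide\<close>)
    also have "sig (?c *s v) (?c *s v) = sig v v / of_real ((nrm v)\<^sup>2)"
      using v by (simp add: sg.ip_scale_left sg.ip_scale_right power2_eq_square)
    finally show ?thesis using False by (simp add: Re_divide_of_real field_simps)
  qed
  have l0: "0 \<le> l" using ub1[of 0] by simp
  \<comment> \<open>The inner average of squared correlations is \<open>Re (ip (S N u) u)\<close> at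
    \<open>u = U (\<gamma> i) f\<close>. If the form vanished, these would be uniformly small,
    contrary to \<open>nz\<close>.\<close>
  have "l \<noteq> 0"
  proof
    assume l: "l = 0"
    have "(\<lambda>N. (\<Sum>i\<in>I N. \<Sum>j\<in>I N. (cmod (ip (U (\<gamma> i) f) (U (\<gamma> j) f)))\<^sup>2) / (real (card (I N)))\<^sup>2) \<longlonglongrightarrow> 0"
    proof (rule tendsto_0_le_approx)
      fix e :: real assume e: "e > 0"
      define q where "q = e / ((nrm f)\<^sup>2 + 1)"
      have "(nrm f)\<^sup>2 + 1 > 0" by (rule add_nonneg_pos) auto
      then have q: "q > 0" "q * (nrm f)\<^sup>2 \<le> e" using e by (auto simp: q_def field_simps)
      obtain N0 where N0: "\<And>N u w. N \<ge> N0 \<Longrightarrow> u \<in> V \<Longrightarrow> w \<in> V \<Longrightarrow> norm (ip (S N u) w - sig u w) \<le> q * nrm u * nrm w"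
        using sig_approx[OF q(1)] by blast
      have "(\<Sum>i\<in>I N. \<Sum>j\<in>I N. (cmod (ip (U (\<gamma> i) f) (U (\<gamma> j) f)))\<^sup>2) / (real (card (I N)))\<^sup>2 \<le> e" if N: "N \<ge> N0" for N
      proof -
        have c: "real (card (I N)) > 0" using asymp_inv_finite(3)[OF ai] by simp
        have "(\<Sum>j\<in>I N. (cmod (ip (U (\<gamma> i) f) (U (\<gamma> j) f)))\<^sup>2) / real (card (I N)) \<le> e" for i
        proof -
          let ?u = "U (\<gamma> i) f"
          have "(\<Sum>j\<in>I N. (cmod (ip ?u (U (\<gamma> j) f)))\<^sup>2) / real (card (I N)) = Re (ip (S N ?u) ?u)"
            using f by (subst ip_S_self) auto
          also have "\<dots> \<le> Re (sig ?u ?u) + norm (ip (S N ?u) ?u - sig ?u ?u)"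
            using complex_Re_le_cmod[of "ip (S N ?u) ?u - sig ?u ?u"] by simp
          also have "\<dots> \<le> 0 + q * nrm ?u * nrm ?u"
            using ub[of ?u] l N0[OF N, of ?u ?u] f by (intro add_mono) auto
          also have "\<dots> \<le> e" using q(2) f by (simp add: power2_eq_square mult.assoc)
          finally show ?thesis .
        qed
        then have "(\<Sum>j\<in>I N. (cmod (ip (U (\<gamma> i) f) (U (\<gamma> j) f)))\<^sup>2) \<le> e * real (card (I N))" for i
          using c by (simp add: pos_divide_le_eq)
        then have "(\<Sum>i\<in>I N. \<Sum>j\<in>I N. (cmod (ip (U (\<gamma> i) f) (U (\<gamma> j) f)))\<^sup>2) \<le> real (card (I N)) * (e * real (card (I N)))"
          by (intro sum_bounded_above)
        then show ?thesis using c by (simp add: pos_divide_le_eq power2_eq_square mult_ac)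
      qed
      then show "\<forall>\<^sub>F N in sequentially. (\<Sum>i\<in>I N. \<Sum>j\<in>I N. (cmod (ip (U (\<gamma> i) f) (U (\<gamma> j) f)))\<^sup>2) / (real (card (I N)))\<^sup>2 \<le> e"
        unfolding eventually_sequentially by blast
    qed (simp add: sum_nonneg)
    then show False using nz by simp
  qed
  then have l: "l > 0" using l0 by simp
  have app: "\<exists>v\<in>V. nrm v \<le> 1 \<and> Re (sig v v) > l - e" if "e > 0" for e
  proof -
    have "l - e < Sup ?X" using that by (simp add: l_def)
    then obtain x where "x \<in> ?X" "l - e < x" using less_cSup_iff[OF ne bdd] by blast
    then show ?thesis by blast
  qed
  obtain w where w: "w \<in> V" "nrm w \<noteq> 0" "\<And>u. u \<in> V \<Longrightarrow> sig w u = of_real l * ip w u"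
    using top_eigenvector[OF l ub app] by blast
  define W where "W = {v \<in> V. \<forall>u\<in>V. sig v u = of_real l * ip v u}"
  have W: "inv_sub W"
    unfolding inv_sub_def
  proof (intro conjI allI ballI)
    show "W \<subseteq> V" by (auto simp: W_def)
    show "subspace W"
      by (rule subspaceI) (auto simp: W_def sg.ip_add_left ip_add_left sg.ip_scale_left ip_scale_left ring_distribs)
    fix g v assume "v \<in> W"
    then have v: "v \<in> V" "\<And>u. u \<in> V \<Longrightarrow> sig v u = of_real l * ip v u" by (auto simp: W_def)
    have "sig (U g v) u = of_real l * ip (U g v) u" if "u \<in> V" for u
      using v that by (simp add: sig_U ip_U_swap)
    then show "U g v \<in> W" using v by (simp add: W_def)
  qed
  \<comment> \<open>Such a system has trace \<open>real k * l\<close>, so its size is at most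
    \<open>(nrm f)\<^sup>2 / l\<close>.\<close>
  have dim: "k \<le> nat \<lceil>(nrm f)\<^sup>2 / l\<rceil>" if o: "orthonormal e k" and e: "\<And>i. i < k \<Longrightarrow> e i \<in> W" for e k
  proof -
    have eV: "e i \<in> V" if "i < k" for i using e[OF that] by (simp add: W_def)
    have "ip (e i) (e i) = 1" if "i < k" for i using o that by (simp add: orthonormal_def)
    then have sk: "(\<Sum>i<k. Re (sig (e i) (e i))) = real k * l"
      using e by (simp add: W_def)
    have "(\<lambda>N. \<Sum>i<k. Re (ip (S N (e i)) (e i))) \<longlonglongrightarrow> (\<Sum>i<k. Re (sig (e i) (e i)))"
      by (intro tendsto_intros sig_lim) (use eV in auto)
    moreover have "(\<Sum>i<k. Re (ip (S N (e i)) (e i))) \<le> (nrm f)\<^sup>2" for N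
    proof -
      have "(\<Sum>i<k. Re (ip (S N (e i)) (e i))) = (\<Sum>i<k. (\<Sum>j\<in>I N. (cmod (ip (e i) (U (\<gamma> j) f)))\<^sup>2) / real (card (I N)))"
        using eV by (intro sum.cong) (auto simp: ip_S_self)
      also have "\<dots> = (\<Sum>j\<in>I N. \<Sum>i<k. (cmod (ip (e i) (U (\<gamma> j) f)))\<^sup>2) / real (card (I N))"
        unfolding sum_divide_distrib[symmetric] by (subst sum.swap) simp
      also have "\<dots> \<le> (real (card (I N)) * (nrm f)\<^sup>2) / real (card (I N))"
      proof (intro divide_right_mono sum_bounded_above)
        fix j
        have "(\<Sum>i<k. (cmod (ip (e i) (U (\<gamma> j) f)))\<^sup>2) = (\<Sum>i<k. (cmod (ip (U (\<gamma> j) f) (e i)))\<^sup>2)"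
        proof (rule sum.cong[OF refl])
          fix i assume "i \<in> {..<k}"
          then have "ip (U (\<gamma> j) f) (e i) = cnj (ip (e i) (U (\<gamma> j) f))" using ip_herm[of "e i" "U (\<gamma> j) f"] eV f by simp
          then show "(cmod (ip (e i) (U (\<gamma> j) f)))\<^sup>2 = (cmod (ip (U (\<gamma> j) f) (e i)))\<^sup>2" by simp
        qed
        also have "\<dots> \<le> (nrm f)\<^sup>2" using bessel[OF o, of "U (\<gamma> j) f"] f by simp
        finally show "(\<Sum>i<k. (cmod (ip (e i) (U (\<gamma> j) f)))\<^sup>2) \<le> (nrm f)\<^sup>2" .
      qed simp
      also have "\<dots> = (nrm f)\<^sup>2" using asymp_inv_finite(3)[OF ai, of N] by simp
      finally show ?thesis .
    qed
    ultimately have "(\<Sum>i<k. Re (sig (e i) (e i))) \<le> (nrm f)\<^sup>2" by (intro LIMSEQ_le_const2) auto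
    then have "real k \<le> (nrm f)\<^sup>2 / l" using sk l by (simp add: field_simps)
    then show ?thesis by linarith
  qed
  have "w \<in> W" using w by (simp add: W_def)
  then have "\<exists>e\<in>W. nrm e \<noteq> 0 \<and> (\<forall>g. \<exists>c. nrm (U g e - c *s e) = 0)"
    by (rule common_eigenvector_finite_dim[OF W _ w(2)]) (rule dim)
  then obtain e where e: "e \<in> W" "nrm e \<noteq> 0" "\<And>g. \<exists>c. nrm (U g e - c *s e) = 0"
    by blast
  have eV: "e \<in> V" and se: "sig e e = of_real l * ip e e" using e(1) by (auto simp: W_def)
  \<comment> \<open>An eigenvector orthogonal to \<open>f\<close> would be orthogonal to the whole
    orbit of \<open>f\<close>. Then every \<open>ip (S N e) e\<close> vanishes, against
    \<open>sig e e = l * ip e e\<close> with \<open>l > 0\<close>.\<close>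
  have "ip e f \<noteq> 0"
  proof
    assume 0: "ip e f = 0"
    have "ip e (U x f) = 0" for x
    proof -
      obtain c where c: "nrm (U (- x) e - c *s e) = 0" using e(3) by blast
      have "ip e (U x f) = ip (U (- x) e) f" using ip_U_swap[of e f "- x"] eV f by simp
      also have "\<dots> = ip (c *s e) f" by (rule ip_eq_of_nrm_zero[OF _ _ f c]) (use eV in auto)
      also have "\<dots> = 0" using 0 eV f by (simp add: ip_scale_left)
      finally show ?thesis .
    qed
    then have "ip (S N e) e = 0" for N using eV by (simp add: ip_S)
    then have "sig e e = 0" using sig_lim[OF eV eV] by (simp add: LIMSEQ_const_iff)
    then show False using se l e(2) eV by (simp add: ip_self)
  qed
  then show ?thesis using e eV by blast
qed

end

section \<open>Koopman operators on bounded functions\<close>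

text \<open>Requiring the functions to vanish off \<open>space M\<close> makes the Koopman operators an action on the nose:
  the hypotheses on \<open>T\<close> only concern points of \<open>space M\<close>.\<close>
definition bfun :: "'a measure \<Rightarrow> ('a \<Rightarrow> complex) set" where
  "bfun M = {f. f \<in> borel_measurable M \<and> (\<exists>C. \<forall>x. norm (f x) \<le> C) \<and> (\<forall>x. x \<notin> space M \<longrightarrow> f x = 0)}"

definition csc :: "complex \<Rightarrow> ('a \<Rightarrow> complex) \<Rightarrow> 'a \<Rightarrow> complex" where
  "csc c f = (\<lambda>x. c * f x)"

definition l2ip :: "'a measure \<Rightarrow> ('a \<Rightarrow> complex) \<Rightarrow> ('a \<Rightarrow> complex) \<Rightarrow> complex" where
  "l2ip M f g = (\<integral>x. f x * cnj (g x) \<partial>M)"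

definition koop :: "'a measure \<Rightarrow> ('g \<Rightarrow> 'a \<Rightarrow> 'a) \<Rightarrow> 'g \<Rightarrow> ('a \<Rightarrow> complex) \<Rightarrow> 'a \<Rightarrow> complex" where
  "koop M T g f = (\<lambda>x. if x \<in> space M then f (T g x) else 0)"

lemma csc_apply [simp]: "csc c f x = c * f x"
  by (simp add: csc_def)

lemma minus_fun_apply' [simp]: "((f::'a \<Rightarrow> 'b::ab_group_add) - g) x = f x - g x"
  by (simp add: fun_diff_def)

lemma sum_fun_apply' [simp]: "(sum (f :: 'i \<Rightarrow> 'a \<Rightarrow> complex) J) x = (\<Sum>i\<in>J. f i x)"
  by (induction J rule: infinite_finite_induct) auto

lemma bfun_measurable [measurable_dest]: "f \<in> bfun M \<Longrightarrow> f \<in> borel_measurable M"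
  by (simp add: bfun_def)

lemma bfun_off: "f \<in> bfun M \<Longrightarrow> x \<notin> space M \<Longrightarrow> f x = 0"
  by (simp add: bfun_def)

lemma bfun_bound: "f \<in> bfun M \<Longrightarrow> \<exists>C\<ge>0. \<forall>x. norm (f x) \<le> C"
proof -
  assume "f \<in> bfun M"
  then obtain C where C: "\<forall>x. norm (f x) \<le> C" by (auto simp: bfun_def)
  then have "0 \<le> C" using norm_ge_zero[of "f undefined"] order_trans by blast
  then show ?thesis using C by blast
qed

lemma bfunI: "f \<in> borel_measurable M \<Longrightarrow> (\<And>x. norm (f x) \<le> C) \<Longrightarrow> (\<And>x. x \<notin> space M \<Longrightarrow> f x = 0) \<Longrightarrow> f \<in> bfun M"
  by (auto simp: bfun_def)

lemma vector_space_csc: "vector_space (csc :: complex \<Rightarrow> ('a \<Rightarrow> complex) \<Rightarrow> 'a \<Rightarrow> complex)"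
  by unfold_locales (auto simp: fun_eq_iff algebra_simps)

lemma bfun_add: "f \<in> bfun M \<Longrightarrow> g \<in> bfun M \<Longrightarrow> f + g \<in> bfun M"
proof -
  assume f: "f \<in> bfun M" and g: "g \<in> bfun M"
  obtain C D where "\<forall>x. norm (f x) \<le> C" "\<forall>x. norm (g x) \<le> D" using bfun_bound[OF f] bfun_bound[OF g] by blast
  moreover have "(\<lambda>x. f x + g x) \<in> borel_measurable M" using f g by measurable
  ultimately show ?thesis
    by (intro bfunI[where C = "C + D"]) (auto simp: plus_fun_def bfun_off[OF f] bfun_off[OF g] intro: norm_triangle_mono)
qed

lemma bfun_mult: "f \<in> bfun M \<Longrightarrow> g \<in> bfun M \<Longrightarrow> f * g \<in> bfun M"
proof -
  assume f: "f \<in> bfun M" and g: "g \<in> bfun M"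
  obtain C D where "C \<ge> 0" "\<forall>x. norm (f x) \<le> C" "\<forall>x. norm (g x) \<le> D" using bfun_bound[OF f] bfun_bound[OF g] by blast
  moreover have "(\<lambda>x. f x * g x) \<in> borel_measurable M" using f g by measurable
  ultimately show ?thesis
    by (intro bfunI[where C = "C * D"]) (auto simp: times_fun_def bfun_off[OF f] norm_mult intro!: mult_mono)
qed

lemma bfun_cnj: "f \<in> bfun M \<Longrightarrow> (\<lambda>x. cnj (f x)) \<in> bfun M"
proof -
  assume f: "f \<in> bfun M"
  obtain C where "\<forall>x. norm (f x) \<le> C" using bfun_bound[OF f] by blast
  moreover have "(\<lambda>x. cnj (f x)) \<in> borel_measurable M"
    by (rule measurable_compose[OF bfun_measurable[OF f] borel_measurable_continuous_onI]) (intro continuous_intros)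
  ultimately show ?thesis
    by (intro bfunI[where C = C]) (auto simp: bfun_off[OF f])
qed

lemma bfun_scale: "f \<in> bfun M \<Longrightarrow> csc c f \<in> bfun M"
proof -
  assume f: "f \<in> bfun M"
  obtain C where "\<forall>x. norm (f x) \<le> C" using bfun_bound[OF f] by blast
  moreover have "(\<lambda>x. c * f x) \<in> borel_measurable M" using f by measurable
  ultimately show ?thesis
    by (intro bfunI[where C = "norm c * C"]) (auto simp: csc_def bfun_off[OF f] norm_mult intro!: mult_left_mono)
qed

lemma bfun_zero: "0 \<in> bfun M"
  by (rule bfunI[where C = 0]) (auto simp: zero_fun_def)

lemma (in prob_space) bfun_integrable: "f \<in> bfun M \<Longrightarrow> integrable M f"
proof -
  assume f: "f \<in> bfun M"
  obtain C where "\<forall>x. norm (f x) \<le> C" using bfun_bound[OF f] by blast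
  then show ?thesis using f by (intro integrable_const_bound[where B = C]) auto
qed

lemma (in prob_space) bfun_ip_integrable: "f \<in> bfun M \<Longrightarrow> g \<in> bfun M \<Longrightarrow> integrable M (\<lambda>x. f x * cnj (g x))"
  using bfun_integrable[OF bfun_mult[of f M "\<lambda>x. cnj (g x)"]] bfun_cnj[of g M] by (simp add: times_fun_def)

lemma (in prob_space) semi_inner_bfun: "complex_semi_inner csc (bfun M) (l2ip M)"
proof -
  interpret vector_space "csc :: complex \<Rightarrow> ('a \<Rightarrow> complex) \<Rightarrow> 'a \<Rightarrow> complex" by (rule vector_space_csc)
  show ?thesis
  proof
    show "subspace (bfun M)" by (rule subspaceI) (auto intro: bfun_add bfun_scale bfun_zero)
    show "l2ip M (u + v) w = l2ip M u w + l2ip M v w" if "u \<in> bfun M" "v \<in> bfun M" "w \<in> bfun M" for u v w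
      using that by (simp add: l2ip_def ring_distribs bfun_ip_integrable)
    show "l2ip M (csc c u) w = c * l2ip M u w" for u w c
      by (simp add: l2ip_def mult.assoc)
    show "l2ip M v u = cnj (l2ip M u v)" for u v
      unfolding l2ip_def by (subst Bochner_Integration.integral_cnj[symmetric]) (simp add: mult.commute)
    show "0 \<le> Re (l2ip M v v)" if "v \<in> bfun M" for v
    proof -
      have "l2ip M v v = (\<integral>x. complex_of_real ((cmod (v x))\<^sup>2) \<partial>M)"
        unfolding l2ip_def by (simp only: complex_norm_square)
      also have "\<dots> = complex_of_real (\<integral>x. (cmod (v x))\<^sup>2 \<partial>M)" by (rule integral_complex_of_real)
      finally show ?thesis by simp
    qed
  qed
qed

section \<open>The Koopman representation, bounded limits, and consequences of ergodicity\<close>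

locale mp_system =
  fixes M :: "'a measure" and T :: "'g::{countable,ab_group_add} \<Rightarrow> 'a \<Rightarrow> 'a"
  assumes mp: "mp_action M T"
begin

sublocale prob_space M using mp by (simp add: mp_action_def)

lemma T_measurable [measurable]: "T g \<in> measurable M M" and T_distr: "distr M M (T g) = M"
  and T_0: "x \<in> space M \<Longrightarrow> T 0 x = x" and T_plus: "x \<in> space M \<Longrightarrow> T (g + h) x = T g (T h x)"
  using mp by (auto simp: mp_action_def)

lemma T_space: "x \<in> space M \<Longrightarrow> T g x \<in> space M"
  using measurable_space[OF T_measurable] .

lemma T_integral: "h \<in> borel_measurable M \<Longrightarrow> (\<integral>x. h (T g x) \<partial>M) = (\<integral>x. h x \<partial>M)"
  for h :: "'a \<Rightarrow> 'b::{banach, second_countable_topology}"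
  using integral_distr[OF T_measurable, of h g] T_distr by simp

lemma AE_T: "AE x in M. P x \<Longrightarrow> AE x in M. P (T g x)"
  by (rule AE_distrD[where M' = M, OF T_measurable]) (subst T_distr)

lemma koop_bfun: assumes f: "f \<in> bfun M" shows "koop M T g f \<in> bfun M"
proof -
  obtain C where C: "0 \<le> C" "\<forall>x. norm (f x) \<le> C" using bfun_bound[OF f] by blast
  have "(\<lambda>x. f (T g x)) \<in> borel_measurable M" by (rule measurable_compose[OF T_measurable bfun_measurable[OF f]])
  then have "koop M T g f \<in> borel_measurable M" unfolding koop_def by (rule measurable_cong[THEN iffD1, rotated]) simp
  then show ?thesis using C by (intro bfunI[where C = C]) (auto simp: koop_def)
qed

sublocale L: unitary_action csc "bfun M" "l2ip M" "koop M T"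
proof -
  interpret complex_semi_inner csc "bfun M" "l2ip M" by (rule semi_inner_bfun)
  show "unitary_action csc (bfun M) (l2ip M) (koop M T)"
  proof
    show "koop M T g v \<in> bfun M" if "v \<in> bfun M" for g v using koop_bfun[OF that] .
    show "koop M T g (u + v) = koop M T g u + koop M T g v" for g u v by (auto simp: koop_def)
    show "koop M T g (csc c v) = csc c (koop M T g v)" for g c v by (auto simp: koop_def)
    show "l2ip M (koop M T g u) (koop M T g v) = l2ip M u v" if u: "u \<in> bfun M" and v: "v \<in> bfun M" for g u v
    proof -
      have "l2ip M (koop M T g u) (koop M T g v) = (\<integral>x. u (T g x) * cnj (v (T g x)) \<partial>M)"
        unfolding l2ip_def by (rule Bochner_Integration.integral_cong) (auto simp: koop_def)
      also have "\<dots> = l2ip M u v"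
        unfolding l2ip_def
        using T_integral[of "\<lambda>x. u x * cnj (v x)" g] bfun_ip_integrable[OF u v] by simp
      finally show ?thesis .
    qed
    show "koop M T (g + h) v = koop M T g (koop M T h v)" if "v \<in> bfun M" for g h v
    proof
      fix x
      \<comment> \<open>Composition with \<open>T\<close> reverses the order of the factors;
        commutativity of the group restores it.\<close>
      have "T (g + h) x = T h (T g x)" if "x \<in> space M"
        using T_plus[OF that, of h g] by (simp add: add.commute)
      then show "koop M T (g + h) v x = koop M T g (koop M T h v) x" by (simp add: koop_def T_space)
    qed
    show "koop M T 0 v = v" if "v \<in> bfun M" for v
      using bfun_off[OF that] by (auto simp: koop_def T_0)
  qed
qed

lemma avg_apply: "L.avg J x y = (\<Sum>i\<in>J. x i y) / of_nat (card J)"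
  by (simp add: L.avg_def)

lemma ip_self_integral: "l2ip M v v = of_real (\<integral>x. (cmod (v x))\<^sup>2 \<partial>M)"
proof -
  have "l2ip M v v = (\<integral>x. complex_of_real ((cmod (v x))\<^sup>2) \<partial>M)"
    unfolding l2ip_def by (simp only: complex_norm_square)
  then show ?thesis by (simp only: integral_complex_of_real)
qed

lemma nrm_sq_integral: "v \<in> bfun M \<Longrightarrow> (L.nrm v)\<^sup>2 = (\<integral>x. (cmod (v x))\<^sup>2 \<partial>M)"
  by (simp add: L.nrm_sq ip_self_integral)

lemma bfun_sq_integrable: "v \<in> bfun M \<Longrightarrow> integrable M (\<lambda>x. (cmod (v x))\<^sup>2)"
proof -
  assume v: "v \<in> bfun M"
  obtain C where C: "0 \<le> C" "\<forall>x. norm (v x) \<le> C" using bfun_bound[OF v] by blast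
  have "(\<lambda>x. (cmod (v x))\<^sup>2) \<in> borel_measurable M" using v by measurable
  then show ?thesis
    using C by (intro integrable_const_bound[where B = "C\<^sup>2"]) (auto intro!: power_mono)
qed

lemma nrm_zero_iff_AE: assumes v: "v \<in> bfun M" shows "L.nrm v = 0 \<longleftrightarrow> (AE x in M. v x = 0)"
proof -
  have "L.nrm v = 0 \<longleftrightarrow> (L.nrm v)\<^sup>2 = 0" by simp
  also have "\<dots> \<longleftrightarrow> (AE x in M. (cmod (v x))\<^sup>2 = 0)"
    unfolding nrm_sq_integral[OF v]
    by (rule integral_nonneg_eq_0_iff_AE[OF bfun_sq_integrable[OF v]]) simp
  finally show ?thesis by simp
qed

lemma nrm_le_bound: assumes v: "v \<in> bfun M" and C: "\<And>x. norm (v x) \<le> C" shows "L.nrm v \<le> C"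
proof -
  have C0: "0 \<le> C" using C norm_ge_zero order_trans by blast
  have "(L.nrm v)\<^sup>2 \<le> (\<integral>x. C\<^sup>2 \<partial>M)"
    unfolding nrm_sq_integral[OF v]
    by (intro integral_mono bfun_sq_integrable[OF v]) (use C in \<open>auto intro!: power_mono\<close>)
  then have "(L.nrm v)\<^sup>2 \<le> C\<^sup>2" by (simp add: prob_space)
  then show ?thesis using C0 by (rule power2_le_imp_le)
qed

definition cst :: "complex \<Rightarrow> 'a \<Rightarrow> complex" where
  "cst c = (\<lambda>x. if x \<in> space M then c else 0)"

lemma cst_bfun [simp]: "cst c \<in> bfun M"
proof (rule bfunI[where C = "norm c"])
  show "cst c \<in> borel_measurable M" unfolding cst_def by (rule measurable_cong[THEN iffD1, of _ "\<lambda>_. c"]) auto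
qed (auto simp: cst_def)

lemma l1_le_nrm: assumes v: "v \<in> bfun M" shows "(\<integral>x. norm (v x) \<partial>M) \<le> L.nrm v"
proof -
  let ?a = "\<lambda>x. complex_of_real (norm (v x))"
  obtain C where C: "0 \<le> C" "\<forall>x. norm (v x) \<le> C" using bfun_bound[OF v] by blast
  have "?a \<in> borel_measurable M" using v by measurable
  then have a: "?a \<in> bfun M" using C bfun_off[OF v] by (intro bfunI[where C = C]) auto
  have "l2ip M ?a (cst 1) = (\<integral>x. ?a x \<partial>M)"
    unfolding l2ip_def by (rule Bochner_Integration.integral_cong) (auto simp: cst_def)
  then have "norm (l2ip M ?a (cst 1)) = (\<integral>x. norm (v x) \<partial>M)" by simp
  then have "(\<integral>x. norm (v x) \<partial>M) \<le> L.nrm ?a * L.nrm (cst 1)"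
    using L.cauchy_schwarz[OF a cst_bfun, of 1] by simp
  also have "L.nrm ?a = L.nrm v"
    unfolding L.nrm_def ip_self_integral by simp
  also have "L.nrm v * L.nrm (cst 1) \<le> L.nrm v * 1"
    by (intro mult_left_mono nrm_le_bound cst_bfun) (use v in \<open>auto simp: cst_def\<close>)
  finally show ?thesis by simp
qed

text \<open>A sup bound survives in the almost everywhere limit of a subsequence, so the limit is
  again a bounded function. The same bound provides the dominating function that turns this
  convergence back into norm convergence.\<close>

lemma complete_bounded:
  assumes x: "\<And>n. x n \<in> bfun M" and C: "\<And>n y. norm (x n y) \<le> C"
    and Cauchy: "\<And>e. e > 0 \<Longrightarrow> \<exists>n0. \<forall>n\<ge>n0. \<forall>m\<ge>n0. L.nrm (x n - x m) \<le> e"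
  shows "\<exists>l\<in>bfun M. (\<forall>y. norm (l y) \<le> C) \<and> (\<lambda>n. L.nrm (x n - l)) \<longlonglongrightarrow> 0"
proof -
  have C0: "0 \<le> C" using C norm_ge_zero order_trans by blast
  obtain r where r: "strict_mono r" and ae: "AE y in M. Cauchy (\<lambda>i. x (r i) y)"
  proof (rule cauchy_L1_AE_cauchy_subseq[of M x])
    show "integrable M (x n)" for n using bfun_integrable[OF x] .
    fix e :: real assume e: "e > 0"
    then obtain n0 where n0: "\<forall>n\<ge>n0. \<forall>m\<ge>n0. L.nrm (x n - x m) \<le> e/2" using Cauchy[of "e/2"] by auto
    have "(LINT y|M. norm (x i y - x j y)) < e" if "i \<ge> n0" "j \<ge> n0" for i j
      using l1_le_nrm[of "x i - x j"] n0 that x[of i] x[of j] e by force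
    then show "\<exists>N. \<forall>i\<ge>N. \<forall>j\<ge>N. LINT y|M. norm (x i y - x j y) < e" by blast
  qed
  \<comment> \<open>The value 0 where the subsequence diverges keeps \<open>l\<close> measurable and
    inside the bound.\<close>
  define l where "l = (\<lambda>y. if y \<in> space M \<and> Cauchy (\<lambda>i. x (r i) y) then lim (\<lambda>i. x (r i) y) else 0)"
  have m[measurable]: "\<And>n. x n \<in> borel_measurable M" using x by (simp add: bfun_def)
  have "(\<lambda>y. if Cauchy (\<lambda>i. x (r i) y) then lim (\<lambda>i. x (r i) y) else 0) \<in> borel_measurable M" by measurable
  then have "l \<in> borel_measurable M" by (rule measurable_cong[THEN iffD1, rotated]) (simp add: l_def)
  moreover have lC: "norm (l y) \<le> C" for y
  proof (cases "y \<in> space M \<and> Cauchy (\<lambda>i. x (r i) y)")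
    case True
    then have "(\<lambda>i. x (r i) y) \<longlonglongrightarrow> l y" by (simp add: l_def Cauchy_convergent_iff convergent_LIMSEQ_iff)
    then have "(\<lambda>i. norm (x (r i) y)) \<longlonglongrightarrow> norm (l y)" by (rule tendsto_norm)
    then show ?thesis by (rule LIMSEQ_le_const2) (use C in blast)
  next
    case False
    then show ?thesis unfolding l_def using C0 by auto
  qed
  ultimately have l: "l \<in> bfun M" by (rule bfunI) (simp add: l_def)
  have aelim: "AE y in M. (\<lambda>i. x (r i) y) \<longlonglongrightarrow> l y"
    using ae by (rule AE_mp) (auto intro!: AE_I2 simp: l_def Cauchy_convergent_iff convergent_LIMSEQ_iff)
  have fat: "L.nrm (x n - l) \<le> e" if b: "\<forall>m\<ge>n0. L.nrm (x n - x m) \<le> e" and e: "e > 0" for n n0 e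
  proof -
    have lim: "(\<lambda>i. \<integral>y. (cmod (x n y - x (r i) y))\<^sup>2 \<partial>M) \<longlonglongrightarrow> (\<integral>y. (cmod (x n y - l y))\<^sup>2 \<partial>M)"
    proof (rule integral_dominated_convergence[where w = "\<lambda>_. (2 * C)\<^sup>2"])
      show "AE y in M. (\<lambda>i. (cmod (x n y - x (r i) y))\<^sup>2) \<longlonglongrightarrow> (cmod (x n y - l y))\<^sup>2"
        using aelim by (rule AE_mp) (auto intro!: AE_I2 tendsto_intros)
      show "AE y in M. norm ((cmod (x n y - x (r i) y))\<^sup>2) \<le> (2 * C)\<^sup>2" for i
      proof (rule AE_I2)
        fix y
        have "cmod (x n y - x (r i) y) \<le> 2 * C" using norm_triangle_ineq4[of "x n y" "x (r i) y"] C[of n y] C[of "r i" y] by linarith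
        then show "norm ((cmod (x n y - x (r i) y))\<^sup>2) \<le> (2 * C)\<^sup>2"
          using power_mono[of "cmod (x n y - x (r i) y)" "2 * C" 2] by simp
      qed
      show "(\<lambda>y. (cmod (x n y - l y))\<^sup>2) \<in> borel_measurable M" using l by measurable
    qed auto
    have "(L.nrm (x n - l))\<^sup>2 \<le> e\<^sup>2"
    proof (rule LIMSEQ_le_const2)
      show "(\<lambda>i. (L.nrm (x n - x (r i)))\<^sup>2) \<longlonglongrightarrow> (L.nrm (x n - l))\<^sup>2"
        using lim x l by (simp add: nrm_sq_integral)
      have "(L.nrm (x n - x (r i)))\<^sup>2 \<le> e\<^sup>2" if "i \<ge> n0" for i
        using b seq_suble[OF r, of i] that x by (intro power_mono) auto
      then show "\<exists>N. \<forall>i\<ge>N. (L.nrm (x n - x (r i)))\<^sup>2 \<le> e\<^sup>2" by blast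
    qed
    then show ?thesis by (rule power2_le_imp_le) (use e in simp)
  qed
  have "(\<lambda>n. L.nrm (x n - l)) \<longlonglongrightarrow> 0"
  proof (rule tendsto_0_le_approx)
    show "0 \<le> L.nrm (x n - l)" for n using x l by simp
    fix e :: real assume e: "e > 0"
    then obtain n0 where n0: "\<forall>n\<ge>n0. \<forall>m\<ge>n0. L.nrm (x n - x m) \<le> e" using Cauchy by blast
    then have "L.nrm (x n - l) \<le> e" if "n \<ge> n0" for n using fat[of n0 n e] e that by blast
    then show "\<forall>\<^sub>F n in sequentially. L.nrm (x n - l) \<le> e" unfolding eventually_sequentially by blast
  qed
  then show ?thesis using l lC by blast
qed

lemma koop_bound: "(\<And>x. norm (f x) \<le> C) \<Longrightarrow> 0 \<le> C \<Longrightarrow> norm (koop M T g f x) \<le> C"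
  by (simp add: koop_def)

lemma avg_bound:
  assumes "finite J" "J \<noteq> {}" "\<And>i y. i \<in> J \<Longrightarrow> norm (x i y) \<le> C"
  shows "norm (L.avg J x y) \<le> C"
proof -
  have "norm (\<Sum>i\<in>J. x i y) \<le> real (card J) * C"
    using assms by (intro order_trans[OF norm_sum] sum_bounded_above) auto
  then show ?thesis using assms by (simp add: avg_apply norm_divide divide_le_eq card_gt_0_iff mult.commute)
qed

lemma mean_ergodic_limit:
  assumes ai: "asymp_inv I \<gamma>" and f: "f \<in> bfun M"
  shows "\<exists>l\<in>bfun M. (\<lambda>N. L.nrm (L.avg (I N) (\<lambda>i. koop M T (\<gamma> i) f) - l)) \<longlonglongrightarrow> 0 \<and>
           (\<forall>h. L.nrm (koop M T h l - l) = 0)"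
proof -
  obtain C where C: "0 \<le> C" "\<forall>x. norm (f x) \<le> C" using bfun_bound[OF f] by blast
  have "\<exists>l\<in>bfun M. (\<forall>y. norm (l y) \<le> C) \<and> (\<lambda>N. L.nrm (L.avg (I N) (\<lambda>i. koop M T (\<gamma> i) f) - l)) \<longlonglongrightarrow> 0"
  proof (rule complete_bounded)
    show "L.avg (I n) (\<lambda>i. koop M T (\<gamma> i) f) \<in> bfun M" for n using f by simp
    show "norm (L.avg (I n) (\<lambda>i. koop M T (\<gamma> i) f) y) \<le> C" for n y
      by (rule avg_bound) (use asymp_inv_finite[OF ai] C koop_bound in auto)
    fix e :: real assume "e > 0"
    then show "\<exists>n0. \<forall>n\<ge>n0. \<forall>m\<ge>n0. L.nrm (L.avg (I n) (\<lambda>i. koop M T (\<gamma> i) f) - L.avg (I m) (\<lambda>i. koop M T (\<gamma> i) f)) \<le> e"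
      by (rule L.mean_ergodic_Cauchy[OF ai f])
  qed
  then show ?thesis using L.mean_ergodic_limit_invariant[OF ai f] by blast
qed

text \<open>\<open>ergodic_action\<close> speaks of strictly invariant sets, whereas
  \<open>r\<close> is invariant only almost everywhere. The points whose whole orbit satisfies
  \<open>r \<le> c\<close> form a strictly invariant set, which by countability of the group differs
  from the sublevel set by a null set.\<close>

lemma ergodic_invariant_real:
  fixes r :: "'a \<Rightarrow> real"
  assumes erg: "ergodic_action M T" and r: "integrable M r" and inv: "\<And>g. AE x in M. r (T g x) = r x"
  shows "AE x in M. r x = (\<integral>x. r x \<partial>M)"
proof -
  have [measurable]: "r \<in> borel_measurable M" using r by simp
  define a where "a = (\<integral>x. r x \<partial>M)"
  have zo: "(AE x in M. r x > c) \<or> (AE x in M. r x \<le> c)" for c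
  proof -
    define B where "B = {x \<in> space M. \<forall>g. r (T g x) \<le> c}"
    have [measurable]: "B \<in> sets M" unfolding B_def by measurable
    have "T g -` B \<inter> space M = B" for g
    proof (intro set_eqI iffI)
      fix x assume "x \<in> T g -` B \<inter> space M"
      then have x: "x \<in> space M" "\<And>h. r (T h (T g x)) \<le> c" by (auto simp: B_def)
      have "r (T h x) \<le> c" for h
        using x(2)[of "h - g"] T_plus[OF x(1), of "h - g" g] by simp
      then show "x \<in> B" using x by (simp add: B_def)
    next
      fix x assume "x \<in> B"
      then have x: "x \<in> space M" "\<And>h. r (T h x) \<le> c" by (auto simp: B_def)
      have "r (T h (T g x)) \<le> c" for h using x(2)[of "h + g"] T_plus[OF x(1), of h g] by simp
      then show "x \<in> T g -` B \<inter> space M" using x T_space by (simp add: B_def)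
    qed
    then have zero_one: "emeasure M B = 0 \<or> emeasure M B = 1" using erg by (simp add: ergodic_action_def)
    have "AE x in M. \<forall>g. r (T g x) = r x" using inv by (subst AE_all_countable) auto
    then have eqB: "AE x in M. x \<in> B \<longleftrightarrow> r x \<le> c"
      by (rule AE_mp) (auto intro!: AE_I2 simp: B_def)
    from zero_one show ?thesis
    proof
      assume "emeasure M B = 0"
      then have "AE x in M. x \<notin> B" by (intro AE_not_in) (simp add: null_sets_def)
      with eqB have "AE x in M. r x > c" by eventually_elim auto
      then show ?thesis ..
    next
      assume "emeasure M B = 1"
      then have "AE x in M. x \<in> B" by (simp add: AE_in_set_eq_1 measure_def)
      with eqB have "AE x in M. r x \<le> c" by eventually_elim auto
      then show ?thesis ..
    qed
  qed
  \<comment> \<open>By the zero-one law the alternative is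
    \<open>r \<le> a - 1 / real (Suc n)\<close> almost everywhere, which contradicts that
    \<open>a\<close> is the mean. A function that is at least its own mean almost everywhere equals
    it almost everywhere.\<close>
  have "AE x in M. r x > a - 1 / real (Suc n)" for n
  proof (rule ccontr)
    assume "\<not> ?thesis"
    then have "AE x in M. r x \<le> a - 1 / real (Suc n)" using zo by blast
    then have "(\<integral>x. r x \<partial>M) \<le> (\<integral>x. a - 1 / real (Suc n) \<partial>M)" by (intro integral_mono_AE r) auto
    then show False by (simp add: a_def prob_space)
  qed
  then have "AE x in M. \<forall>n. r x > a - 1 / real (Suc n)" by (subst AE_all_countable) auto
  then have ge: "AE x in M. 0 \<le> r x - a"
  proof (rule AE_mp, intro AE_I2 impI)
    fix x assume *: "\<forall>n. r x > a - 1 / real (Suc n)"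
    have "(\<lambda>n. a - 1 / real (Suc n)) \<longlonglongrightarrow> a - 0" by (intro tendsto_intros LIMSEQ_Suc[OF lim_1_over_n])
    then have "a - 0 \<le> r x" by (rule LIMSEQ_le_const2) (use * less_imp_le in blast)
    then show "0 \<le> r x - a" by simp
  qed
  have "(\<integral>x. r x - a \<partial>M) = 0" using r by (simp add: a_def prob_space)
  then have "AE x in M. r x - a = 0"
    using integral_nonneg_eq_0_iff_AE[of M "\<lambda>x. r x - a"] ge r by simp
  then show ?thesis by (simp add: a_def)
qed

lemma ergodic_invariant_const:
  assumes erg: "ergodic_action M T" and l: "l \<in> bfun M" and inv: "\<And>h. L.nrm (koop M T h l - l) = 0"
  shows "\<exists>c. L.nrm (l - cst c) = 0"
proof -
  have inv': "AE x in M. l (T g x) = l x" for g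
  proof -
    have "AE x in M. (koop M T g l - l) x = 0" using nrm_zero_iff_AE[of "koop M T g l - l"] inv[of g] l by simp
    then show ?thesis by (rule AE_mp) (auto intro!: AE_I2 simp: koop_def)
  qed
  have il: "integrable M l" by (rule bfun_integrable[OF l])
  have "AE x in M. Re (l x) = (\<integral>x. Re (l x) \<partial>M)"
  proof (rule ergodic_invariant_real[OF erg])
    show "AE x in M. Re (l (T g x)) = Re (l x)" for g using inv'[of g] by eventually_elim simp
  qed (use il in simp)
  moreover have "AE x in M. Im (l x) = (\<integral>x. Im (l x) \<partial>M)"
  proof (rule ergodic_invariant_real[OF erg])
    show "AE x in M. Im (l (T g x)) = Im (l x)" for g using inv'[of g] by eventually_elim simp
  qed (use il in simp)
  ultimately have "AE x in M. l x = Complex (\<integral>x. Re (l x) \<partial>M) (\<integral>x. Im (l x) \<partial>M)"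
    by eventually_elim (simp add: complex_eq_iff)
  then have "AE x in M. (l - cst (Complex (\<integral>x. Re (l x) \<partial>M) (\<integral>x. Im (l x) \<partial>M))) x = 0"
    by (rule AE_mp) (auto intro!: AE_I2 simp: cst_def)
  then have "L.nrm (l - cst (Complex (\<integral>x. Re (l x) \<partial>M) (\<integral>x. Im (l x) \<partial>M))) = 0"
    by (subst nrm_zero_iff_AE) (use l in auto)
  then show ?thesis by blast
qed

lemma ip_cst: "f \<in> bfun M \<Longrightarrow> l2ip M f (cst c) = cnj c * (\<integral>x. f x \<partial>M)"
proof -
  assume f: "f \<in> bfun M"
  have "l2ip M f (cst c) = (\<integral>x. cnj c * f x \<partial>M)"
    unfolding l2ip_def by (rule Bochner_Integration.integral_cong) (auto simp: cst_def)
  then show ?thesis by simp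
qed

theorem mean_ergodic:
  assumes erg: "ergodic_action M T" and ai: "asymp_inv I \<gamma>" and f: "f \<in> bfun M"
  shows "(\<lambda>N. L.nrm (L.avg (I N) (\<lambda>i. koop M T (\<gamma> i) f) - cst (\<integral>x. f x \<partial>M))) \<longlonglongrightarrow> 0"
proof -
  let ?A = "\<lambda>N. L.avg (I N) (\<lambda>i. koop M T (\<gamma> i) f)"
  obtain l where l: "l \<in> bfun M" and lim: "(\<lambda>N. L.nrm (?A N - l)) \<longlonglongrightarrow> 0"
    and inv: "\<And>h. L.nrm (koop M T h l - l) = 0" using mean_ergodic_limit[OF ai f] by blast
  obtain c where c: "L.nrm (l - cst c) = 0" using ergodic_invariant_const[OF erg l inv] by blast
  have A: "?A N \<in> bfun M" for N using f by simp
  have lim': "(\<lambda>N. L.nrm (?A N - cst c)) \<longlonglongrightarrow> 0"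
  proof (rule null_squeeze[OF lim])
    show "L.nrm (?A N - cst c) \<le> L.nrm (?A N - l)" for N
      using L.nrm_triangle3[OF A l cst_bfun, of N c] c by simp
  qed (use A in simp)
  \<comment> \<open>The constant 1 is fixed by the action, so the averages all keep the integral of
    \<open>f\<close>; this identifies the limit constant \<open>c\<close>.\<close>
  have "l2ip M (?A N) (cst 1) = l2ip M f (cst 1)" for N
  proof -
    have "l2ip M (koop M T g f) (cst 1) = l2ip M f (cst 1)" for g
    proof -
      have "koop M T g (cst 1) = cst 1" by (auto simp: koop_def cst_def T_space)
      then show ?thesis using L.U_ip[OF f cst_bfun, of g 1] by simp
    qed
    then show ?thesis using f asymp_inv_finite(3)[OF ai, of N] by (subst L.ip_avg_left) auto
  qed
  then have "norm (l2ip M f (cst 1) - l2ip M (cst c) (cst 1)) \<le> L.nrm (?A N - cst c) * L.nrm (cst 1)" for N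
    using L.cauchy_schwarz[of "?A N - cst c" "cst 1"] A by (simp add: L.ip_diff_left)
  moreover have "(\<lambda>N. L.nrm (?A N - cst c) * L.nrm (cst 1)) \<longlonglongrightarrow> 0 * L.nrm (cst 1)" by (intro tendsto_intros lim')
  ultimately have "norm (l2ip M f (cst 1) - l2ip M (cst c) (cst 1)) \<le> 0 * L.nrm (cst 1)"
    by (intro LIMSEQ_le_const) auto
  then have "(\<integral>x. f x \<partial>M) = (\<integral>x. cst c x \<partial>M)" using f by (simp add: ip_cst)
  also have "\<dots> = (\<integral>x. c \<partial>M)" by (rule Bochner_Integration.integral_cong) (auto simp: cst_def)
  also have "\<dots> = c" by (simp add: prob_space)
  finally show ?thesis using lim' by simp
qed

end

section \<open>Functions orthogonal to the eigenfunctions\<close>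

text \<open>The integral kernel of the rank one operator
  \<open>u \<mapsto> \<langle>u, f\<rangle> f\<close>. Translating it by the product action gives
  the kernel belonging to the translate of \<open>f\<close>, so averages of these operators are
  ergodic averages of one function on the square of the system.\<close>

definition tens :: "('a \<Rightarrow> complex) \<Rightarrow> 'a \<times> 'a \<Rightarrow> complex" where
  "tens f = (\<lambda>(x, y). f x * cnj (f y))"

definition prod_act :: "('g \<Rightarrow> 'a \<Rightarrow> 'a) \<Rightarrow> 'g \<Rightarrow> 'a \<times> 'a \<Rightarrow> 'a \<times> 'a" where
  "prod_act T g = (\<lambda>(x, y). (T g x, T g y))"

lemma bfun_tens: assumes f: "f \<in> bfun M" shows "tens f \<in> bfun (M \<Otimes>\<^sub>M M)"
proof -
  obtain C where C: "C \<ge> 0" "\<forall>x. norm (f x) \<le> C" using bfun_bound[OF f] by blast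
  have [measurable]: "f \<in> borel_measurable M" "(\<lambda>x. cnj (f x)) \<in> borel_measurable M"
    using f bfun_cnj[OF f] by (auto simp: bfun_def)
  have "tens f \<in> borel_measurable (M \<Otimes>\<^sub>M M)" unfolding tens_def by measurable
  then show ?thesis
    by (rule bfunI[where C = "C * C"], use C in \<open>auto simp: tens_def norm_mult intro!: mult_mono\<close>)
      (metis bfun_off[OF f] SigmaI space_pair_measure)
qed

context mp_system
begin

lemma mp_prod: "mp_action (M \<Otimes>\<^sub>M M) (prod_act T)"
proof -
  interpret pp: pair_prob_space M M ..
  have 1: "prod_act T g \<in> measurable (M \<Otimes>\<^sub>M M) (M \<Otimes>\<^sub>M M)" for g
    unfolding prod_act_def by measurable
  have "sigma_finite_measure (distr M M (T g))" for g unfolding T_distr by unfold_locales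
  then have "distr (M \<Otimes>\<^sub>M M) (M \<Otimes>\<^sub>M M) (prod_act T g) = M \<Otimes>\<^sub>M M" for g
    unfolding prod_act_def using pair_measure_distr[OF T_measurable T_measurable, of g g] by (simp add: T_distr)
  moreover have "prob_space (M \<Otimes>\<^sub>M M)" by unfold_locales
  ultimately show ?thesis using 1
    by (auto simp: mp_action_def prod_act_def space_pair_measure T_0 T_plus)
qed

lemma koop_tens: "koop (M \<Otimes>\<^sub>M M) (prod_act T) g (tens f) = tens (koop M T g f)"
  by (auto simp: koop_def tens_def prod_act_def space_pair_measure fun_eq_iff)

lemma mp_system_prod: "mp_system (M \<Otimes>\<^sub>M M) (prod_act T)"
  by (rule mp_system.intro) (rule mp_prod)

text \<open>The operator norm is at most the Hilbert-Schmidt norm: Cauchy-Schwarz in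
  \<open>y\<close> for each fixed \<open>x\<close>, then integration over \<open>x\<close>.\<close>

lemma kernel_operator_bound:
  assumes w: "w \<in> bfun M" and u: "u \<in> bfun M" and D: "D \<in> bfun (M \<Otimes>\<^sub>M M)"
    and eq: "\<And>x. x \<in> space M \<Longrightarrow> w x = (\<integral>y. D (x, y) * u y \<partial>M)"
  shows "L.nrm w \<le> complex_semi_inner.nrm (l2ip (M \<Otimes>\<^sub>M M)) D * L.nrm u"
proof -
  interpret pp: pair_prob_space M M ..
  interpret P: mp_system "M \<Otimes>\<^sub>M M" "prod_act T" by (rule mp_system_prod)
  \<comment> \<open>The form is conjugate linear in its second argument, so \<open>u\<close> has to
    enter as its conjugate, which has the same norm.\<close>
  have cu: "(\<lambda>x. cnj (u x)) \<in> bfun M" by (rule bfun_cnj[OF u])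
  have ncu: "L.nrm (\<lambda>x. cnj (u x)) = L.nrm u" unfolding L.nrm_def ip_self_integral by simp
  obtain C where C: "C \<ge> 0" "\<forall>x. norm (D x) \<le> C" using bfun_bound[OF D] by blast
  have Dx: "(\<lambda>y. D (x, y)) \<in> bfun M" if x: "x \<in> space M" for x
  proof (rule bfunI[where C = C])
    show "(\<lambda>y. D (x, y)) \<in> borel_measurable M" by (rule measurable_Pair2[OF bfun_measurable[OF D] x])
  qed (use C bfun_off[OF D] in \<open>auto simp: space_pair_measure\<close>)
  have int: "integrable (M \<Otimes>\<^sub>M M) (\<lambda>z. (cmod (D z))\<^sup>2)" by (rule P.bfun_sq_integrable[OF D])
  have pt: "(cmod (w x))\<^sup>2 \<le> (\<integral>y. (cmod (D (x, y)))\<^sup>2 \<partial>M) * (L.nrm u)\<^sup>2" if x: "x \<in> space M" for x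
  proof -
    have "w x = l2ip M (\<lambda>y. D (x, y)) (\<lambda>x. cnj (u x))" using eq[OF x] by (simp add: l2ip_def)
    then have "cmod (w x) \<le> L.nrm (\<lambda>y. D (x, y)) * L.nrm u"
      using L.cauchy_schwarz[OF Dx[OF x] cu] ncu by simp
    then have "(cmod (w x))\<^sup>2 \<le> (L.nrm (\<lambda>y. D (x, y)) * L.nrm u)\<^sup>2" by (intro power_mono) auto
    then show ?thesis by (simp add: power_mult_distrib nrm_sq_integral[OF Dx[OF x]])
  qed
  have "(L.nrm w)\<^sup>2 = (\<integral>x. (cmod (w x))\<^sup>2 \<partial>M)" by (rule nrm_sq_integral[OF w])
  also have "\<dots> \<le> (\<integral>x. (\<integral>y. (cmod (D (x, y)))\<^sup>2 \<partial>M) * (L.nrm u)\<^sup>2 \<partial>M)"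
    by (intro integral_mono bfun_sq_integrable[OF w] integrable_mult_left pp.integrable_fst'[OF int] pt)
  also have "\<dots> = (P.L.nrm D)\<^sup>2 * (L.nrm u)\<^sup>2"
    using pp.integral_fst'[OF int] by (simp add: P.nrm_sq_integral[OF D])
  finally have "(L.nrm w)\<^sup>2 \<le> (P.L.nrm D * L.nrm u)\<^sup>2" by (simp add: power_mult_distrib)
  then show ?thesis by (rule power2_le_imp_le) (use D u in simp)
qed

text \<open>The kernels of the operators \<open>S N\<close> are ergodic averages on the product
  system, hence Cauchy in L2, and \<open>kernel_operator_bound\<close> makes this uniform over
  \<open>u\<close>. Since the product system may fail to be ergodic, it is the Cauchy form of the
  ergodic theorem that is applied there.\<close>

lemma orbit_form_bfun:
  assumes ai: "asymp_inv I \<gamma>" and f: "f \<in> bfun M"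
  shows "orbit_form csc (bfun M) (l2ip M) (koop M T) I \<gamma> f
     (\<lambda>N u. L.avg (I N) (\<lambda>i. csc (l2ip M u (koop M T (\<gamma> i) f)) (koop M T (\<gamma> i) f)))"
proof -
  interpret P: mp_system "M \<Otimes>\<^sub>M M" "prod_act T" by (rule mp_system_prod)
  define S where "S = (\<lambda>N u. L.avg (I N) (\<lambda>i. csc (l2ip M u (koop M T (\<gamma> i) f)) (koop M T (\<gamma> i) f)))"
  define K where "K = (\<lambda>N. P.L.avg (I N) (\<lambda>i. koop (M \<Otimes>\<^sub>M M) (prod_act T) (\<gamma> i) (tens f)))"
  have KV: "K N \<in> bfun (M \<Otimes>\<^sub>M M)" for N unfolding K_def using bfun_tens[OF f] by simp
  have SV: "S N u \<in> bfun M" for N u unfolding S_def using f by simp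
  have Kx: "K N (x, y) = (\<Sum>i\<in>I N. koop M T (\<gamma> i) f x * cnj (koop M T (\<gamma> i) f y)) / of_nat (card (I N))" for N x y
    unfolding K_def P.avg_apply by (simp add: koop_tens) (simp add: tens_def)
  have S_int: "S N u x = (\<integral>y. K N (x, y) * u y \<partial>M)" if u: "u \<in> bfun M" for N u x
  proof -
    have i: "integrable M (\<lambda>y. u y * cnj (koop M T (\<gamma> i) f y))" for i
      by (rule bfun_ip_integrable) (use u f in auto)
    have "(\<integral>y. K N (x, y) * u y \<partial>M) = (\<integral>y. (\<Sum>i\<in>I N. koop M T (\<gamma> i) f x * (u y * cnj (koop M T (\<gamma> i) f y))) / of_nat (card (I N)) \<partial>M)"
      by (simp add: Kx sum_distrib_right sum_distrib_left mult_ac)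
    also have "\<dots> = (\<Sum>i\<in>I N. koop M T (\<gamma> i) f x * l2ip M u (koop M T (\<gamma> i) f)) / of_nat (card (I N))"
      unfolding l2ip_def using i by (simp add: Bochner_Integration.integral_sum)
    also have "\<dots> = S N u x" by (simp add: S_def avg_apply mult.commute)
    finally show ?thesis ..
  qed
  have Sdiff: "L.nrm (S N u - S M' u) \<le> P.L.nrm (K N - K M') * L.nrm u" if u: "u \<in> bfun M" for N M' u
  proof (rule kernel_operator_bound)
    show "S N u - S M' u \<in> bfun M" "u \<in> bfun M" using SV u by auto
    show "K N - K M' \<in> bfun (M \<Otimes>\<^sub>M M)" using KV by simp
    fix x assume x: "x \<in> space M"
    have KI: "integrable M (\<lambda>y. K N (x, y) * u y)" for N
    proof -
      obtain C where C: "C \<ge> 0" "\<forall>x. norm (K N x) \<le> C" using bfun_bound[OF KV] by blast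
      have "(\<lambda>y. K N (x, y)) \<in> bfun M"
      proof (rule bfunI[where C = C])
        show "(\<lambda>y. K N (x, y)) \<in> borel_measurable M" by (rule measurable_Pair2[OF bfun_measurable[OF KV] x])
      qed (use C bfun_off[OF KV] in \<open>auto simp: space_pair_measure\<close>)
      from bfun_integrable[OF bfun_mult[OF this u]] show ?thesis by (simp add: times_fun_def)
    qed
    show "(S N u - S M' u) x = (\<integral>y. (K N - K M') (x, y) * u y \<partial>M)"
      using KI by (simp add: S_int[OF u] left_diff_distrib)
  qed
  show ?thesis
    unfolding S_def[symmetric]
  proof (rule orbit_form.intro[OF L.unitary_action_axioms], unfold_locales)
    show "asymp_inv I \<gamma>" by (rule ai)
    show "f \<in> bfun M" by (rule f)
    show "S N u = L.avg (I N) (\<lambda>i. csc (l2ip M u (koop M T (\<gamma> i) f)) (koop M T (\<gamma> i) f))" for N u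
      by (simp add: S_def)
    fix e :: real assume e: "e > 0"
    obtain N0 where N0: "\<forall>N\<ge>N0. \<forall>M'\<ge>N0. P.L.nrm (K N - K M') \<le> e"
      using P.L.mean_ergodic_Cauchy[OF ai bfun_tens[OF f] e] unfolding K_def by blast
    have "L.nrm (S N u - S M' u) \<le> e * L.nrm u" if "N \<ge> N0" "M' \<ge> N0" "u \<in> bfun M" for N M' u
      using order_trans[OF Sdiff[OF that(3)] mult_right_mono[of "P.L.nrm (K N - K M')" e "L.nrm u"]] N0 that by auto
    then show "\<exists>N0. \<forall>N\<ge>N0. \<forall>M'\<ge>N0. \<forall>u\<in>bfun M. L.nrm (S N u - S M' u) \<le> e * L.nrm u" by blast
  next
    fix v :: "nat \<Rightarrow> 'a \<Rightarrow> complex" and k :: "nat \<Rightarrow> nat"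
    assume v: "\<And>n. v n \<in> bfun M" "\<And>n. L.nrm (v n) \<le> 1"
      and cau: "\<And>e. e > 0 \<Longrightarrow> \<exists>n0. \<forall>n\<ge>n0. \<forall>m\<ge>n0. L.nrm (S (k n) (v n) - S (k m) (v m)) \<le> e"
    obtain C where C: "C \<ge> 0" "\<And>x. norm (f x) \<le> C" using bfun_bound[OF f] by blast
    \<comment> \<open>A bound in sup norm although the \<open>v n\<close> are bounded only in norm:
      \<open>v n\<close> enters through inner products of size at most \<open>nrm f \<le> C\<close>,
      and the remaining factor is a translate of \<open>f\<close>. So
      \<open>complete_bounded\<close> applies.\<close>
    have "norm (S N (v n) y) \<le> C * C" for N n y
      unfolding S_def
    proof (rule avg_bound)
      fix i y assume "i \<in> I N"
      have "norm (l2ip M (v n) (koop M T (\<gamma> i) f)) \<le> L.nrm (v n) * L.nrm f"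
        using L.cauchy_schwarz[of "v n" "koop M T (\<gamma> i) f"] v f by simp
      also have "\<dots> \<le> 1 * C" by (intro mult_mono v nrm_le_bound[OF f]) (use f C in auto)
      finally show "norm (csc (l2ip M (v n) (koop M T (\<gamma> i) f)) (koop M T (\<gamma> i) f) y) \<le> C * C"
        using koop_bound[of f C "\<gamma> i" y] C by (simp add: norm_mult mult_mono)
    qed (use asymp_inv_finite[OF ai] in auto)
    then show "\<exists>w\<in>bfun M. (\<lambda>n. L.nrm (S (k n) (v n) - w)) \<longlonglongrightarrow> 0"
      using complete_bounded[of "\<lambda>n. S (k n) (v n)" "C * C"] SV cau by blast
  qed
qed

theorem weak_mixing_orthogonal_to_eigenfunctions:
  assumes ai: "asymp_inv I \<gamma>" and f: "f \<in> bfun M"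
    and orth: "\<And>e. e \<in> bfun M \<Longrightarrow> L.nrm e \<noteq> 0 \<Longrightarrow> (\<And>g. \<exists>c. L.nrm (koop M T g e - csc c e) = 0) \<Longrightarrow> l2ip M e f = 0"
  shows "(\<lambda>N. (\<Sum>i\<in>I N. \<Sum>j\<in>I N. (cmod (l2ip M (koop M T (\<gamma> i) f) (koop M T (\<gamma> j) f)))\<^sup>2) / (real (card (I N)))\<^sup>2) \<longlonglongrightarrow> 0"
  using orbit_form.common_eigenvector[OF orbit_form_bfun[OF ai f]] orth by blast

end

section \<open>Eigenfunctions and the Kronecker factor\<close>

text \<open>Fatou's lemma: if \<open>h x\<close> lies in the open set, so does \<open>hn n x\<close>
  for all large \<open>n\<close>.\<close>

lemma limit_preserving_open:
  fixes \<mu> :: "'y::topological_space measure"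
  assumes s: "sets \<mu> = sets borel" and h: "continuous_on UNIV h" and hn: "\<And>n. continuous_on UNIV (hn n)"
    and lim: "\<And>x. (\<lambda>n. hn n x) \<longlonglongrightarrow> h x" and pres: "\<And>n. distr \<mu> borel (hn n) = \<mu>" and O: "open O'"
  shows "emeasure \<mu> (h -` O') \<le> emeasure \<mu> O'"
proof -
  have sp: "space \<mu> = UNIV" using sets_eq_imp_space_eq[OF s] by simp
  have [measurable]: "h \<in> measurable \<mu> borel" "\<And>n. hn n \<in> measurable \<mu> borel"
    using h hn borel_measurable_continuous_onI measurable_cong_sets[OF s refl] by blast+
  have [measurable]: "O' \<in> sets borel" using O by simp
  have "h -` O' \<in> sets \<mu>" using open_vimage[OF O h] s by simp
  then have "emeasure \<mu> (h -` O') = (\<integral>\<^sup>+x. indicator (h -` O') x \<partial>\<mu>)" by simp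
  also have "\<dots> = (\<integral>\<^sup>+x. indicator O' (h x) \<partial>\<mu>)"
    by (rule nn_integral_cong) (simp add: indicator_def)
  finally have "emeasure \<mu> (h -` O') = (\<integral>\<^sup>+x. indicator O' (h x) \<partial>\<mu>)" .
  also have "\<dots> \<le> (\<integral>\<^sup>+x. liminf (\<lambda>n. indicator O' (hn n x)) \<partial>\<mu>)"
  proof (rule nn_integral_mono)
    fix x
    show "indicator O' (h x) \<le> liminf (\<lambda>n. (indicator O' (hn n x) :: ennreal))"
    proof (cases "h x \<in> O'")
      case True
      then have "\<forall>\<^sub>F n in sequentially. hn n x \<in> O'" using lim[of x] O topological_tendstoD by blast
      then have "\<forall>\<^sub>F n in sequentially. (1::ennreal) \<le> indicator O' (hn n x)" by eventually_elim simp
      then have "(1::ennreal) \<le> liminf (\<lambda>n. indicator O' (hn n x))" by (rule Liminf_bounded)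
      then show ?thesis using True by simp
    qed simp
  qed
  also have "\<dots> \<le> liminf (\<lambda>n. \<integral>\<^sup>+x. indicator O' (hn n x) \<partial>\<mu>)" by (rule nn_integral_liminf) measurable
  also have "(\<lambda>n. \<integral>\<^sup>+x. indicator O' (hn n x) \<partial>\<mu>) = (\<lambda>n. emeasure \<mu> O')"
  proof
    fix n
    have "(\<integral>\<^sup>+x. indicator O' (hn n x) \<partial>\<mu>) = (\<integral>\<^sup>+x. indicator O' x \<partial>distr \<mu> borel (hn n))"
      by (rule nn_integral_distr[symmetric]) measurable
    also have "\<dots> = emeasure \<mu> O'" unfolding pres using s by (simp add: nn_integral_indicator)
    finally show "(\<integral>\<^sup>+x. indicator O' (hn n x) \<partial>\<mu>) = emeasure \<mu> O'" .
  qed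
  finally show ?thesis by (simp add: Liminf_const)
qed

text \<open>Semicontinuity yields one inequality on open sets; the same inequality for the right
  inverse \<open>k\<close> yields the other. It extends invariance from a dense subgroup to its
  closure.\<close>

lemma limit_preserving:
  fixes \<mu> :: "'y::topological_space measure"
  assumes \<mu>: "finite_measure \<mu>" and s: "sets \<mu> = sets borel"
    and h: "continuous_on UNIV h" "\<And>n. continuous_on UNIV (hn n)" "\<And>x. (\<lambda>n. hn n x) \<longlonglongrightarrow> h x"
      "\<And>n. distr \<mu> borel (hn n) = \<mu>"
    and k: "continuous_on UNIV k" "\<And>n. continuous_on UNIV (kn n)" "\<And>x. (\<lambda>n. kn n x) \<longlonglongrightarrow> k x"
      "\<And>n. distr \<mu> borel (kn n) = \<mu>"
    and hk: "\<And>x. h (k x) = x"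
  shows "distr \<mu> borel h = \<mu>"
proof -
  interpret finite_measure \<mu> by (rule \<mu>)
  have sp: "space \<mu> = UNIV" using sets_eq_imp_space_eq[OF s] by simp
  have m: "h \<in> measurable \<mu> borel"
    using h(1) borel_measurable_continuous_onI measurable_cong_sets[OF s refl] by blast
  have eq: "emeasure (distr \<mu> borel h) O' = emeasure \<mu> O'" if O: "open O'" for O'
  proof -
    have "emeasure (distr \<mu> borel h) O' = emeasure \<mu> (h -` O')" using O by (simp add: emeasure_distr[OF m] sp)
    moreover have "emeasure \<mu> (h -` O') \<le> emeasure \<mu> O'" by (rule limit_preserving_open[OF s h O])
    moreover have "emeasure \<mu> (k -` (h -` O')) \<le> emeasure \<mu> (h -` O')"
      by (rule limit_preserving_open[OF s k open_vimage[OF O h(1)]])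
    moreover have "k -` (h -` O') = O'" using hk by auto
    ultimately show ?thesis by simp
  qed
  show ?thesis
  proof (rule measure_eqI_generator_eq[where E = "{S. open S}" and \<Omega> = UNIV and A = "\<lambda>_. UNIV"])
    show "Int_stable {S :: 'y set. open S}" by (auto simp: Int_stable_def)
    show "\<And>X. X \<in> {S. open S} \<Longrightarrow> emeasure (distr \<mu> borel h) X = emeasure \<mu> X" using eq by simp
    show "sets (distr \<mu> borel h) = sigma_sets UNIV {S. open S}" by (simp add: borel_def)
    show "sets \<mu> = sigma_sets UNIV {S. open S}" using s by (simp add: borel_def)
    show "emeasure (distr \<mu> borel h) UNIV \<noteq> \<infinity>" using eq[of UNIV] emeasure_finite[of UNIV] by simp
  qed auto
qed

lemma (in prob_space) AE_witness: "AE x in M. P x \<Longrightarrow> \<exists>x. P x"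
proof (rule ccontr)
  assume "AE x in M. P x" "\<nexists>x. P x"
  then have "AE x in M. False" by auto
  then show False by (simp add: AE_const)
qed

lemma continuous_on_cmult: "continuous_on UNIV (cmult k)"
  unfolding cmult_def
  by (intro continuous_on_coordinatewise_then_product continuous_intros continuous_on_product_coordinates)

lemma infdist_mult_unit:
  fixes K :: "complex set"
  assumes c: "norm c = 1" and m: "\<And>k. k \<in> K \<Longrightarrow> c * k \<in> K" "\<And>k. k \<in> K \<Longrightarrow> inverse c * k \<in> K" and ne: "K \<noteq> {}"
  shows "infdist (c * z) K = infdist z K"
proof -
  have le: "infdist (c * z) K \<le> infdist z K"
    if c: "norm c = 1" and m: "\<And>k. k \<in> K \<Longrightarrow> c * k \<in> K" for c z
  proof -
    have "infdist (c * z) K \<le> dist z k" if "k \<in> K" for k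
    proof -
      have "infdist (c * z) K \<le> dist (c * z) (c * k)" by (rule infdist_le[OF m[OF that]])
      also have "\<dots> = dist z k" using c by (simp add: dist_norm norm_mult flip: right_diff_distrib)
      finally show ?thesis .
    qed
    then have "infdist (c * z) K \<le> (INF k\<in>K. dist z k)" by (intro cINF_greatest ne)
    then show ?thesis using ne by (simp add: infdist_def)
  qed
  have "c \<noteq> 0" using c by auto
  then have "inverse c * (c * z) = z" by (simp add: mult.assoc[symmetric])
  moreover have "infdist (inverse c * (c * z)) K \<le> infdist (c * z) K"
    by (rule le) (use c m in \<open>auto simp: norm_inverse\<close>)
  ultimately have "infdist z K \<le> infdist (c * z) K" by (simp only:)
  then show ?thesis using le[OF c m(1), of z] by simp
qed

context mp_system
begin

text \<open>A unimodular eigenfunction takes values in a single coset of the closure of its eigenvalue group, because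
  the distance to any given coset is an invariant function.\<close>
lemma eigenfunction_coset:
  assumes erg: "ergodic_action M T"
    and w: "w \<in> borel_measurable M" "\<And>x. norm (w x) = 1" and eig: "\<And>g. AE x in M. w (T g x) = \<theta> g * w x"
    and \<theta>: "\<And>g. norm (\<theta> g) = 1" "\<And>g h. \<theta> (g + h) = \<theta> g * \<theta> h"
  shows "\<exists>c. norm c = 1 \<and> (AE x in M. w x * cnj c \<in> closure (range \<theta>))"
proof -
  let ?K = "closure (range \<theta>)"
  have \<theta>0: "\<theta> 0 = 1" using \<theta>(2)[of 0 0] \<theta>(1)[of 0] by auto
  have \<theta>m: "\<theta> (- g) = inverse (\<theta> g)" for g
    using \<theta>(2)[of g "- g"] \<theta>0 by (simp add: inverse_unique)
  have mul: "\<theta> g * k \<in> ?K" if "k \<in> ?K" for g k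
  proof -
    have "(\<lambda>z. \<theta> g * z) ` ?K \<subseteq> ?K"
    proof (rule image_closure_subset)
      show "(\<lambda>z. \<theta> g * z) ` range \<theta> \<subseteq> ?K" using \<theta>(2) closure_subset by (fastforce simp flip: \<theta>(2))
    qed (auto intro!: continuous_intros)
    then show ?thesis using that by blast
  qed
  have ne: "?K \<noteq> {}" by simp
  have inv: "infdist (\<theta> g * z) ?K = infdist z ?K" for g z
    by (rule infdist_mult_unit[OF \<theta>(1) mul _ ne]) (use mul[of _ "- g"] \<theta>m in auto)
  define D where "D = (\<lambda>z. \<integral>x. infdist (w x * cnj z) ?K \<partial>M)"
  have [measurable]: "w \<in> borel_measurable M" by (rule w)
  have cinf: "(\<lambda>x. infdist (w x * cnj z) ?K) \<in> borel_measurable M" for z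
  proof -
    have "(\<lambda>u. infdist (u * cnj z) ?K) \<in> borel_measurable borel"
      by (intro borel_measurable_continuous_onI continuous_intros)
    from measurable_compose[OF w(1) this] show ?thesis .
  qed
  have D: "AE x in M. infdist (w x * cnj z) ?K = D z" for z
    unfolding D_def
  proof (rule ergodic_invariant_real[OF erg])
    have b: "infdist (w x * cnj z) ?K \<le> norm z + 1" for x
    proof -
      have "1 \<in> ?K" using \<theta>0 closure_subset by (metis rangeI subsetD)
      then have "infdist (w x * cnj z) ?K \<le> dist (w x * cnj z) 1" by (rule infdist_le)
      also have "\<dots> \<le> norm (w x * cnj z) + 1" using norm_triangle_ineq4[of "w x * cnj z" 1] by (simp add: dist_norm)
      also have "\<dots> = norm z + 1" using w(2) by (simp add: norm_mult)
      finally show ?thesis .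
    qed
    show "integrable M (\<lambda>x. infdist (w x * cnj z) ?K)"
      by (rule integrable_const_bound[where B = "norm z + 1"]) (use b cinf in \<open>auto simp: infdist_nonneg\<close>)
    show "AE x in M. infdist (w (T g x) * cnj z) ?K = infdist (w x * cnj z) ?K" for g
      using eig[of g] by eventually_elim (simp add: inv mult.assoc)
  qed
  \<comment> \<open>Each \<open>z\<close> has its own exceptional null set, hence the restriction to
    a countable dense set; the Lipschitz bound in \<open>z\<close> recovers the point
    \<open>c\<close> later.\<close>
  obtain Q :: "complex set" where Q: "countable Q" "\<And>X. open X \<Longrightarrow> X \<noteq> {} \<Longrightarrow> \<exists>q\<in>Q. q \<in> X"
    using countable_dense_exists by blast
  have "AE x in M. \<forall>z\<in>Q. infdist (w x * cnj z) ?K = D z"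
    by (subst AE_ball_countable[OF Q(1)]) (use D in blast)
  note ae = this
  \<comment> \<open>One typical point selects the coset. Its distance to its own coset is zero, and
    any other typical point has the same distances to all cosets \<open>z\<close> in
    \<open>Q\<close>.\<close>
  obtain x0 where x0: "\<forall>z\<in>Q. infdist (w x0 * cnj z) ?K = D z" using AE_witness[OF ae] by blast
  define c where "c = w x0"
  have c: "norm c = 1" using w by (simp add: c_def)
  have lip: "infdist (w x * cnj z) ?K \<le> infdist (w x * cnj z') ?K + norm (z - z')" for x z z'
  proof -
    have "infdist (w x * cnj z) ?K \<le> infdist (w x * cnj z') ?K + dist (w x * cnj z) (w x * cnj z')"
      by (rule infdist_triangle)
    also have "dist (w x * cnj z) (w x * cnj z') = norm (z - z')"
      using w(2)[of x] by (simp add: dist_norm norm_mult flip: right_diff_distrib complex_cnj_diff)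
    finally show ?thesis .
  qed
  have c0: "infdist (w x0 * cnj c) ?K = 0"
  proof -
    have "w x0 * cnj c = 1" unfolding c_def using w(2)[of x0] by (simp flip: complex_norm_square)
    moreover have "1 \<in> ?K" using \<theta>0 closure_subset by (metis rangeI subsetD)
    ultimately show ?thesis by simp
  qed
  have "AE x in M. w x * cnj c \<in> ?K"
    using ae
  proof (rule AE_mp, intro AE_I2 impI)
    fix x assume x: "\<forall>z\<in>Q. infdist (w x * cnj z) ?K = D z"
    have "infdist (w x * cnj c) ?K \<le> 0 + e" if e: "e > 0" for e
    proof -
      obtain z where z: "z \<in> Q" "z \<in> ball c (e/2)" using Q(2)[of "ball c (e/2)"] e by auto
      have "norm (c - z) < e/2" using z by (simp add: dist_norm)
      then show ?thesis
        using lip[of x c z] lip[of x0 z c] x x0 z(1) c0 by (simp add: norm_minus_commute)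
    qed
    then have "infdist (w x * cnj c) ?K \<le> 0" by (rule field_le_epsilon)
    then have "infdist (w x * cnj c) ?K = 0" using infdist_nonneg[of "w x * cnj c" ?K] by linarith
    then show "w x * cnj c \<in> ?K" using in_closed_iff_infdist_zero[OF closed_closure ne] by blast
  qed
  then show ?thesis using c by blast
qed

text \<open>The circle sits in the product as the constant sequences. Invariance of the image
  measure under the eigenvalues \<open>\<theta> g\<close> comes from invariance of \<open>M\<close>
  under \<open>T g\<close>; invariance under their limits comes from
  \<open>limit_preserving\<close>.\<close>

lemma eigenfunction_factor:
  assumes v: "v \<in> borel_measurable M" and eig: "\<And>g. AE x in M. v (T g x) = \<theta> g * v x"
    and \<theta>: "\<And>g. norm (\<theta> g) = 1" "\<And>g h. \<theta> (g + h) = \<theta> g * \<theta> h"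
    and vK: "AE x in M. v x \<in> closure (range \<theta>)"
  shows "circle_rotation_factor M T ((\<lambda>k n. k) ` closure (range \<theta>)) (distr M borel (\<lambda>x n. v x)) (\<lambda>g n. \<theta> g) (\<lambda>x n. v x)"
proof -
  let ?Cl = "closure (range \<theta>)" and ?\<iota> = "\<lambda>k (n::nat). k :: complex"
  let ?K = "?\<iota> ` ?Cl"
  have \<theta>0: "\<theta> 0 = 1" using \<theta>(2)[of 0 0] \<theta>(1)[of 0] by auto
  have \<theta>m: "\<theta> (- g) = inverse (\<theta> g)" for g
    using \<theta>(2)[of g "- g"] \<theta>0 by (simp add: inverse_unique)
  have nK: "norm k = 1" if "k \<in> ?Cl" for k
  proof -
    have "?Cl \<subseteq> sphere 0 1" by (rule closure_minimal) (use \<theta>(1) in auto)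
    then show ?thesis using that by auto
  qed
  have cont: "continuous_on S ?\<iota>" for S
    by (intro continuous_on_coordinatewise_then_product continuous_intros)
  have "compact ?Cl"
    using nK by (intro compact_eq_bounded_closed[THEN iffD2]) (auto simp: bounded_iff intro!: exI[of _ 1])
  then have closedK: "closed ?K" by (intro compact_imp_closed compact_continuous_image cont)
  have seq: "\<exists>g. (\<lambda>n. \<theta> (g n)) \<longlonglongrightarrow> k" if k: "k \<in> ?Cl" for k
  proof -
    obtain s where s: "\<forall>n. s n \<in> range \<theta>" "s \<longlonglongrightarrow> k" using closure_sequential[THEN iffD1, OF k] by blast
    then have "\<forall>n. \<exists>g. s n = \<theta> g" by blast
    then obtain g where "\<And>n. s n = \<theta> (g n)" by metis
    then have "s = (\<lambda>n. \<theta> (g n))" by auto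
    then show ?thesis using s(2) by blast
  qed
  have mulK: "a * b \<in> ?Cl" if ab: "a \<in> ?Cl" "b \<in> ?Cl" for a b
  proof -
    obtain g h where "(\<lambda>n. \<theta> (g n)) \<longlonglongrightarrow> a" "(\<lambda>n. \<theta> (h n)) \<longlonglongrightarrow> b" using seq[OF ab(1)] seq[OF ab(2)] by blast
    then have "(\<lambda>n. \<theta> (g n) * \<theta> (h n)) \<longlonglongrightarrow> a * b" by (rule tendsto_mult)
    then have "(\<lambda>n. \<theta> (g n + h n)) \<longlonglongrightarrow> a * b" by (simp add: \<theta>(2))
    then show ?thesis unfolding closure_sequential by (intro exI[of _ "\<lambda>n. \<theta> (g n + h n)"]) auto
  qed
  have invK: "inverse a \<in> ?Cl" if a: "a \<in> ?Cl" for a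
  proof -
    obtain g where "(\<lambda>n. \<theta> (g n)) \<longlonglongrightarrow> a" using seq a by blast
    moreover have "a \<noteq> 0" using nK[OF a] by auto
    ultimately have "(\<lambda>n. inverse (\<theta> (g n))) \<longlonglongrightarrow> inverse a" by (rule tendsto_inverse)
    then have "(\<lambda>n. \<theta> (- g n)) \<longlonglongrightarrow> inverse a" by (simp add: \<theta>m)
    then show ?thesis unfolding closure_sequential by (intro exI[of _ "\<lambda>n. \<theta> (- g n)"]) auto
  qed
  have rK: "\<theta> g \<in> ?Cl" for g using closure_subset[of "range \<theta>"] by blast
  have sub: "closed_circle_subgroup ?K"
    unfolding closed_circle_subgroup_def circle_seq_def
  proof (intro conjI ballI)
    show "(\<lambda>n. 1) \<in> ?K" using rK[of 0] \<theta>0 by auto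
  qed (use nK closedK mulK invK in \<open>auto simp: cmult_def\<close>)
  have clos: "closure (range (\<lambda>g n. \<theta> g)) = ?K"
  proof
    show "closure (range (\<lambda>g n. \<theta> g)) \<subseteq> ?K" by (rule closure_minimal[OF _ closedK]) (use rK in auto)
    have "?\<iota> ` ?Cl \<subseteq> closure (range (\<lambda>g n. \<theta> g))"
      by (rule image_closure_subset[OF cont closed_closure]) (use closure_subset[of "range (\<lambda>g (n::nat). \<theta> g)"] in blast)
    then show "?K \<subseteq> closure (range (\<lambda>g n. \<theta> g))" .
  qed
  have \<pi>m: "(\<lambda>x. ?\<iota> (v x)) \<in> measurable M borel"
    by (rule measurable_compose[OF v borel_measurable_continuous_onI[OF cont]])
  let ?m = "distr M borel (\<lambda>x (n::nat). v x)"
  have pm: "prob_space ?m" by (rule prob_space_distr[OF \<pi>m])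
  have eig': "AE x in M. (\<lambda>n::nat. v (T g x)) = cmult (\<lambda>n::nat. v x) (\<lambda>n. \<theta> g)" for g
    using eig[of g] by eventually_elim (auto simp: cmult_def mult.commute)
  have pres: "distr ?m borel (cmult (\<lambda>n. \<theta> g)) = ?m" for g
  proof -
    have "distr ?m borel (cmult (\<lambda>n. \<theta> g)) = distr M borel (\<lambda>x. cmult (\<lambda>n. \<theta> g) (\<lambda>n::nat. v x))"
      by (subst distr_distr[OF borel_measurable_continuous_onI[OF continuous_on_cmult] \<pi>m]) (simp add: o_def)
    also have "\<dots> = distr M borel (\<lambda>x. (\<lambda>n::nat. v (T g x)))"
    proof (rule distr_cong_AE)
      show "AE x in M. cmult (\<lambda>n. \<theta> g) (\<lambda>n::nat. v x) = (\<lambda>n::nat. v (T g x))"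
        using eig[of g] by eventually_elim (auto simp: cmult_def)
      show "(\<lambda>x. cmult (\<lambda>n. \<theta> g) (\<lambda>n::nat. v x)) \<in> borel_measurable M"
        by (rule measurable_compose[OF \<pi>m borel_measurable_continuous_onI[OF continuous_on_cmult]])
      show "(\<lambda>x. (\<lambda>n::nat. v (T g x))) \<in> borel_measurable M" by (rule measurable_compose[OF T_measurable \<pi>m])
    qed auto
    also have "\<dots> = distr (distr M M (T g)) borel (\<lambda>x n. v x)"
      by (subst distr_distr[OF \<pi>m T_measurable]) (simp add: o_def)
    finally show ?thesis by (simp add: T_distr)
  qed
  have K1: "emeasure ?m ?K = 1"
  proof -
    have "emeasure ?m ?K = emeasure M ((\<lambda>x n. v x) -` ?K \<inter> space M)"
      using closedK by (intro emeasure_distr[OF \<pi>m]) auto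
    also have "\<dots> = 1"
    proof (rule emeasure_eq_1_AE)
      show "(\<lambda>x n. v x) -` ?K \<inter> space M \<in> sets M" using closedK by (intro measurable_sets[OF \<pi>m]) auto
      show "AE x in M. x \<in> (\<lambda>x n. v x) -` ?K \<inter> space M" using vK by (rule AE_mp) (auto intro!: AE_I2)
    qed
    finally show ?thesis .
  qed
  have haar: "haar_on_circle ?K ?m"
    unfolding haar_on_circle_def
  proof (intro conjI ballI)
    fix k A assume "k \<in> ?K" and A: "A \<in> sets (borel :: (nat \<Rightarrow> complex) measure)"
    then obtain k0 where k0: "k0 \<in> ?Cl" "k = ?\<iota> k0" by blast
    have k0n: "k0 \<noteq> 0" using nK[OF k0(1)] by auto
    let ?k' = "?\<iota> (inverse k0)"
    \<comment> \<open>Negated group elements have inverse eigenvalues, so one sequence approximates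
      multiplication by \<open>inverse k0\<close> and also its inverse map.\<close>
    obtain g where g: "(\<lambda>n. \<theta> (g n)) \<longlonglongrightarrow> inverse k0" using seq invK[OF k0(1)] by blast
    have g': "(\<lambda>n. \<theta> (- g n)) \<longlonglongrightarrow> k0"
      using tendsto_inverse[OF g] k0n by (simp add: \<theta>m)
    have tl: "(\<lambda>n. cmult (\<lambda>i. s n) x) \<longlonglongrightarrow> cmult (\<lambda>i. l) x" if "s \<longlonglongrightarrow> l" for s l x
    proof -
      have "continuous_on UNIV (\<lambda>z. cmult (\<lambda>i. z) x)"
        unfolding cmult_def by (intro continuous_on_coordinatewise_then_product continuous_intros)
      then show ?thesis by (rule continuous_on_tendsto_compose[OF _ that]) auto
    qed
    have "distr ?m borel (cmult ?k') = ?m"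
    proof (rule limit_preserving)
      show "finite_measure ?m" using pm prob_space_def by blast
      show "cmult ?k' (cmult k x) = x" for x using k0n k0(2) by (auto simp: cmult_def)
      show "(\<lambda>n. cmult (\<lambda>i. \<theta> (g n)) x) \<longlonglongrightarrow> cmult ?k' x" for x by (rule tl[OF g])
      show "(\<lambda>n. cmult (\<lambda>i. \<theta> (- g n)) x) \<longlonglongrightarrow> cmult k x" for x unfolding k0(2) by (rule tl[OF g'])
    qed (auto intro: pres continuous_on_cmult)
    then have "emeasure ?m A = emeasure (distr ?m borel (cmult ?k')) A" by simp
    also have "\<dots> = emeasure ?m (cmult ?k' -` A)"
      using A by (subst emeasure_distr) (auto intro!: borel_measurable_continuous_onI continuous_on_cmult)
    also have "cmult ?k' -` A = cmult k ` A"
    proof (intro set_eqI iffI)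
      fix x assume "x \<in> cmult ?k' -` A"
      moreover have "x = cmult k (cmult ?k' x)" using k0n k0(2) by (auto simp: cmult_def)
      ultimately show "x \<in> cmult k ` A" by blast
    next
      fix x assume "x \<in> cmult k ` A"
      then obtain a where "a \<in> A" "x = cmult k a" by blast
      moreover have "cmult ?k' (cmult k a) = a" using k0n k0(2) by (auto simp: cmult_def)
      ultimately show "x \<in> cmult ?k' -` A" by simp
    qed
    finally show "emeasure ?m (cmult k ` A) = emeasure ?m A" by simp
  qed (use pm K1 in auto)
  show ?thesis
    unfolding circle_rotation_factor_def
    using sub haar rK clos \<pi>m eig' by (auto simp: cmult_def \<theta>(2))
qed

text \<open>Normalised, the eigenfunction is the factor map \<open>v\<close> of a circle rotation,
  so by maximality each event \<open>v x \<in> B\<close> agrees modulo null sets with one coming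
  from \<open>\<pi>\<close>. Thus \<open>f\<close> integrates to zero over all these events, hence
  against every integrable function of \<open>v\<close>, in particular its conjugate.\<close>

lemma eigenfunction_orthogonal:
  assumes erg: "ergodic_action M T" and kron: "kronecker_factor M T m \<alpha> \<pi>"
    and f: "f \<in> bfun M" and f0: "\<And>A. A \<in> sets borel \<Longrightarrow> (LINT x:(\<pi> -` A \<inter> space M)|M. f x) = 0"
    and e: "e \<in> bfun M" "L.nrm e \<noteq> 0" and eig: "\<And>g. \<exists>c. L.nrm (koop M T g e - csc c e) = 0"
  shows "l2ip M e f = 0"
proof -
  obtain \<theta> where \<theta>e: "\<And>g. L.nrm (koop M T g e - csc (\<theta> g) e) = 0" using eig by metis
  have ee: "AE x in M. e (T g x) = \<theta> g * e x" for g
  proof -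
    have "AE x in M. (koop M T g e - csc (\<theta> g) e) x = 0"
      using nrm_zero_iff_AE[of "koop M T g e - csc (\<theta> g) e"] \<theta>e[of g] e by simp
    then show ?thesis by (rule AE_mp) (auto intro!: AE_I2 simp: koop_def)
  qed
  have n1: "norm (\<theta> g) = 1" for g
  proof -
    have "L.nrm (koop M T g e) \<le> L.nrm (koop M T g e - csc (\<theta> g) e) + L.nrm (csc (\<theta> g) e)"
      using L.nrm_triangle[of "koop M T g e - csc (\<theta> g) e" "csc (\<theta> g) e"] e by simp
    moreover have "L.nrm (csc (\<theta> g) e) \<le> L.nrm (csc (\<theta> g) e - koop M T g e) + L.nrm (koop M T g e)"
      using L.nrm_triangle[of "csc (\<theta> g) e - koop M T g e" "koop M T g e"] e by simp
    moreover have "L.nrm (csc (\<theta> g) e - koop M T g e) = 0" using \<theta>e[of g] L.nrm_minus_commute[of "koop M T g e" "csc (\<theta> g) e"] e by simp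
    ultimately have "L.nrm e = norm (\<theta> g) * L.nrm e" using \<theta>e[of g] e by (simp add: L.nrm_scale)
    then show ?thesis using e(2) by simp
  qed
  have [measurable]: "e \<in> borel_measurable M" "f \<in> borel_measurable M" using e f by (auto simp: bfun_def)
  define a where "a = (\<integral>x. norm (e x) \<partial>M)"
  have ea: "AE x in M. norm (e x) = a"
    unfolding a_def
  proof (rule ergodic_invariant_real[OF erg])
    show "integrable M (\<lambda>x. norm (e x))" using bfun_integrable[OF e(1)] by simp
    show "AE x in M. norm (e (T g x)) = norm (e x)" for g using ee[of g] by eventually_elim (simp add: norm_mult n1)
  qed
  have "a \<noteq> 0"
  proof
    assume "a = 0"
    then have "AE x in M. e x = 0" using ea by simp
    then show False using nrm_zero_iff_AE[OF e(1)] e(2) by simp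
  qed
  \<comment> \<open>The value 1 at zeros of \<open>e\<close> makes \<open>w\<close> unimodular at
    every point, as \<open>eigenfunction_coset\<close> demands; the zeros form a null set.\<close>
  define w where "w = (\<lambda>x. if e x = 0 then 1 else sgn (e x))"
  have w1: "norm (w x) = 1" for x by (simp add: w_def norm_sgn)
  have wm: "w \<in> borel_measurable M" unfolding w_def sgn_div_norm by measurable
  have ew: "AE x in M. e x = of_real a * w x"
    using ea by eventually_elim (use \<open>a \<noteq> 0\<close> in \<open>auto simp: w_def sgn_div_norm scaleR_conv_of_real field_simps\<close>)
  have weig: "AE x in M. w (T g x) = \<theta> g * w x" for g
    using ee[of g] ew AE_T[OF ew, of g] by eventually_elim (use \<open>a \<noteq> 0\<close> in auto)
  \<comment> \<open>Both sides are constants, so one point where all three eigenvalue equations hold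
    suffices.\<close>
  have hom: "\<theta> (g + h) = \<theta> g * \<theta> h" for g h
  proof -
    have "AE x in M. \<theta> (g + h) = \<theta> g * \<theta> h"
      using weig[of "g + h"] weig[of h] AE_T[OF weig[of g], of h] AE_space
    proof eventually_elim
      case (elim x)
      have "w x \<noteq> 0" using w1[of x] by auto
      then show ?case using elim by (simp add: T_plus)
    qed
    then show ?thesis by (simp add: AE_const)
  qed
  obtain c where c: "norm c = 1" "AE x in M. w x * cnj c \<in> closure (range \<theta>)"
    using eigenfunction_coset[OF erg wm w1 weig n1 hom] by blast
  \<comment> \<open>Rotation by \<open>cnj c\<close> moves the values from a coset into the closed
    subgroup itself.\<close>
  define v where "v = (\<lambda>x. w x * cnj c)"
  have vm [measurable]: "v \<in> borel_measurable M" unfolding v_def using wm by measurable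
  have "AE x in M. v (T g x) = \<theta> g * v x" for g using weig[of g] by eventually_elim (simp add: v_def)
  have vK: "AE x in M. v x \<in> closure (range \<theta>)" using c(2) by (simp add: v_def)
  from eigenfunction_factor[OF vm \<open>\<And>g. AE x in M. v (T g x) = \<theta> g * v x\<close> n1 hom vK]
  have fac: "circle_rotation_factor M T ((\<lambda>k n. k) ` closure (range \<theta>)) (distr M borel (\<lambda>x n. v x)) (\<lambda>g n. \<theta> g) (\<lambda>x n. v x)" .
  have ind: "(\<integral>x. indicator B (v x) *\<^sub>R f x \<partial>M) = 0" if B: "B \<in> sets borel" for B
  proof -
    \<comment> \<open>The factor map takes values in sequences, so \<open>B\<close> is pulled back
      along coordinate 0.\<close>
    let ?B = "{s :: nat \<Rightarrow> complex. s 0 \<in> B}"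
    have "(\<lambda>s :: nat \<Rightarrow> complex. s 0) \<in> borel_measurable borel"
      by (intro borel_measurable_continuous_onI continuous_on_product_coordinates)
    from measurable_sets[OF this B] have "?B \<in> sets borel" by (simp add: vimage_def)
    then obtain A where A: "A \<in> sets borel"
      "emeasure M (((\<lambda>x n. v x) -` ?B \<inter> space M) - (\<pi> -` A \<inter> space M)) = 0"
      "emeasure M ((\<pi> -` A \<inter> space M) - ((\<lambda>x n. v x) -` ?B \<inter> space M)) = 0"
      using kron fac unfolding kronecker_factor_def by metis
    have [measurable]: "\<pi> \<in> measurable M borel" using kron by (simp add: kronecker_factor_def rotation_factor_def)
    have pA: "\<pi> -` A \<inter> space M \<in> sets M" using A(1) by measurable
    have "v -` B \<inter> space M \<in> sets M" using B by measurable
    then have vB: "(\<lambda>x (n::nat). v x) -` ?B \<inter> space M \<in> sets M" by (simp add: vimage_def)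
    have "AE x in M. x \<notin> ((\<lambda>x n. v x) -` ?B \<inter> space M) - (\<pi> -` A \<inter> space M)"
      by (rule AE_not_in) (use A(2) pA vB in \<open>auto simp: null_sets_def\<close>)
    moreover have "AE x in M. x \<notin> (\<pi> -` A \<inter> space M) - ((\<lambda>x n. v x) -` ?B \<inter> space M)"
      by (rule AE_not_in) (use A(3) pA vB in \<open>auto simp: null_sets_def\<close>)
    ultimately have ae: "AE x in M. indicator B (v x) *\<^sub>R f x = indicator (\<pi> -` A \<inter> space M) x *\<^sub>R f x"
      using AE_space by eventually_elim (auto simp: indicator_def)
    have "(\<integral>x. indicator B (v x) *\<^sub>R f x \<partial>M) = (\<integral>x. indicator (\<pi> -` A \<inter> space M) x *\<^sub>R f x \<partial>M)"
      by (rule integral_cong_AE[OF _ _ ae]) (use B pA in measurable)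
    also have "\<dots> = 0" using f0[OF A(1)] by (simp add: set_lebesgue_integral_def)
    finally show ?thesis .
  qed
  obtain C where C: "0 \<le> C" "\<forall>x. norm (f x) \<le> C" using bfun_bound[OF f] by blast
  \<comment> \<open>Induction over integrable functions on the image measure of \<open>v\<close>;
    boundedness of \<open>f\<close> gives the integrable majorants.\<close>
  have all: "(\<integral>x. f x * h (v x) \<partial>M) = 0" if h: "integrable (distr M borel v) h" for h
    using h
  proof (induction rule: integrable_induct)
    case (base A c)
    have "(\<integral>x. f x * (indicator A (v x) *\<^sub>R c) \<partial>M) = (\<integral>x. (indicator A (v x) *\<^sub>R f x) * c \<partial>M)"
      by (rule Bochner_Integration.integral_cong) (auto simp: scaleR_conv_of_real mult_ac)
    also have "\<dots> = (\<integral>x. indicator A (v x) *\<^sub>R f x \<partial>M) * c" by (rule integral_mult_left_zero)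
    also have "\<dots> = 0" using ind[of A] base by simp
    finally show ?case .
  next
    case (add p q)
    have "integrable M (\<lambda>x. f x * r (v x))" if r: "integrable (distr M borel v) r" for r
    proof (rule Bochner_Integration.integrable_bound)
      have "integrable M (\<lambda>x. r (v x))" using integrable_distr[OF vm r] .
      then show "integrable M (\<lambda>x. C * norm (r (v x)))" by simp
      show "(\<lambda>x. f x * r (v x)) \<in> borel_measurable M"
        using borel_measurable_integrable[OF \<open>integrable M (\<lambda>x. r (v x))\<close>] by measurable
      show "AE x in M. norm (f x * r (v x)) \<le> norm (C * norm (r (v x)))"
        using C by (intro AE_I2) (simp add: norm_mult mult_right_mono)
    qed
    then show ?case using add by (simp add: ring_distribs)
  next
    case (lim p s)
    have lim1: "(\<lambda>i. \<integral>x. f x * s i (v x) \<partial>M) \<longlonglongrightarrow> (\<integral>x. f x * p (v x) \<partial>M)"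
    proof (rule integral_dominated_convergence[where w = "\<lambda>x. C * (2 * norm (p (v x)))"])
      have ip: "integrable M (\<lambda>x. p (v x))" using integrable_distr[OF vm lim.hyps(4)] .
      have isi: "integrable M (\<lambda>x. s i (v x))" for i using integrable_distr[OF vm lim.hyps(1)] .
      show "(\<lambda>x. f x * p (v x)) \<in> borel_measurable M" using borel_measurable_integrable[OF ip] by measurable
      show "(\<lambda>x. f x * s i (v x)) \<in> borel_measurable M" for i using borel_measurable_integrable[OF isi] by measurable
      show "integrable M (\<lambda>x. C * (2 * norm (p (v x))))" using ip by simp
      show "AE x in M. (\<lambda>i. f x * s i (v x)) \<longlonglongrightarrow> f x * p (v x)"
        by (intro AE_I2 tendsto_intros lim.hyps(2)) simp
      show "AE x in M. norm (f x * s i (v x)) \<le> C * (2 * norm (p (v x)))" for i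
        using C lim.hyps(3) by (intro AE_I2) (auto simp: norm_mult intro!: mult_mono)
    qed
    then show ?case using lim.IH by (simp add: LIMSEQ_const_iff)
  qed
  have "(\<integral>x. f x * cnj (v x) \<partial>M) = 0"
  proof (rule all)
    have "(\<lambda>z. cnj z) \<in> borel_measurable borel" by (intro borel_measurable_continuous_onI continuous_intros)
    then have cm: "cnj \<in> borel_measurable (distr M borel v)" by simp
    interpret d: prob_space "distr M borel v" by (rule prob_space_distr[OF vm])
    have "AE z in distr M borel v. norm (cnj z) \<le> 1"
      by (subst AE_distr_iff[OF vm]) (use w1 c in \<open>auto simp: v_def norm_mult\<close>)
    then show "integrable (distr M borel v) cnj" by (rule d.integrable_const_bound[OF _ cm])
  qed
  moreover have "l2ip M f e = (\<integral>x. (of_real a * cnj c) * (f x * cnj (v x)) \<partial>M)"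
    unfolding l2ip_def
  proof (rule integral_cong_AE)
    have cc: "c * cnj c = 1" using c(1) by (simp flip: complex_norm_square)
    show "AE x in M. f x * cnj (e x) = (of_real a * cnj c) * (f x * cnj (v x))"
      using ew
    proof eventually_elim
      case (elim x)
      have "(of_real a * cnj c) * (f x * cnj (v x)) = of_real a * f x * cnj (w x) * (c * cnj c)" by (simp add: v_def mult_ac)
      then show ?case using elim cc by auto
    qed
    show "(\<lambda>x. f x * cnj (e x)) \<in> borel_measurable M" using bfun_ip_integrable[OF f e(1)] by simp
    have "(\<lambda>x. cnj (v x)) \<in> borel_measurable M"
      by (rule measurable_compose[OF vm borel_measurable_continuous_onI]) (intro continuous_intros)
    then show "(\<lambda>x. (of_real a * cnj c) * (f x * cnj (v x))) \<in> borel_measurable M" by measurable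
  qed
  ultimately have "l2ip M f e = 0" by simp
  then show ?thesis using L.ip_herm[OF f e(1)] by simp
qed

end

section \<open>The van der Corput argument for finite index homomorphisms\<close>

text \<open>The two sums cancel on the intersection of the set with its translate, leaving at most
  the cardinality of their symmetric difference.\<close>

lemma folner_asymp_inv: assumes F: "folner F" shows "asymp_inv F (\<lambda>g. g)"
proof -
  have fin: "finite (F N)" "F N \<noteq> {}" for N using F by (auto simp: folner_def)
  have "\<exists>\<epsilon>. \<epsilon> \<longlonglongrightarrow> 0 \<and> (\<forall>N b. (\<forall>x. norm (b x :: complex) \<le> 1) \<longrightarrow>
       norm (\<Sum>i\<in>F N. b i - b (i + h)) \<le> \<epsilon> N * real (card (F N)))" for h
  proof (intro exI conjI allI impI)
    let ?D = "\<lambda>N. ((\<lambda>x. x + h) ` F N - F N) \<union> (F N - (\<lambda>x. x + h) ` F N)"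
    show "(\<lambda>N. real (card (?D N)) / real (card (F N))) \<longlonglongrightarrow> 0" using F by (simp add: folner_def)
    fix N and b :: "'a \<Rightarrow> complex" assume b: "\<forall>x. norm (b x) \<le> 1"
    let ?A = "F N" and ?B = "(\<lambda>x. x + h) ` F N"
    have fB: "finite ?B" using fin by simp
    have "(\<Sum>i\<in>F N. b (i + h)) = sum b ?B" by (subst sum.reindex) (auto simp: inj_on_def)
    then have "(\<Sum>i\<in>F N. b i - b (i + h)) = sum b ?A - sum b ?B" by (simp add: sum_subtractf)
    also have "sum b ?A = sum b (?A - ?B) + sum b (?A \<inter> ?B)"
      using sum.union_disjoint[of "?A - ?B" "?A \<inter> ?B" b] fin by (simp add: Un_Diff_Int Diff_Int_distrib inf_commute) (metis Int_Diff_disjoint Un_Diff_Int finite_Diff finite_Int inf_commute)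
    also have "sum b ?B = sum b (?B - ?A) + sum b (?A \<inter> ?B)"
      using sum.Int_Diff[of ?B b ?A] fB by (simp add: add.commute inf_commute)
    finally have "(\<Sum>i\<in>F N. b i - b (i + h)) = sum b (?A - ?B) - sum b (?B - ?A)" by simp
    then have "norm (\<Sum>i\<in>F N. b i - b (i + h)) \<le> norm (sum b (?A - ?B)) + norm (sum b (?B - ?A))"
      by (simp add: norm_triangle_ineq4)
    also have "\<dots> \<le> real (card (?A - ?B)) * 1 + real (card (?B - ?A)) * 1"
      by (intro add_mono order_trans[OF norm_sum] sum_bounded_above) (use b in auto)
    also have "\<dots> = real (card (?D N))"
      using fin fB by (subst card_Un_disjoint) auto
    finally show "norm (\<Sum>i\<in>F N. b i - b (i + h)) \<le> real (card (?D N)) / real (card (F N)) * real (card (F N))"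
      using fin[of N] by simp
  qed
  then show ?thesis unfolding asymp_inv_def using fin by blast
qed

section \<open>Homomorphisms with image of finite index, and transversals\<close>

lemma additive_hom_simps:
  assumes "additive_hom \<phi>"
  shows "\<phi> (g + h) = \<phi> g + \<phi> h" "\<phi> 0 = 0" "\<phi> (- g) = - \<phi> g"
proof -
  show a: "\<phi> (g + h) = \<phi> g + \<phi> h" for g h using assms by (simp add: additive_hom_def)
  show z: "\<phi> 0 = 0" using a[of 0 0] by simp
  show "\<phi> (- g) = - \<phi> g" using a[of g "- g"] z by (simp add: eq_neg_iff_add_eq_0 add.commute)
qed

lemma finite_index_transversal:
  fixes \<phi> :: "'g::ab_group_add \<Rightarrow> 'g"
  assumes hom: "additive_hom \<phi>" and fi: "finite_index (range \<phi>)"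
  obtains R where "finite R" "0 \<in> R" "\<And>x. \<exists>r\<in>R. \<exists>t. x = \<phi> t + r"
    "\<And>r r' t. r \<in> R \<Longrightarrow> r' \<in> R \<Longrightarrow> r = \<phi> t + r' \<Longrightarrow> r = r'"
proof -
  define c where "c = (\<lambda>g. (\<lambda>h. g + h) ` range \<phi>)"
  have c_eq: "c x = c y" if "x = \<phi> t + y" for x y t
  proof (intro set_eqI iffI)
    fix z assume "z \<in> c x"
    then obtain s where "z = x + \<phi> s" by (auto simp: c_def)
    then have "z = y + \<phi> (t + s)" using that by (simp add: additive_hom_simps[OF hom] algebra_simps)
    then show "z \<in> c y" by (auto simp: c_def)
  next
    fix z assume "z \<in> c y"
    then obtain s where "z = y + \<phi> s" by (auto simp: c_def)
    then have "z = x + \<phi> (s + (- t))" using that unfolding additive_hom_simps[OF hom] by (simp add: algebra_simps)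
    then show "z \<in> c x" by (auto simp: c_def)
  qed
  have c_D: "\<exists>t. x = \<phi> t + y" if "c x = c y" for x y
  proof -
    have "x + \<phi> 0 \<in> c x" by (auto simp: c_def)
    then have "x \<in> c y" using that by (simp add: additive_hom_simps[OF hom])
    then show ?thesis by (auto simp: c_def add.commute)
  qed
  \<comment> \<open>The trivial coset must be represented by 0: the original family is recovered
    later as the slice \<open>r = 0\<close>.\<close>
  define rep where "rep = (\<lambda>C. if C = c 0 then 0 else SOME g. c g = C)"
  have rep: "c (rep (c x)) = c x" for x
  proof -
    have "c (SOME g. c g = c x) = c x" by (rule someI[of "\<lambda>g. c g = c x" x]) (rule refl)
    then show ?thesis by (simp add: rep_def)
  qed
  show thesis
  proof (rule that[of "rep ` range c"])
    show "finite (rep ` range c)" using fi by (simp add: finite_index_def c_def)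
    have "rep (c 0) = 0" by (simp add: rep_def)
    then show "0 \<in> rep ` range c" by (metis rangeI imageI)
    show "\<exists>r\<in>rep ` range c. \<exists>t. x = \<phi> t + r" for x using c_D[of x "rep (c x)"] rep[of x] by auto
    fix r r' t assume "r \<in> rep ` range c" "r' \<in> rep ` range c" and e: "r = \<phi> t + r'"
    then obtain x y where xy: "r = rep (c x)" "r' = rep (c y)" by auto
    then have "c x = c y" using rep c_eq[OF e] by metis
    then show "r = r'" using xy by simp
  qed
qed

text \<open>Adding \<open>h\<close> permutes the cosets:
  \<open>r + h = \<phi> (t r) + \<sigma> r\<close> with \<open>\<sigma>\<close> a permutation of
  \<open>R\<close>. After reindexing by \<open>\<sigma>\<close>, a translation by \<open>h\<close>
  is a translation by \<open>t r\<close> in the first coordinate, where \<open>F\<close> is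
  asymptotically invariant.\<close>

lemma asymp_inv_transversal:
  fixes \<phi> :: "'g::ab_group_add \<Rightarrow> 'g"
  assumes F: "asymp_inv F (\<lambda>g. g)" and hom: "additive_hom \<phi>" and R: "finite R" "0 \<in> R"
    and cov: "\<And>x. \<exists>r\<in>R. \<exists>t. x = \<phi> t + r"
    and uniq: "\<And>r r' t. r \<in> R \<Longrightarrow> r' \<in> R \<Longrightarrow> r = \<phi> t + r' \<Longrightarrow> r = r'"
  shows "asymp_inv (\<lambda>N. F N \<times> R) (\<lambda>(g, r). \<phi> g + r)"
proof -
  have fin: "finite (F N)" "F N \<noteq> {}" "card (F N) > 0" for N using asymp_inv_finite[OF F] by auto
  have cR: "card R > 0" using R by (auto simp: card_gt_0_iff)
  have "\<exists>\<epsilon>. \<epsilon> \<longlonglongrightarrow> 0 \<and> (\<forall>N b. (\<forall>x. norm (b x :: complex) \<le> 1) \<longrightarrow>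
       norm (\<Sum>i\<in>F N \<times> R. b ((\<lambda>(g, r). \<phi> g + r) i) - b ((\<lambda>(g, r). \<phi> g + r) i + h)) \<le> \<epsilon> N * real (card (F N \<times> R)))" for h
  proof -
    have "\<exists>r'\<in>R. \<exists>t. r + h = \<phi> t + r'" for r using cov by blast
    then obtain \<sigma> t where \<sigma>: "\<And>r. \<sigma> r \<in> R" and t: "\<And>r. r + h = \<phi> (t r) + \<sigma> r" by metis
    have inj: "inj_on \<sigma> R"
    proof (rule inj_onI)
      fix r r' assume r: "r \<in> R" "r' \<in> R" "\<sigma> r = \<sigma> r'"
      have "r + h - (r' + h) = \<phi> (t r) + \<sigma> r - (\<phi> (t r') + \<sigma> r')" by (simp only: t)
      then have "r - r' = \<phi> (t r) - \<phi> (t r')" using r(3) by simp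
      then have "r = (\<phi> (t r) - \<phi> (t r')) + r'" by (simp add: algebra_simps)
      also have "\<phi> (t r) - \<phi> (t r') = \<phi> (t r + (- t r'))" unfolding additive_hom_simps[OF hom] by simp
      finally have "r = \<phi> (t r + (- t r')) + r'" .
      then show "r = r'" by (rule uniq[OF r(1,2)])
    qed
    then have bij: "bij_betw \<sigma> R R" using \<sigma> R(1) by (simp add: bij_betw_def endo_inj_surj image_subset_iff)
    have "\<exists>\<epsilon>. \<epsilon> \<longlonglongrightarrow> 0 \<and> (\<forall>N b. (\<forall>x. norm (b x :: complex) \<le> 1) \<longrightarrow>
       norm (\<Sum>i\<in>F N. b i - b (i + k)) \<le> \<epsilon> N * real (card (F N)))" for k
      using F by (simp add: asymp_inv_def)
    then obtain \<epsilon> where e: "\<And>k. \<epsilon> k \<longlonglongrightarrow> 0" "\<And>k N b. (\<forall>x. norm (b x :: complex) \<le> 1) \<Longrightarrow>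
       norm (\<Sum>i\<in>F N. b i - b (i + k)) \<le> \<epsilon> k N * real (card (F N))" by metis
    define \<delta> where "\<delta> = (\<lambda>N. (\<Sum>r\<in>R. \<epsilon> (t r) N) / real (card R))"
    have "\<delta> \<longlonglongrightarrow> (\<Sum>r\<in>R. 0) / real (card R)" unfolding \<delta>_def by (intro tendsto_intros e) (use cR in auto)
    then have "\<delta> \<longlonglongrightarrow> 0" by simp
    moreover have "norm (\<Sum>i\<in>F N \<times> R. b ((\<lambda>(g, r). \<phi> g + r) i) - b ((\<lambda>(g, r). \<phi> g + r) i + h)) \<le> \<delta> N * real (card (F N \<times> R))"
      if b: "\<forall>x. norm (b x :: complex) \<le> 1" for N b
    proof -
      have "(\<Sum>i\<in>F N \<times> R. b ((\<lambda>(g, r). \<phi> g + r) i) - b ((\<lambda>(g, r). \<phi> g + r) i + h))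
          = (\<Sum>r\<in>R. \<Sum>g\<in>F N. b (\<phi> g + r)) - (\<Sum>r\<in>R. \<Sum>g\<in>F N. b (\<phi> g + r + h))"
      proof -
        have "(\<Sum>i\<in>F N \<times> R. c i) = (\<Sum>r\<in>R. \<Sum>g\<in>F N. c (g, r))" for c :: "_ \<Rightarrow> complex"
          by (subst sum.swap) (simp add: sum.cartesian_product)
        then show ?thesis unfolding sum_subtractf by simp
      qed
      also have "(\<Sum>r\<in>R. \<Sum>g\<in>F N. b (\<phi> g + r)) = (\<Sum>r\<in>R. \<Sum>g\<in>F N. b (\<phi> g + \<sigma> r))"
        by (rule sum.reindex_bij_betw[OF bij, symmetric])
      also have "(\<Sum>r\<in>R. \<Sum>g\<in>F N. b (\<phi> g + r + h)) = (\<Sum>r\<in>R. \<Sum>g\<in>F N. b (\<phi> (g + t r) + \<sigma> r))"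
      proof -
        have "\<phi> g + r + h = \<phi> (g + t r) + \<sigma> r" for g r
          using t[of r] by (simp add: additive_hom_simps[OF hom] add.assoc)
        then show ?thesis by simp
      qed
      finally have "(\<Sum>i\<in>F N \<times> R. b ((\<lambda>(g, r). \<phi> g + r) i) - b ((\<lambda>(g, r). \<phi> g + r) i + h))
          = (\<Sum>r\<in>R. \<Sum>g\<in>F N. b (\<phi> g + \<sigma> r) - b (\<phi> (g + t r) + \<sigma> r))"
        by (simp add: sum_subtractf)
      also have "norm \<dots> \<le> (\<Sum>r\<in>R. \<epsilon> (t r) N * real (card (F N)))"
        by (rule order_trans[OF norm_sum sum_mono])
          (rule e(2)[of "\<lambda>x. b (\<phi> x + \<sigma> _)"], use b in auto)
      also have "\<dots> = \<delta> N * real (card (F N \<times> R))"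
        using cR by (simp add: \<delta>_def card_cartesian_product flip: sum_distrib_right)
      finally show ?thesis .
    qed
    ultimately show ?thesis by blast
  qed
  then show ?thesis unfolding asymp_inv_def using fin R by blast
qed

lemma sum_slice_le:
  fixes a :: "'a \<times> 'b::zero \<Rightarrow> real"
  assumes "finite A" "finite R" "0 \<in> R" "\<And>i. 0 \<le> a i"
  shows "(\<Sum>g\<in>A. a (g, 0)) \<le> (\<Sum>i\<in>A \<times> R. a i)"
proof -
  have "(\<Sum>g\<in>A. a (g, 0)) = sum a ((\<lambda>g. (g, 0)) ` A)" by (subst sum.reindex) (auto simp: inj_on_def)
  also have "\<dots> \<le> (\<Sum>i\<in>A \<times> R. a i)" by (rule sum_mono2) (use assms in auto)
  finally show ?thesis .
qed

context mp_system
begin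

definition corr :: "'g set \<Rightarrow> ('g \<Rightarrow> 'g) \<Rightarrow> ('a \<Rightarrow> complex) \<Rightarrow> real" where
  "corr E \<phi> f = (\<Sum>g\<in>E. \<Sum>h\<in>E. (cmod (l2ip M (koop M T (\<phi> g) f) (koop M T (\<phi> h) f)))\<^sup>2) / (real (card E))\<^sup>2"

text \<open>Weak mixing is applied to the family over \<open>F N \<times> R\<close>. All terms are
  nonnegative, so keeping only both representatives 0 costs the factor
  \<open>(real (card R))\<^sup>2\<close> from the normalisation.\<close>

lemma corr_null:
  assumes F: "folner F" and hom: "additive_hom \<phi>" and fi: "finite_index (range \<phi>)" and f: "f \<in> bfun M"
    and orth: "\<And>e. e \<in> bfun M \<Longrightarrow> L.nrm e \<noteq> 0 \<Longrightarrow> (\<And>g. \<exists>c. L.nrm (koop M T g e - csc c e) = 0) \<Longrightarrow> l2ip M e f = 0"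
  shows "(\<lambda>N. corr (F N) \<phi> f) \<longlonglongrightarrow> 0"
proof -
  obtain R where R: "finite R" "0 \<in> R" "\<And>x. \<exists>r\<in>R. \<exists>t. x = \<phi> t + r"
    "\<And>r r' t. r \<in> R \<Longrightarrow> r' \<in> R \<Longrightarrow> r = \<phi> t + r' \<Longrightarrow> r = r'"
    by (rule finite_index_transversal[OF hom fi]) blast
  have ai: "asymp_inv (\<lambda>N. F N \<times> R) (\<lambda>(g, r). \<phi> g + r)"
    by (rule asymp_inv_transversal[OF folner_asymp_inv[OF F] hom R(1,2,3)]) (rule R(4))
  have fin: "finite (F N)" "F N \<noteq> {}" for N using F by (auto simp: folner_def)
  define a where "a = (\<lambda>i j. (cmod (l2ip M (koop M T ((\<lambda>(g, r). \<phi> g + r) i) f) (koop M T ((\<lambda>(g, r). \<phi> g + r) j) f)))\<^sup>2)"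
  have lim: "(\<lambda>N. (\<Sum>i\<in>F N \<times> R. \<Sum>j\<in>F N \<times> R. a i j) / (real (card (F N \<times> R)))\<^sup>2) \<longlonglongrightarrow> 0"
    unfolding a_def by (rule weak_mixing_orthogonal_to_eigenfunctions[OF ai f]) (rule orth)
  have "(\<lambda>N. (real (card R))\<^sup>2 * ((\<Sum>i\<in>F N \<times> R. \<Sum>j\<in>F N \<times> R. a i j) / (real (card (F N \<times> R)))\<^sup>2)) \<longlonglongrightarrow> (real (card R))\<^sup>2 * 0"
    by (intro tendsto_intros lim)
  then have lim2: "(\<lambda>N. (real (card R))\<^sup>2 * ((\<Sum>i\<in>F N \<times> R. \<Sum>j\<in>F N \<times> R. a i j) / (real (card (F N \<times> R)))\<^sup>2)) \<longlonglongrightarrow> 0" by simp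
  show ?thesis
  proof (rule null_squeeze[OF lim2])
    fix N
    have cR: "card R > 0" using R by (auto simp: card_gt_0_iff)
    have a0: "0 \<le> a i j" for i j by (simp add: a_def)
    have "(\<Sum>g\<in>F N. \<Sum>h\<in>F N. a (g, 0) (h, 0)) \<le> (\<Sum>g\<in>F N. \<Sum>j\<in>F N \<times> R. a (g, 0) j)"
      by (intro sum_mono sum_slice_le fin R a0)
    also have "\<dots> \<le> (\<Sum>i\<in>F N \<times> R. \<Sum>j\<in>F N \<times> R. a i j)"
      by (rule sum_slice_le[of _ _ "\<lambda>i. \<Sum>j\<in>F N \<times> R. a i j"]) (use fin R a0 in \<open>auto intro!: sum_nonneg\<close>)
    finally have "corr (F N) \<phi> f \<le> (\<Sum>i\<in>F N \<times> R. \<Sum>j\<in>F N \<times> R. a i j) / (real (card (F N)))\<^sup>2"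
      unfolding corr_def by (intro divide_right_mono) (auto simp: a_def)
    also have "\<dots> = (real (card R))\<^sup>2 * ((\<Sum>i\<in>F N \<times> R. \<Sum>j\<in>F N \<times> R. a i j) / (real (card (F N \<times> R)))\<^sup>2)"
      using cR by (simp add: card_cartesian_product power_mult_distrib)
    finally show "corr (F N) \<phi> f \<le> (real (card R))\<^sup>2 * ((\<Sum>i\<in>F N \<times> R. \<Sum>j\<in>F N \<times> R. a i j) / (real (card (F N \<times> R)))\<^sup>2)" .
  qed (simp add: corr_def sum_nonneg)
qed

lemma koop_mult: "koop M T g (a * b) = koop M T g a * koop M T g b"
  by (auto simp: koop_def)

text \<open>Collects on the left the factors \<open>q\<close>, \<open>q'\<close> that move with the
  averaging variable and on the right those that stay fixed, which is the shape the ergodic theorem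
  needs.\<close>

lemma ip_mult_swap: "l2ip M (p * q) (p' * q') = l2ip M (q * (\<lambda>x. cnj (q' x))) ((\<lambda>x. cnj (p x)) * p')"
  unfolding l2ip_def by (rule Bochner_Integration.integral_cong) (auto simp: mult_ac)

text \<open>The left side is a sum of nonnegative quantities \<open>B (\<psi> g - \<phi> g)\<close>, where \<open>B k\<close> is a squared norm. Adding the
  other cosets of \<open>range (\<psi> - \<phi>)\<close> only increases it, and turns it into an average along the ergodic action of
  the whole group.\<close>
lemma vdc_inner_average:
  fixes \<phi> \<psi> :: "'g \<Rightarrow> 'g"
  assumes erg: "ergodic_action M T" and F: "folner F"
    and hom: "additive_hom \<phi>" "additive_hom \<psi>" and \<delta>_def: "\<delta> = (\<lambda>g. \<psi> g - \<phi> g)"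
    and R: "finite R" "0 \<in> R" "\<And>x. \<exists>r\<in>R. \<exists>t. x = \<delta> t + r"
      "\<And>r r' t. r \<in> R \<Longrightarrow> r' \<in> R \<Longrightarrow> r = \<delta> t + r' \<Longrightarrow> r = r'"
    and e: "e > 0" and f: "f1 \<in> bfun M" "f2 \<in> bfun M" and E: "finite E" "E \<noteq> {}"
    and \<beta>: "\<beta> = (\<Sum>h\<in>E. \<Sum>h'\<in>E. cmod (l2ip M (koop M T (\<phi> h) f1) (koop M T (\<phi> h') f1)) *
             cmod (l2ip M (koop M T (\<psi> h) f2) (koop M T (\<psi> h') f2))) / (real (card E))\<^sup>2"
  shows "\<forall>\<^sub>F N in sequentially.
     (\<Sum>g\<in>F N. (L.nrm (L.avg E (\<lambda>h. koop M T (\<phi> (g + h)) f1 * koop M T (\<psi> (g + h)) f2)))\<^sup>2) / real (card (F N))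
       \<le> real (card R) * (\<beta> + e)"
proof -
  have dhom: "additive_hom \<delta>" using hom by (simp add: additive_hom_def \<delta>_def)
  have ai: "asymp_inv (\<lambda>N. F N \<times> R) (\<lambda>(g, r). \<delta> g + r)"
    by (rule asymp_inv_transversal[OF folner_asymp_inv[OF F] dhom R(1,2,3)]) (rule R(4))
  let ?\<gamma> = "\<lambda>(g, r). \<delta> g + r"
  have fin: "finite (F N)" "F N \<noteq> {}" for N using F by (auto simp: folner_def)
  have cR: "card R > 0" using R by (auto simp: card_gt_0_iff)
  define P where "P = (\<lambda>h. koop M T (\<phi> h) f1)"
  define Q where "Q = (\<lambda>h. koop M T (\<psi> h) f2)"
  have PV: "P h \<in> bfun M" and QV: "Q h \<in> bfun M" for h using f by (auto simp: P_def Q_def)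
  define B where "B = (\<lambda>k. (L.nrm (L.avg E (\<lambda>h. P h * koop M T k (Q h))))\<^sup>2)"
  have BV: "P h * koop M T k (Q h) \<in> bfun M" for h k using PV QV by (simp add: bfun_mult)
  \<comment> \<open>Pulling out the unitary \<open>koop M T (\<phi> g)\<close> does not change the
    norm and leaves a dependence on \<open>\<psi> g - \<phi> g\<close> alone.\<close>
  have step1: "(L.nrm (L.avg E (\<lambda>h. koop M T (\<phi> (g + h)) f1 * koop M T (\<psi> (g + h)) f2)))\<^sup>2 = B (\<delta> g)" for g
  proof -
    have "koop M T (\<phi> (g + h)) f1 * koop M T (\<psi> (g + h)) f2 = koop M T (\<phi> g) (P h * koop M T (\<delta> g) (Q h))" for h
    proof -
      have "koop M T (\<psi> (g + h)) f2 = koop M T (\<phi> g + \<delta> g) (Q h)"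
        unfolding Q_def \<delta>_def using L.U_plus[OF f(2), of "\<psi> g" "\<psi> h"] by (simp add: additive_hom_simps[OF hom(2)])
      also have "\<dots> = koop M T (\<phi> g) (koop M T (\<delta> g) (Q h))" by (rule L.U_plus[OF QV])
      finally show ?thesis
        using L.U_plus[OF f(1), of "\<phi> g" "\<phi> h"] by (simp add: koop_mult additive_hom_simps[OF hom(1)] P_def)
    qed
    then have "L.avg E (\<lambda>h. koop M T (\<phi> (g + h)) f1 * koop M T (\<psi> (g + h)) f2) = koop M T (\<phi> g) (L.avg E (\<lambda>h. P h * koop M T (\<delta> g) (Q h)))"
      using BV by (simp add: L.U_avg)
    then show ?thesis using BV by (simp add: B_def)
  qed
  define a where "a = (\<lambda>h h'. Q h * (\<lambda>x. cnj (Q h' x)))"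
  define w where "w = (\<lambda>h h'. (\<lambda>x. cnj (P h x)) * P h')"
  have aV: "a h h' \<in> bfun M" and wV: "w h h' \<in> bfun M" for h h'
    unfolding a_def w_def using PV QV by (auto intro!: bfun_mult bfun_cnj)
  \<comment> \<open>Expanding the squared norm over pairs from \<open>E\<close> writes
    \<open>B k\<close> through correlations of the fixed functions \<open>a h h'\<close> and
    \<open>w h h'\<close>, with \<open>k\<close> acting on the first only.\<close>
  have step2: "of_real (B k) = (\<Sum>h\<in>E. \<Sum>h'\<in>E. l2ip M (koop M T k (a h h')) (w h h')) / (of_nat (card E))\<^sup>2" for k
  proof -
    have sw: "l2ip M (P h * koop M T k (Q h)) (P h' * koop M T k (Q h')) = l2ip M (koop M T k (a h h')) (w h h')" for h h'
    proof -
      have "(\<lambda>x. cnj (koop M T k (Q h') x)) = koop M T k (\<lambda>x. cnj (Q h' x))" by (auto simp: koop_def)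
      then show ?thesis by (subst ip_mult_swap) (simp add: a_def w_def koop_mult)
    qed
    have "of_real (B k) = l2ip M (L.avg E (\<lambda>h. P h * koop M T k (Q h))) (L.avg E (\<lambda>h. P h * koop M T k (Q h)))"
      using L.ip_self[of "L.avg E (\<lambda>h. P h * koop M T k (Q h))"] BV by (simp add: B_def)
    also have "\<dots> = (\<Sum>h\<in>E. (\<Sum>h'\<in>E. l2ip M (P h * koop M T k (Q h)) (P h' * koop M T k (Q h'))) / of_nat (card E)) / of_nat (card E)"
      using BV by (subst L.ip_avg_left) (auto simp: L.ip_avg_right)
    finally show ?thesis by (simp add: sw sum_divide_distrib power2_eq_square)
  qed
  \<comment> \<open>By ergodicity every correlation averages to a product of two integrals, and
    these integrals are again inner products of translates of \<open>f2\<close> and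
    \<open>f1\<close>.\<close>
  define l where "l = (\<Sum>h\<in>E. \<Sum>h'\<in>E. (\<integral>x. a h h' x \<partial>M) * cnj (\<integral>x. w h h' x \<partial>M)) / (of_nat (card E))\<^sup>2"
  have ipa: "(\<integral>x. a h h' x \<partial>M) = l2ip M (Q h) (Q h')" "cnj (\<integral>x. w h h' x \<partial>M) = l2ip M (P h) (P h')" for h h'
    by (simp_all add: a_def w_def l2ip_def mult.commute flip: Bochner_Integration.integral_cnj)
  have "cmod l \<le> (\<Sum>h\<in>E. \<Sum>h'\<in>E. cmod (l2ip M (Q h) (Q h') * l2ip M (P h) (P h'))) / (real (card E))\<^sup>2"
    unfolding l_def ipa norm_divide
    by (simp add: norm_power) (intro divide_right_mono order_trans[OF norm_sum sum_mono] norm_sum zero_le_power2)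
  also have "\<dots> = \<beta>" unfolding \<beta> by (simp add: P_def Q_def norm_mult mult.commute)
  finally have l\<beta>: "cmod l \<le> \<beta>" .
  have pair: "(\<lambda>N. (\<Sum>i\<in>F N \<times> R. l2ip M (koop M T (?\<gamma> i) (a h h')) (w h h')) / of_nat (card (F N \<times> R)))
      \<longlonglongrightarrow> (\<integral>x. a h h' x \<partial>M) * cnj (\<integral>x. w h h' x \<partial>M)" for h h'
  proof -
    let ?A = "\<lambda>N. L.avg (F N \<times> R) (\<lambda>i. koop M T (?\<gamma> i) (a h h'))" and ?c = "\<integral>x. a h h' x \<partial>M"
    have AV: "?A N \<in> bfun M" for N using aV by simp
    have lim: "(\<lambda>N. L.nrm (?A N - cst ?c)) \<longlonglongrightarrow> 0" by (rule mean_ergodic[OF erg ai aV])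
    have "(\<lambda>N. l2ip M (?A N) (w h h') - l2ip M (cst ?c) (w h h')) \<longlonglongrightarrow> 0"
    proof (rule tendsto_norm_zero_cancel, rule null_squeeze)
      have "(\<lambda>N. L.nrm (?A N - cst ?c) * L.nrm (w h h')) \<longlonglongrightarrow> 0 * L.nrm (w h h')" by (intro tendsto_intros lim)
      then show "(\<lambda>N. L.nrm (?A N - cst ?c) * L.nrm (w h h')) \<longlonglongrightarrow> 0" by simp
      show "norm (l2ip M (?A N) (w h h') - l2ip M (cst ?c) (w h h')) \<le> L.nrm (?A N - cst ?c) * L.nrm (w h h')" for N
        using L.cauchy_schwarz[of "?A N - cst ?c" "w h h'"] AV wV[of h h'] by (simp add: L.ip_diff_left)
    qed simp
    then have "(\<lambda>N. l2ip M (?A N) (w h h')) \<longlonglongrightarrow> l2ip M (cst ?c) (w h h')" by (rule LIM_zero_cancel)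
    moreover have "l2ip M (cst ?c) (w h h') = ?c * cnj (\<integral>x. w h h' x \<partial>M)"
      using L.ip_herm[OF wV[of h h'] cst_bfun, of ?c] by (simp add: ip_cst[OF wV])
    ultimately show ?thesis using aV wV by (simp add: L.ip_avg_left)
  qed
  have limB: "(\<lambda>N. (\<Sum>i\<in>F N \<times> R. complex_of_real (B (?\<gamma> i))) / of_nat (card (F N \<times> R))) \<longlonglongrightarrow> l"
  proof -
    have "(\<Sum>i\<in>F N \<times> R. complex_of_real (B (?\<gamma> i))) / of_nat (card (F N \<times> R)) =
       (\<Sum>h\<in>E. \<Sum>h'\<in>E. (\<Sum>i\<in>F N \<times> R. l2ip M (koop M T (?\<gamma> i) (a h h')) (w h h')) / of_nat (card (F N \<times> R))) / (of_nat (card E))\<^sup>2" for N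
    proof -
      have "(\<Sum>i\<in>F N \<times> R. complex_of_real (B (?\<gamma> i))) = (\<Sum>h\<in>E. \<Sum>h'\<in>E. (\<Sum>i\<in>F N \<times> R. l2ip M (koop M T (?\<gamma> i) (a h h')) (w h h'))) / (of_nat (card E))\<^sup>2"
        unfolding step2 sum_divide_distrib[symmetric]
        by (subst sum.swap) (intro arg_cong2[where f = "(/)"] sum.cong refl sum.swap)
      then show ?thesis by (simp add: sum_divide_distrib mult.commute)
    qed
    moreover have "(\<lambda>N. (\<Sum>h\<in>E. \<Sum>h'\<in>E. (\<Sum>i\<in>F N \<times> R. l2ip M (koop M T (?\<gamma> i) (a h h')) (w h h')) / of_nat (card (F N \<times> R))) / (of_nat (card E))\<^sup>2) \<longlonglongrightarrow> l"
      unfolding l_def by (intro tendsto_intros pair) (use E in auto)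
    ultimately show ?thesis by simp
  qed
  show ?thesis
  proof -
    have "(\<lambda>N. Re ((\<Sum>i\<in>F N \<times> R. complex_of_real (B (?\<gamma> i))) / of_nat (card (F N \<times> R)))) \<longlonglongrightarrow> Re l"
      by (intro tendsto_intros limB)
    moreover have "Re ((\<Sum>i\<in>F N \<times> R. complex_of_real (B (?\<gamma> i))) / of_nat (card (F N \<times> R))) = (\<Sum>i\<in>F N \<times> R. B (?\<gamma> i)) / real (card (F N \<times> R))" for N
      by (simp only: Re_divide_of_nat Re_sum Re_complex_of_real)
    ultimately have "(\<lambda>N. (\<Sum>i\<in>F N \<times> R. B (?\<gamma> i)) / real (card (F N \<times> R))) \<longlonglongrightarrow> Re l" by simp
    moreover have "Re l < \<beta> + e" using complex_Re_le_cmod[of l] l\<beta> e by linarith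
    ultimately have "\<forall>\<^sub>F N in sequentially. (\<Sum>i\<in>F N \<times> R. B (?\<gamma> i)) / real (card (F N \<times> R)) < \<beta> + e"
      by (rule order_tendstoD(2))
    then show ?thesis
    proof eventually_elim
      case (elim N)
      have "(\<Sum>g\<in>F N. B (\<delta> g)) \<le> (\<Sum>i\<in>F N \<times> R. B (?\<gamma> i))"
        using sum_slice_le[of "F N" R "\<lambda>i. B (?\<gamma> i)"] fin R by (simp add: B_def)
      then have "(\<Sum>g\<in>F N. B (\<delta> g)) / real (card (F N)) \<le> (\<Sum>i\<in>F N \<times> R. B (?\<gamma> i)) / real (card (F N))"
        by (rule divide_right_mono) simp
      also have "\<dots> = real (card R) * ((\<Sum>i\<in>F N \<times> R. B (?\<gamma> i)) / real (card (F N \<times> R)))"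
        using cR by (simp add: card_cartesian_product)
      also have "\<dots> \<le> real (card R) * (\<beta> + e)" using elim by (intro mult_left_mono) auto
      finally show ?case by (simp only: step1)
    qed
  qed
qed

text \<open>One factor is bounded by the constant \<open>D\<close> and Cauchy-Schwarz over all pairs
  handles the other, so decay of a single correlation is enough.\<close>

lemma sum_prod_le_sqrt:
  fixes x y :: "'b \<Rightarrow> 'b \<Rightarrow> real"
  assumes E: "finite E" "E \<noteq> {}" and x: "\<And>h h'. 0 \<le> x h h'" and y: "\<And>h h'. 0 \<le> y h h'" "\<And>h h'. y h h' \<le> D"
  shows "(\<Sum>h\<in>E. \<Sum>h'\<in>E. x h h' * y h h') / (real (card E))\<^sup>2 \<le> D * sqrt ((\<Sum>h\<in>E. \<Sum>h'\<in>E. (x h h')\<^sup>2) / (real (card E))\<^sup>2)"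
proof -
  have D: "0 \<le> D" using y order_trans by blast
  have c: "real (card E) > 0" using E by (simp add: card_gt_0_iff)
  have "(\<Sum>h\<in>E. \<Sum>h'\<in>E. x h h' * y h h') \<le> (\<Sum>h\<in>E. \<Sum>h'\<in>E. x h h' * D)"
    by (intro sum_mono mult_left_mono x y)
  also have "\<dots> = D * (\<Sum>i\<in>E \<times> E. x (fst i) (snd i))"
    by (simp add: sum.cartesian_product case_prod_beta sum_distrib_left mult.commute)
  finally have 1: "(\<Sum>h\<in>E. \<Sum>h'\<in>E. x h h' * y h h') \<le> D * (\<Sum>i\<in>E \<times> E. x (fst i) (snd i))" .
  have "(\<Sum>i\<in>E \<times> E. x (fst i) (snd i))\<^sup>2 \<le> real (card (E \<times> E)) * (\<Sum>i\<in>E \<times> E. (x (fst i) (snd i))\<^sup>2)"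
    using Cauchy_Schwarz_ineq_sum[of "\<lambda>_. 1" "\<lambda>i. x (fst i) (snd i)" "E \<times> E"] by simp
  also have "\<dots> = (real (card E))\<^sup>2 * (\<Sum>h\<in>E. \<Sum>h'\<in>E. (x h h')\<^sup>2)"
    by (simp add: card_cartesian_product power2_eq_square sum.cartesian_product case_prod_beta)
  finally have "(\<Sum>i\<in>E \<times> E. x (fst i) (snd i)) \<le> sqrt ((real (card E))\<^sup>2 * (\<Sum>h\<in>E. \<Sum>h'\<in>E. (x h h')\<^sup>2))"
    by (rule real_le_rsqrt)
  also have "\<dots> = (real (card E))\<^sup>2 * sqrt ((\<Sum>h\<in>E. \<Sum>h'\<in>E. (x h h')\<^sup>2) / (real (card E))\<^sup>2)"
    using c by (simp add: real_sqrt_mult real_sqrt_divide power2_eq_square)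
  finally have "D * (\<Sum>i\<in>E \<times> E. x (fst i) (snd i)) \<le> D * ((real (card E))\<^sup>2 * sqrt ((\<Sum>h\<in>E. \<Sum>h'\<in>E. (x h h')\<^sup>2) / (real (card E))\<^sup>2))"
    using D by (rule mult_left_mono)
  with 1 show ?thesis using c by (simp add: pos_divide_le_eq mult_ac)
qed

theorem weak_mixing_average:
  fixes \<phi> \<psi> :: "'g \<Rightarrow> 'g"
  assumes erg: "ergodic_action M T" and F: "folner F"
    and hom: "additive_hom \<phi>" "additive_hom \<psi>" and fi: "finite_index (range (\<lambda>g. \<psi> g - \<phi> g))"
    and f: "f1 \<in> bfun M" "f2 \<in> bfun M"
    and null: "(\<lambda>N. corr (F N) \<phi> f1) \<longlonglongrightarrow> 0 \<or> (\<lambda>N. corr (F N) \<psi> f2) \<longlonglongrightarrow> 0"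
  shows "(\<lambda>N. L.nrm (L.avg (F N) (\<lambda>g. koop M T (\<phi> g) f1 * koop M T (\<psi> g) f2))) \<longlonglongrightarrow> 0"
proof -
  define u where "u = (\<lambda>g. koop M T (\<phi> g) f1 * koop M T (\<psi> g) f2)"
  have uV: "u g \<in> bfun M" for g unfolding u_def using f by (simp add: bfun_mult)
  obtain C1 C2 where C1: "0 \<le> C1" "\<And>x. norm (f1 x) \<le> C1" and C2: "0 \<le> C2" "\<And>x. norm (f2 x) \<le> C2"
    using bfun_bound[OF f(1)] bfun_bound[OF f(2)] by blast
  have un: "L.nrm (u g) \<le> C1 * C2" for g
  proof (rule nrm_le_bound[OF uV])
    show "norm (u g x) \<le> C1 * C2" for x
      unfolding u_def times_fun_apply norm_mult by (intro mult_mono koop_bound) (use C1 C2 in auto)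
  qed
  \<comment> \<open>A common bound for the correlations of \<open>f1\<close> and of
    \<open>f2\<close>.\<close>
  define D where "D = C1\<^sup>2 + C2\<^sup>2 + 1"
  have D: "D > 0" unfolding D_def by (smt (verit) zero_le_power2)
  have ipD: "cmod (l2ip M (koop M T g f') (koop M T h f')) \<le> D" if "f' \<in> {f1, f2}" for g h f'
  proof -
    have V: "f' \<in> bfun M" using f that by auto
    have "cmod (l2ip M (koop M T g f') (koop M T h f')) \<le> L.nrm f' * L.nrm f'"
      using L.cauchy_schwarz[of "koop M T g f'" "koop M T h f'"] V by simp
    also have "\<dots> \<le> D"
    proof -
      have "L.nrm f1 \<le> C1" "L.nrm f2 \<le> C2" by (auto intro!: nrm_le_bound f C1 C2)
      then have "L.nrm f1 * L.nrm f1 \<le> C1\<^sup>2" "L.nrm f2 * L.nrm f2 \<le> C2\<^sup>2"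
        unfolding power2_eq_square using f by (auto intro!: mult_mono C1 C2)
      then show ?thesis using that by (auto simp: D_def add_increasing add_increasing2)
    qed
    finally show ?thesis .
  qed
  define \<beta> where "\<beta> = (\<lambda>E. (\<Sum>h\<in>E. \<Sum>h'\<in>E. cmod (l2ip M (koop M T (\<phi> h) f1) (koop M T (\<phi> h') f1)) *
             cmod (l2ip M (koop M T (\<psi> h) f2) (koop M T (\<psi> h') f2))) / (real (card E))\<^sup>2)"
  have fin: "finite (F N)" "F N \<noteq> {}" for N using F by (auto simp: folner_def)
  have b1: "\<beta> (F N) \<le> D * sqrt (corr (F N) \<phi> f1)" for N
    unfolding \<beta>_def corr_def by (rule sum_prod_le_sqrt) (use fin ipD in auto)
  have b2: "\<beta> (F N) \<le> D * sqrt (corr (F N) \<psi> f2)" for N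
    unfolding \<beta>_def corr_def
    by (subst mult.commute) (rule sum_prod_le_sqrt, use fin ipD in auto)
  have \<beta>0: "0 \<le> \<beta> (F N)" for N unfolding \<beta>_def by (simp add: sum_nonneg)
  have "(\<lambda>N. \<beta> (F N)) \<longlonglongrightarrow> 0"
    using null
  proof
    assume "(\<lambda>N. corr (F N) \<phi> f1) \<longlonglongrightarrow> 0"
    then have "(\<lambda>N. D * sqrt (corr (F N) \<phi> f1)) \<longlonglongrightarrow> D * sqrt 0" by (intro tendsto_intros)
    then show ?thesis using null_squeeze[of "\<lambda>N. D * sqrt (corr (F N) \<phi> f1)" "\<lambda>N. \<beta> (F N)"] b1 \<beta>0 by simp
  next
    assume "(\<lambda>N. corr (F N) \<psi> f2) \<longlonglongrightarrow> 0"
    then have "(\<lambda>N. D * sqrt (corr (F N) \<psi> f2)) \<longlonglongrightarrow> D * sqrt 0" by (intro tendsto_intros)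
    then show ?thesis using null_squeeze[of "\<lambda>N. D * sqrt (corr (F N) \<psi> f2)" "\<lambda>N. \<beta> (F N)"] b2 \<beta>0 by simp
  qed
  note \<beta>lim = this
  have "(\<lambda>N. L.nrm (L.avg (F N) (\<lambda>i. u ((\<lambda>g. g) i)))) \<longlonglongrightarrow> 0"
  proof (rule L.van_der_corput[OF folner_asymp_inv[OF F] uV un])
    fix e :: real assume e: "e > 0"

    show "\<exists>E. finite E \<and> E \<noteq> {} \<and> (\<forall>\<^sub>F N in sequentially.
        (\<Sum>i\<in>F N. (L.nrm (L.avg E (\<lambda>h. u (i + h))))\<^sup>2) / real (card (F N)) \<le> e)"
    proof -
      define \<delta> where "\<delta> = (\<lambda>g. \<psi> g - \<phi> g)"
      have dhom: "additive_hom \<delta>" using hom by (simp add: additive_hom_def \<delta>_def)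
      obtain R where R: "finite R" "0 \<in> R" "\<And>x. \<exists>r\<in>R. \<exists>t. x = \<delta> t + r"
        "\<And>r r' t. r \<in> R \<Longrightarrow> r' \<in> R \<Longrightarrow> r = \<delta> t + r' \<Longrightarrow> r = r'"
        by (rule finite_index_transversal[OF dhom fi[folded \<delta>_def]]) blast
      have cR: "real (card R) > 0" using R by (auto simp: card_gt_0_iff)
      \<comment> \<open>With \<open>\<beta> (F K) < d\<close> the bound
        \<open>real (card R) * (\<beta> (F K) + d)\<close> is at most \<open>e\<close>.\<close>
      define d where "d = e / (2 * real (card R))"
      have d: "d > 0" using e cR by (simp add: d_def)
      have "\<forall>\<^sub>F K in sequentially. \<beta> (F K) < d" by (rule order_tendstoD(2)[OF \<beta>lim d])
      \<comment> \<open>The window of van der Corput's inequality is itself a set of the Folner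
        sequence, which links its inner average to the decay of \<open>corr\<close>.\<close>
      then obtain K where K: "\<beta> (F K) < d" by (auto simp: eventually_sequentially)
      have "\<forall>\<^sub>F N in sequentially.
        (\<Sum>g\<in>F N. (L.nrm (L.avg (F K) (\<lambda>h. koop M T (\<phi> (g + h)) f1 * koop M T (\<psi> (g + h)) f2)))\<^sup>2) / real (card (F N))
        \<le> real (card R) * (\<beta> (F K) + d)"
        by (rule vdc_inner_average[OF erg F hom \<delta>_def R(1,2,3) _ d f fin]) (use R(4) in \<open>auto simp: \<beta>_def\<close>)
      then have "\<forall>\<^sub>F N in sequentially.
        (\<Sum>i\<in>F N. (L.nrm (L.avg (F K) (\<lambda>h. u (i + h))))\<^sup>2) / real (card (F N)) \<le> e"
      proof eventually_elim
        case (elim N)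
        have "real (card R) * (\<beta> (F K) + d) \<le> real (card R) * (2 * d)" using K cR by (intro mult_left_mono) auto
        also have "\<dots> = e" using cR by (simp add: d_def)
        finally show ?case using elim by (simp add: u_def)
      qed
      then show ?thesis using fin by blast
    qed
  qed
  then show ?thesis by (simp add: u_def)
qed

end

section \<open>Borel measures on compact metric groups\<close>

text \<open>The type \<open>'z\<close> is not of class \<open>second_countable_topology\<close>, so the library's facts about products of Borel
  spaces do not apply; compactness provides a countable basis.\<close>
lemma compact_countable_basis:
  assumes "compact (UNIV :: 'a::metric_space set)"
  shows "\<exists>B :: 'a set set. countable B \<and> (\<forall>b\<in>B. open b) \<and> (\<forall>S x. open S \<longrightarrow> x \<in> S \<longrightarrow> (\<exists>b\<in>B. x \<in> b \<and> b \<subseteq> S))"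
proof -
  have "\<exists>k. finite k \<and> (UNIV :: 'a set) \<subseteq> (\<Union>x\<in>k. ball x (1 / real (Suc n)))" for n
    using assms unfolding compact_eq_totally_bounded by (meson of_nat_0_less_iff zero_less_Suc zero_less_divide_1_iff)
  then obtain k where k: "\<And>n. finite (k n)" "\<And>n. (UNIV :: 'a set) \<subseteq> (\<Union>x\<in>k n. ball x (1 / real (Suc n)))"
    by metis
  define B where "B = (\<Union>n. (\<lambda>x. ball x (1 / real (Suc n))) ` k n)"
  have "\<exists>b\<in>B. x \<in> b \<and> b \<subseteq> S" if S: "open S" "x \<in> S" for S x
  proof -
    obtain e where e: "e > 0" "ball x e \<subseteq> S" using S open_contains_ball by blast
    obtain n where n: "1 / real (Suc n) < e / 2" using reals_Archimedean[of "e/2"] e by (auto simp: inverse_eq_divide)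
    have "x \<in> (\<Union>x\<in>k n. ball x (1 / real (Suc n)))" using k(2)[of n] by blast
    then obtain y where y: "y \<in> k n" "dist y x < 1 / real (Suc n)" by auto
    have "ball y (1 / real (Suc n)) \<subseteq> ball x e"
    proof
      fix z assume "z \<in> ball y (1 / real (Suc n))"
      then have "dist y z < 1 / real (Suc n)" by simp
      then have "dist x z < e" using y(2) n dist_triangle[of x z y] dist_commute[of x y] by linarith
      then show "z \<in> ball x e" by simp
    qed
    then show ?thesis using y e by (intro bexI[of _ "ball y (1 / real (Suc n))"]) (auto simp: B_def)
  qed
  moreover have "countable B" unfolding B_def
    by (rule countable_UN) (auto intro!: countable_finite k(1))
  ultimately show ?thesis by (intro exI[of _ B]) (auto simp: B_def)
qed

lemma sets_borel_prod_compact: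
  assumes ca: "compact (UNIV :: 'a::metric_space set)" and cb: "compact (UNIV :: 'b::metric_space set)"
  shows "sets (borel \<Otimes>\<^sub>M borel) = sets (borel :: ('a \<times> 'b) measure)"
proof
  have "fst \<in> measurable (borel :: ('a \<times> 'b) measure) borel" "snd \<in> measurable (borel :: ('a \<times> 'b) measure) borel"
    by (intro borel_measurable_continuous_onI continuous_intros)+
  then have id: "(\<lambda>x. (fst x, snd x)) \<in> measurable (borel :: ('a \<times> 'b) measure) (borel \<Otimes>\<^sub>M borel)"
    by (rule measurable_Pair)
  show "sets (borel \<Otimes>\<^sub>M borel) \<subseteq> sets (borel :: ('a \<times> 'b) measure)"
    using measurable_sets[OF id] by auto
  obtain A where A: "countable A" "\<forall>a\<in>A. open a" "\<forall>S x. open S \<longrightarrow> x \<in> S \<longrightarrow> (\<exists>b\<in>A. x \<in> b \<and> b \<subseteq> (S :: 'a set))"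
    using compact_countable_basis[OF ca] by blast
  obtain B where B: "countable B" "\<forall>a\<in>B. open a" "\<forall>S x. open S \<longrightarrow> x \<in> S \<longrightarrow> (\<exists>b\<in>B. x \<in> b \<and> b \<subseteq> (S :: 'b set))"
    using compact_countable_basis[OF cb] by blast
  have "S \<in> sets (borel \<Otimes>\<^sub>M borel)" if S: "open S" for S :: "('a \<times> 'b) set"
  proof -
    let ?C = "{p \<in> A \<times> B. fst p \<times> snd p \<subseteq> S}"
    have "S = (\<Union>p\<in>?C. fst p \<times> snd p)"
    proof
      show "S \<subseteq> (\<Union>p\<in>?C. fst p \<times> snd p)"
      proof
        fix z assume "z \<in> S"
        then obtain X Y where XY: "open X" "open Y" "z \<in> X \<times> Y" "X \<times> Y \<subseteq> S" using S open_prod_elim by blast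
        obtain a where a: "a \<in> A" "fst z \<in> a" "a \<subseteq> X" using A(3) XY by (metis mem_Times_iff)
        obtain b where b: "b \<in> B" "snd z \<in> b" "b \<subseteq> Y" using B(3) XY by (metis mem_Times_iff)
        show "z \<in> (\<Union>p\<in>?C. fst p \<times> snd p)"
          using a b XY by (intro UN_I[of "(a, b)"]) (auto simp: mem_Times_iff)
      qed
    qed auto
    moreover have "(\<Union>p\<in>?C. fst p \<times> snd p) \<in> sets (borel \<Otimes>\<^sub>M borel)"
    proof (rule sets.countable_UN'')
      show "countable ?C" using A(1) B(1) by (intro countable_subset[of ?C "A \<times> B"]) auto
      show "fst p \<times> snd p \<in> sets (borel \<Otimes>\<^sub>M borel)" if "p \<in> ?C" for p
        using that A(2) B(2) by (intro pair_measureI) auto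
    qed
    ultimately show ?thesis by simp
  qed
  then have "sigma_sets UNIV {S. open S} \<subseteq> sets (borel \<Otimes>\<^sub>M borel :: ('a \<times> 'b) measure)"
    using sets.sigma_sets_subset[of "{S. open S}" "borel \<Otimes>\<^sub>M borel :: ('a \<times> 'b) measure"] by (simp add: space_pair_measure subset_iff)
  then show "sets (borel :: ('a \<times> 'b) measure) \<subseteq> sets (borel \<Otimes>\<^sub>M borel)" by (simp add: borel_def)
qed

lemma measurable_continuous_pair:
  fixes h :: "'a::metric_space \<times> 'b::metric_space \<Rightarrow> 'c::topological_space"
  assumes ca: "compact (UNIV :: 'a set)" and cb: "compact (UNIV :: 'b set)" and h: "continuous_on UNIV h"
    and f: "f \<in> measurable N borel" and g: "g \<in> measurable N borel"
  shows "(\<lambda>x. h (f x, g x)) \<in> measurable N borel"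
proof -
  have "h \<in> measurable (borel \<Otimes>\<^sub>M borel) borel"
    using borel_measurable_continuous_onI[OF h] measurable_cong_sets[OF sets_borel_prod_compact[OF ca cb] refl] by blast
  from measurable_compose[OF measurable_Pair[OF f g] this] show ?thesis .
qed

text \<open>Common setting for continuity of translations in L1. It serves the Haar measure
  \<open>m\<close> of the group and also \<open>\<nu>\<close> on the square, where only translations
  by elements of the closed subgroup preserve the measure.\<close>

locale near_identity =
  fixes \<mu> :: "'y::topological_space measure" and h :: "nat \<Rightarrow> 'y \<Rightarrow> 'y"
  assumes prob: "prob_space \<mu>" and s: "sets \<mu> = sets borel" and hm: "\<And>n. h n \<in> measurable borel borel"
    and pres: "\<And>n. distr \<mu> borel (h n) = \<mu>" and lim: "\<And>x. (\<lambda>n. h n x) \<longlonglongrightarrow> x"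
begin

sublocale prob_space \<mu> by (rule prob)

lemma h_measurable [measurable]: "h n \<in> measurable \<mu> \<mu>"
  using hm measurable_cong_sets[OF s s] by blast

lemma distr_h: "distr \<mu> \<mu> (h n) = \<mu>"
  using pres[of n] distr_cong[OF refl s[symmetric], of \<mu> "h n" "h n"] by simp

lemma h_integrable: "integrable \<mu> f \<Longrightarrow> integrable \<mu> (\<lambda>x. f (h n x))" for f :: "'y \<Rightarrow> 'b::{banach, second_countable_topology}"
  by (rule integrable_distr[OF h_measurable]) (simp add: distr_h)

lemma h_integral: "integrable \<mu> f \<Longrightarrow> (\<integral>x. f (h n x) \<partial>\<mu>) = (\<integral>x. f x \<partial>\<mu>)" for f :: "'y \<Rightarrow> 'b::{banach, second_countable_topology}"
  using integral_distr[OF h_measurable[of n], of f] distr_h[of n] by simp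

definition L1c :: "('y \<Rightarrow> complex) \<Rightarrow> bool" where
  "L1c f \<longleftrightarrow> integrable \<mu> f \<and> (\<lambda>n. \<integral>x. norm (f (h n x) - f x) \<partial>\<mu>) \<longlonglongrightarrow> 0"

lemma L1c_add: assumes f: "L1c f" and g: "L1c g" shows "L1c (\<lambda>x. f x + g x)"
proof -
  have i: "integrable \<mu> f" "integrable \<mu> g" using f g by (auto simp: L1c_def)
  have l: "(\<lambda>n. (\<integral>x. norm (f (h n x) - f x) \<partial>\<mu>) + (\<integral>x. norm (g (h n x) - g x) \<partial>\<mu>)) \<longlonglongrightarrow> 0"
    using f g tendsto_add[of _ 0 _ _ 0] by (fastforce simp: L1c_def)
  have "(\<lambda>n. \<integral>x. norm ((f (h n x) + g (h n x)) - (f x + g x)) \<partial>\<mu>) \<longlonglongrightarrow> 0"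
  proof (rule null_squeeze[OF l])
    fix n
    have "(\<integral>x. norm ((f (h n x) + g (h n x)) - (f x + g x)) \<partial>\<mu>) \<le> (\<integral>x. norm (f (h n x) - f x) + norm (g (h n x) - g x) \<partial>\<mu>)"
      by (intro integral_mono) (simp_all add: i h_integrable norm_diff_triangle_ineq)
    also have "\<dots> = (\<integral>x. norm (f (h n x) - f x) \<partial>\<mu>) + (\<integral>x. norm (g (h n x) - g x) \<partial>\<mu>)"
      by (rule Bochner_Integration.integral_add) (simp_all add: i h_integrable)
    finally show "(\<integral>x. norm ((f (h n x) + g (h n x)) - (f x + g x)) \<partial>\<mu>) \<le> (\<integral>x. norm (f (h n x) - f x) \<partial>\<mu>) + (\<integral>x. norm (g (h n x) - g x) \<partial>\<mu>)" .
  qed simp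
  then show ?thesis using i by (simp add: L1c_def)
qed

lemma L1c_zero: "L1c (\<lambda>x. 0)" by (simp add: L1c_def)

lemma L1c_sum: "(\<And>i. i \<in> J \<Longrightarrow> L1c (f i)) \<Longrightarrow> L1c (\<lambda>x. \<Sum>i\<in>J. f i x)"
  by (induction J rule: infinite_finite_induct) (auto intro: L1c_zero L1c_add)

lemma L1c_scale: "L1c f \<Longrightarrow> L1c (\<lambda>x. c * f x)"
proof -
  assume f: "L1c f"
  then have "(\<lambda>n. norm c * (\<integral>x. norm (f (h n x) - f x) \<partial>\<mu>)) \<longlonglongrightarrow> norm c * 0"
    by (intro tendsto_intros) (simp add: L1c_def)
  then show ?thesis using f by (simp add: L1c_def norm_mult flip: right_diff_distrib)
qed

lemma L1c_lim:
  assumes f: "integrable \<mu> f" and c: "\<And>i. L1c (u i)" and l: "(\<lambda>i. \<integral>x. norm (u i x - f x) \<partial>\<mu>) \<longlonglongrightarrow> 0"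
  shows "L1c f"
proof -
  have ui: "integrable \<mu> (u i)" for i using c by (simp add: L1c_def)
  have "(\<lambda>n. \<integral>x. norm (f (h n x) - f x) \<partial>\<mu>) \<longlonglongrightarrow> 0"
  proof (rule tendsto_0_le_approx)
    fix e :: real assume e: "e > 0"
    have "\<forall>\<^sub>F i in sequentially. (\<integral>x. norm (u i x - f x) \<partial>\<mu>) < e/3" by (rule order_tendstoD(2)[OF l]) (use e in simp)
    then obtain i where i: "(\<integral>x. norm (u i x - f x) \<partial>\<mu>) < e/3" by (auto simp: eventually_sequentially)
    have "\<forall>\<^sub>F n in sequentially. (\<integral>x. norm (u i (h n x) - u i x) \<partial>\<mu>) < e/3"
      by (rule order_tendstoD(2)[of _ 0]) (use c[of i] e in \<open>auto simp: L1c_def\<close>)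
    then show "\<forall>\<^sub>F n in sequentially. (\<integral>x. norm (f (h n x) - f x) \<partial>\<mu>) \<le> e"
    proof eventually_elim
      case (elim n)
      have "(\<integral>x. norm (f (h n x) - f x) \<partial>\<mu>) \<le> (\<integral>x. norm (u i (h n x) - f (h n x)) + norm (u i (h n x) - u i x) + norm (u i x - f x) \<partial>\<mu>)"
      proof (intro integral_mono)
        fix x
        have "f (h n x) - f x = - (u i (h n x) - f (h n x)) + (u i (h n x) - u i x) + (u i x - f x)" by simp
        then show "norm (f (h n x) - f x) \<le> norm (u i (h n x) - f (h n x)) + norm (u i (h n x) - u i x) + norm (u i x - f x)"
          by (metis norm_triangle_ineq norm_minus_cancel add_mono_thms_linordered_semiring(3) order_trans)
      qed (simp_all add: f ui h_integrable)
      also have "\<dots> = (\<integral>x. norm (u i (h n x) - f (h n x)) \<partial>\<mu>) + (\<integral>x. norm (u i (h n x) - u i x) \<partial>\<mu>) + (\<integral>x. norm (u i x - f x) \<partial>\<mu>)"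
        by (simp add: f ui h_integrable)
      also have "(\<integral>x. norm (u i (h n x) - f (h n x)) \<partial>\<mu>) = (\<integral>x. norm (u i x - f x) \<partial>\<mu>)"
        using h_integral[of "\<lambda>x. norm (u i x - f x)" n] f ui by simp
      finally show ?case using i elim by linarith
    qed
  qed simp
  then show ?thesis using f by (simp add: L1c_def)
qed

lemma indicator_integrable: "A \<in> sets borel \<Longrightarrow> integrable \<mu> (\<lambda>x. complex_of_real (indicator A x))"
  using s by (intro integrable_of_real integrable_real_indicator) (auto simp: emeasure_eq_measure)

text \<open>A point of an open set is eventually kept in it by \<open>h n\<close>, so the overlap of
  \<open>A\<close> with its preimages tends to full measure; preservation of the measure then makes
  the symmetric difference small.\<close>

lemma L1c_open: assumes A: "open A" shows "L1c (\<lambda>x. of_real (indicator A x))"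
proof -
  have Am: "A \<in> sets \<mu>" using A s by simp
  have iA: "integrable \<mu> (indicator A :: 'y \<Rightarrow> real)" using Am by (intro integrable_real_indicator) (auto simp: emeasure_eq_measure)
  have im: "(indicator A :: 'y \<Rightarrow> real) \<in> borel_measurable \<mu>" using Am by simp
  have ihm: "(\<lambda>x. indicator A (h n x) :: real) \<in> borel_measurable \<mu>" for n by (rule measurable_compose[OF h_measurable im])
  have pm: "(\<lambda>x. indicator A x * indicator A (h n x) :: real) \<in> borel_measurable \<mu>" for n using im ihm by (rule borel_measurable_times)
  have ip: "integrable \<mu> (\<lambda>x. indicator A x * indicator A (h n x) :: real)" for n
    by (rule integrable_const_bound[where B = 1, OF _ pm]) (auto simp: indicator_def)
  have l: "(\<lambda>n. \<integral>x. indicator A x * indicator A (h n x) \<partial>\<mu>) \<longlonglongrightarrow> (\<integral>x. indicator A x \<partial>\<mu> :: real)"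
  proof (rule integral_dominated_convergence[where w = "\<lambda>_. 1"])
    show "AE x in \<mu>. (\<lambda>n. indicator A x * indicator A (h n x) :: real) \<longlonglongrightarrow> indicator A x"
    proof (rule AE_I2)
      fix x
      show "(\<lambda>n. indicator A x * indicator A (h n x) :: real) \<longlonglongrightarrow> indicator A x"
      proof (cases "x \<in> A")
        case True
        then have "\<forall>\<^sub>F n in sequentially. h n x \<in> A" using lim[of x] A topological_tendstoD by blast
        then have "\<forall>\<^sub>F n in sequentially. indicator A x * indicator A (h n x) = (1::real)" by eventually_elim (simp add: True)
        then show ?thesis using True by (simp add: tendsto_eventually)
      qed simp
    qed
  qed (use im pm in \<open>simp_all add: indicator_le_1 mult_le_one\<close>)
  \<comment> \<open>For values 0 and 1 the absolute difference is the sum minus twice the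
    product.\<close>
  have eq: "(\<integral>x. norm (complex_of_real (indicator A (h n x)) - complex_of_real (indicator A x)) \<partial>\<mu>) =
      2 * (\<integral>x. indicator A x \<partial>\<mu>) - 2 * (\<integral>x. indicator A x * indicator A (h n x) \<partial>\<mu>)" for n
  proof -
    have "(\<integral>x. norm (complex_of_real (indicator A (h n x)) - complex_of_real (indicator A x)) \<partial>\<mu>) =
      (\<integral>x. indicator A (h n x) + indicator A x - 2 * (indicator A x * indicator A (h n x)) \<partial>\<mu>)"
      by (rule Bochner_Integration.integral_cong) (auto simp: indicator_def)
    also have "\<dots> = (\<integral>x. indicator A (h n x) \<partial>\<mu>) + (\<integral>x. indicator A x \<partial>\<mu>) - 2 * (\<integral>x. indicator A x * indicator A (h n x) \<partial>\<mu>)"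
      using h_integrable[OF iA, of n] iA ip[of n] by simp
    also have "(\<integral>x. indicator A (h n x) \<partial>\<mu>) = (\<integral>x. indicator A x \<partial>\<mu> :: real)" by (rule h_integral[OF iA])
    finally show ?thesis by simp
  qed
  have "(\<lambda>n. 2 * (\<integral>x. indicator A x \<partial>\<mu> :: real) - 2 * (\<integral>x. indicator A x * indicator A (h n x) \<partial>\<mu>)) \<longlonglongrightarrow> 2 * (\<integral>x. indicator A x \<partial>\<mu>) - 2 * (\<integral>x. indicator A x \<partial>\<mu>)"
    by (intro tendsto_intros l)
  then show ?thesis unfolding L1c_def eq using indicator_integrable A by simp
qed

text \<open>The open sets are a generator closed under intersection. Complements leave the
  difference of indicators unchanged in absolute value, and disjoint unions are L1 limits of finite
  sums.\<close>

lemma L1c_set: assumes "A \<in> sets borel" shows "L1c (\<lambda>x. of_real (indicator A x))"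
proof -
  have a: "A \<in> sigma_sets UNIV {S. open S}" using assms by (simp add: borel_def)
  have i: "Int_stable {S :: 'y set. open S}" by (auto simp: Int_stable_def)
  have "{S :: 'y set. open S} \<subseteq> Pow UNIV" by simp
  from i this a show ?thesis
  proof (induction rule: sigma_sets_induct_disjoint)
    case (basic A)
    then show ?case by (simp add: L1c_open)
  next
    case empty
    show ?case by (simp add: L1c_zero)
  next
    case (compl A)
    have A: "A \<in> sets borel" using compl by (simp add: borel_def)
    have "norm (complex_of_real (indicator (UNIV - A) x) - complex_of_real (indicator (UNIV - A) y)) =
        norm (complex_of_real (indicator A x) - complex_of_real (indicator A y))" for x y
      by (auto simp: indicator_def)
    then show ?case using compl.IH indicator_integrable[of "UNIV - A"] A by (simp add: L1c_def)
  next
    case (union A)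
    have A: "A i \<in> sets borel" for i using union(2) by (auto simp: borel_def)
    show ?case
    proof (rule L1c_lim)
      show "integrable \<mu> (\<lambda>x. complex_of_real (indicator (\<Union>i. A i) x))" using A by (intro indicator_integrable) auto
      show "L1c (\<lambda>x. \<Sum>i<k. complex_of_real (indicator (A i) x))" for k by (intro L1c_sum union.IH)
      have ind: "(\<Sum>i<k. complex_of_real (indicator (A i) x)) = of_real (indicator (\<Union>i<k. A i) x)" for k x
      proof -
        have "(\<Sum>i<k. indicator (A i) x) = (indicator (\<Union>i<k. A i) x :: real)"
          using union(1) by (subst indicator_UN_disjoint) (auto simp: disjoint_family_on_def)
        then show ?thesis by (simp flip: of_real_sum)
      qed
      have "(\<lambda>k. \<integral>x. norm ((\<Sum>i<k. complex_of_real (indicator (A i) x)) - complex_of_real (indicator (\<Union>i. A i) x)) \<partial>\<mu>) \<longlonglongrightarrow> (\<integral>x. 0 \<partial>\<mu>)"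
        unfolding ind
      proof (rule integral_dominated_convergence[where w = "\<lambda>_. 1"])
        show "AE x in \<mu>. (\<lambda>k. norm (complex_of_real (indicator (\<Union>i<k. A i) x) - complex_of_real (indicator (\<Union>i. A i) x))) \<longlonglongrightarrow> 0"
        proof (rule AE_I2, rule tendsto_eventually)
          fix x
          show "\<forall>\<^sub>F k in sequentially. norm (complex_of_real (indicator (\<Union>i<k. A i) x) - complex_of_real (indicator (\<Union>i. A i) x)) = 0"
          proof (cases "x \<in> (\<Union>i. A i)")
            case True
            then obtain i where "x \<in> A i" by blast
            then have "x \<in> (\<Union>i<k. A i)" if "k \<ge> Suc i" for k using that by force
            then show ?thesis using True unfolding eventually_sequentially by (intro exI[of _ "Suc i"]) simp
          qed auto
        qed
        show "(\<lambda>x. norm (complex_of_real (indicator (\<Union>i<k. A i) x) - complex_of_real (indicator (\<Union>i. A i) x))) \<in> borel_measurable \<mu>" for k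
          using borel_measurable_integrable[OF indicator_integrable[of "\<Union>i<k. A i"]] borel_measurable_integrable[OF indicator_integrable[of "\<Union>i. A i"]] A by simp
        show "AE x in \<mu>. norm (norm (complex_of_real (indicator (\<Union>i<k. A i) x) - complex_of_real (indicator (\<Union>i. A i) x))) \<le> 1" for k
          by (auto simp: indicator_def)
      qed auto
      then show "(\<lambda>k. \<integral>x. norm ((\<Sum>i<k. complex_of_real (indicator (A i) x)) - complex_of_real (indicator (\<Union>i. A i) x)) \<partial>\<mu>) \<longlonglongrightarrow> 0" by simp
    qed
  qed
qed

lemma L1c_integrable: assumes "integrable \<mu> f" shows "L1c f"
  using assms
proof (induction rule: integrable_induct)
  case (base A c)
  have "L1c (\<lambda>x. c * of_real (indicator A x))" using base s by (intro L1c_scale L1c_set) simp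
  then show ?case by (simp add: scaleR_conv_of_real mult.commute)
next
  case (add f g)
  then show ?case by (intro L1c_add)
next
  case (lim f u)
  show ?case
  proof (rule L1c_lim[OF lim.hyps(4) lim.IH])
    have "(\<lambda>i. \<integral>x. norm (u i x - f x) \<partial>\<mu>) \<longlonglongrightarrow> (\<integral>x. 0 \<partial>\<mu>)"
    proof (rule integral_dominated_convergence[where w = "\<lambda>x. 3 * norm (f x)"])
      show "AE x in \<mu>. (\<lambda>i. norm (u i x - f x)) \<longlonglongrightarrow> 0"
        using lim.hyps(2) by (intro AE_I2) (simp add: tendsto_norm_zero_iff LIM_zero)
      show "AE x in \<mu>. norm (norm (u i x - f x)) \<le> 3 * norm (f x)" for i
      proof (rule AE_I2)
        fix x assume "x \<in> space \<mu>"
        then show "norm (norm (u i x - f x)) \<le> 3 * norm (f x)"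
          using lim.hyps(3)[of x i] norm_triangle_ineq4[of "u i x" "f x"] by simp
      qed
      show "(\<lambda>x. norm (u i x - f x)) \<in> borel_measurable \<mu>" for i using lim.hyps(1)[of i] lim.hyps(4) by simp
    qed (use lim.hyps(4) in auto)
    then show "(\<lambda>i. \<integral>x. norm (u i x - f x) \<partial>\<mu>) \<longlonglongrightarrow> 0" by simp
  qed
qed

end

section \<open>Haar measure on the closure of a homomorphic image in the square of a compact
  group\<close>

locale rot_pair =
  fixes m :: "'z::{topological_ab_group_add,metric_space} measure"
    and \<omega> :: "'g::{countable,ab_group_add} \<Rightarrow> 'z \<times> 'z" and \<nu> :: "('z \<times> 'z) measure"
  assumes cZ: "compact (UNIV :: 'z set)" and haar_m: "haar_on UNIV m" and hom: "additive_hom \<omega>"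
    and haar_\<nu>: "haar_on (closure (range \<omega>)) \<nu>"
begin

lemma cZZ: "compact (UNIV :: ('z \<times> 'z) set)"
  using compact_Times[OF cZ cZ] by simp

lemma sets_m: "sets m = sets borel" and prob_m: "prob_space m"
  and sets_\<nu>: "sets \<nu> = sets borel" and prob_\<nu>: "prob_space \<nu>"
  using haar_m haar_\<nu> by (auto simp: haar_on_def)

sublocale m: prob_space m by (rule prob_m)
sublocale \<nu>: prob_space \<nu> by (rule prob_\<nu>)
sublocale mn: pair_prob_space m \<nu> ..

lemma space_m: "space m = UNIV" and space_\<nu>: "space \<nu> = UNIV"
  using sets_eq_imp_space_eq[OF sets_m] sets_eq_imp_space_eq[OF sets_\<nu>] by auto

lemma cont_add_pair: "continuous_on UNIV (\<lambda>p :: ('z \<times> 'z) \<times> ('z \<times> 'z). fst p + snd p)"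
  unfolding plus_prod_def by (intro continuous_intros)

lemma cont_tr: "continuous_on UNIV (\<lambda>y :: 'z \<times> 'z. y + k)"
  unfolding plus_prod_def by (intro continuous_intros)

lemma cont_neg: "continuous_on UNIV (\<lambda>y :: 'z \<times> 'z. - y)"
  unfolding uminus_prod_def by (intro continuous_intros)

lemma tendsto_add_pair: "(f \<longlonglongrightarrow> (a :: 'z \<times> 'z)) \<Longrightarrow> (g \<longlonglongrightarrow> b) \<Longrightarrow> (\<lambda>n. f n + g n) \<longlonglongrightarrow> a + b"
  using continuous_on_tendsto_compose[OF cont_add_pair tendsto_Pair, of f a sequentially g b] by simp

lemma tendsto_neg_pair: "(f \<longlonglongrightarrow> (a :: 'z \<times> 'z)) \<Longrightarrow> (\<lambda>n. - f n) \<longlonglongrightarrow> - a"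
  using continuous_on_tendsto_compose[OF cont_neg, of f a sequentially] by simp

definition K where "K = closure (range \<omega>)"

lemma \<omega>_simps: "\<omega> (g + h) = \<omega> g + \<omega> h" "\<omega> 0 = 0" "\<omega> (- g) = - \<omega> g"
  by (rule additive_hom_simps[OF hom])+

lemma \<omega>_K: "\<omega> g \<in> K" unfolding K_def using closure_subset[of "range \<omega>"] by blast

lemma K_seq: assumes "k \<in> K" shows "\<exists>g. (\<lambda>n. \<omega> (g n)) \<longlonglongrightarrow> k"
proof -
  obtain s where s: "\<forall>n. s n \<in> range \<omega>" "s \<longlonglongrightarrow> k"
    using closure_sequential[THEN iffD1, of k "range \<omega>"] assms unfolding K_def by blast
  then have "\<forall>n. \<exists>g. s n = \<omega> g" by blast
  then obtain g where "\<And>n. s n = \<omega> (g n)" by metis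
  then have "s = (\<lambda>n. \<omega> (g n))" by auto
  then show ?thesis using s(2) by blast
qed

lemma K_I: "(\<lambda>n. \<omega> (g n)) \<longlonglongrightarrow> k \<Longrightarrow> k \<in> K"
  unfolding K_def closure_sequential by (intro exI[of _ "\<lambda>n. \<omega> (g n)"]) auto

lemma K_neg: "k \<in> K \<Longrightarrow> - k \<in> K"
proof -
  assume "k \<in> K"
  then obtain g where "(\<lambda>n. \<omega> (g n)) \<longlonglongrightarrow> k" using K_seq by blast
  then have "(\<lambda>n. \<omega> (- g n)) \<longlonglongrightarrow> - k" unfolding \<omega>_simps by (rule tendsto_neg_pair)
  then show ?thesis by (rule K_I)
qed

lemma K_add: "k \<in> K \<Longrightarrow> l \<in> K \<Longrightarrow> k + l \<in> K"
proof -
  assume "k \<in> K" "l \<in> K"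
  then obtain g h where "(\<lambda>n. \<omega> (g n)) \<longlonglongrightarrow> k" "(\<lambda>n. \<omega> (h n)) \<longlonglongrightarrow> l" using K_seq by metis
  then have "(\<lambda>n. \<omega> (g n + h n)) \<longlonglongrightarrow> k + l" unfolding \<omega>_simps by (rule tendsto_add_pair)
  then show ?thesis by (rule K_I)
qed

lemma tr_measurable_\<nu>: "(\<lambda>y. y + k) \<in> measurable \<nu> \<nu>"
  using borel_measurable_continuous_onI[OF cont_tr] measurable_cong_sets[OF sets_\<nu> sets_\<nu>] by blast

lemma tr_measurable_m: "(\<lambda>z. z + a) \<in> measurable m m"
proof -
  have "(\<lambda>z::'z. z + a) \<in> measurable borel borel" by (intro borel_measurable_continuous_onI continuous_intros)
  then show ?thesis using measurable_cong_sets[OF sets_m sets_m] by blast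
qed

lemma vimage_tr: "(\<lambda>y. y + k) -` A = (\<lambda>y. - k + y) ` A" for k :: "'b::ab_group_add"
proof (intro set_eqI iffI)
  fix x assume "x \<in> (\<lambda>y. y + k) -` A"
  moreover have "x = - k + (x + k)" by simp
  ultimately show "x \<in> (\<lambda>y. - k + y) ` A" by blast
qed auto

lemma distr_\<nu>: assumes "k \<in> K" shows "distr \<nu> \<nu> (\<lambda>y. y + k) = \<nu>"
proof (rule measure_eqI)
  fix A assume "A \<in> sets (distr \<nu> \<nu> (\<lambda>y. y + k))"
  then have A: "A \<in> sets \<nu>" by simp
  have "emeasure (distr \<nu> \<nu> (\<lambda>y. y + k)) A = emeasure \<nu> ((\<lambda>y. - k + y) ` A)"
    using emeasure_distr[OF tr_measurable_\<nu> A] by (simp add: space_\<nu> vimage_tr)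
  also have "\<dots> = emeasure \<nu> A"
    using haar_\<nu> K_neg[OF assms] A sets_\<nu> unfolding haar_on_def K_def[symmetric] by blast
  finally show "emeasure (distr \<nu> \<nu> (\<lambda>y. y + k)) A = emeasure \<nu> A" .
qed simp

lemma distr_m: "distr m m (\<lambda>z. z + a) = m"
proof (rule measure_eqI)
  fix A assume "A \<in> sets (distr m m (\<lambda>z. z + a))"
  then have A: "A \<in> sets m" by simp
  have "emeasure (distr m m (\<lambda>z. z + a)) A = emeasure m ((\<lambda>y. - a + y) ` A)"
    using emeasure_distr[OF tr_measurable_m A] by (simp add: space_m vimage_tr)
  also have "\<dots> = emeasure m A"
    using haar_m A sets_m unfolding haar_on_def by blast
  finally show "emeasure (distr m m (\<lambda>z. z + a)) A = emeasure m A" .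
qed simp

lemma integral_tr_m: "f \<in> borel_measurable m \<Longrightarrow> (\<integral>z. f (z + a) \<partial>m) = (\<integral>z. f z \<partial>m)"
  for f :: "'z \<Rightarrow> 'b::{banach, second_countable_topology}"
  using integral_distr[OF tr_measurable_m[of a], of f] distr_m[of a] by simp

lemma integral_tr_\<nu>: "f \<in> borel_measurable \<nu> \<Longrightarrow> k \<in> K \<Longrightarrow> (\<integral>z. f (z + k) \<partial>\<nu>) = (\<integral>z. f z \<partial>\<nu>)"
  for f :: "'z \<times> 'z \<Rightarrow> 'b::{banach, second_countable_topology}"
  using integral_distr[OF tr_measurable_\<nu>[of k], of f] distr_\<nu>[of k] by simp

lemma AE_K: "AE y in \<nu>. y \<in> K"
proof -
  have "K \<in> sets \<nu>" using sets_\<nu> by (simp add: K_def)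
  moreover have "emeasure \<nu> K = 1" using haar_\<nu> by (simp add: haar_on_def K_def)
  ultimately show ?thesis by (simp add: \<nu>.AE_in_set_eq_1 measure_def)
qed

lemma near_identity_\<nu>:
  assumes "\<And>n. d n \<in> K" "d \<longlonglongrightarrow> 0" shows "near_identity \<nu> (\<lambda>n y. y + d n)"
proof
  show "(\<lambda>y. y + d n) \<in> borel_measurable borel" for n by (rule borel_measurable_continuous_onI[OF cont_tr])
  show "distr \<nu> borel (\<lambda>y. y + d n) = \<nu>" for n
    using distr_\<nu>[OF assms(1), of n] distr_cong[OF refl sets_\<nu>, of \<nu> "\<lambda>y. y + d n" "\<lambda>y. y + d n"] by simp
  show "(\<lambda>n. x + d n) \<longlonglongrightarrow> x" for x using tendsto_add_pair[OF tendsto_const assms(2), of x] by simp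
qed (simp_all add: sets_\<nu> prob_\<nu>)

lemma near_identity_m:
  assumes "d \<longlonglongrightarrow> 0" shows "near_identity m (\<lambda>n z. z + d n)"
proof
  show "(\<lambda>z::'z. z + d n) \<in> borel_measurable borel" for n by (intro borel_measurable_continuous_onI continuous_intros)
  show "distr m borel (\<lambda>z. z + d n) = m" for n
    using distr_m[of "d n"] distr_cong[OF refl sets_m, of m "\<lambda>z. z + d n" "\<lambda>z. z + d n"] by simp
  show "(\<lambda>n. x + d n) \<longlonglongrightarrow> x" for x using tendsto_add[OF tendsto_const assms, of x] by simp
qed (simp_all add: sets_m prob_m)

text \<open>A failing modulus would give translations tending to 0 with L1 displacement above
  \<open>e\<close>. The uniform radius later supplies the neighbourhood of 0 for the starting
  points.\<close>

lemma L1_modulus: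
  fixes f :: "'z \<Rightarrow> complex"
  assumes f: "integrable m f" and e: "e > 0"
  shows "\<exists>d>0. \<forall>a. dist a 0 < d \<longrightarrow> (\<integral>z. norm (f (z + a) - f z) \<partial>m) \<le> e"
proof (rule ccontr)
  assume "\<not> ?thesis"
  then have "\<forall>n. \<exists>a. dist a 0 < 1 / real (Suc n) \<and> (\<integral>z. norm (f (z + a) - f z) \<partial>m) > e"
    by (metis of_nat_0_less_iff zero_less_Suc zero_less_divide_1_iff not_le)
  then obtain a where a: "\<And>n. dist (a n) 0 < 1 / real (Suc n)" "\<And>n. (\<integral>z. norm (f (z + a n) - f z) \<partial>m) > e" by metis
  have "a \<longlonglongrightarrow> 0"
    by (rule tendsto_dist_iff[THEN iffD2], rule null_squeeze[OF LIMSEQ_Suc[OF lim_1_over_n]])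
      (use less_imp_le[OF a(1)] in auto)
  then interpret near_identity m "\<lambda>n z. z + a n" by (rule near_identity_m)
  have "(\<lambda>n. \<integral>z. norm (f (z + a n) - f z) \<partial>m) \<longlonglongrightarrow> 0" using L1c_integrable[OF f] by (simp add: L1c_def)
  then have "\<forall>\<^sub>F n in sequentially. (\<integral>z. norm (f (z + a n) - f z) \<partial>m) < e" by (rule order_tendstoD(2)[OF _ e])
  then show False using a(2) by (auto simp: eventually_sequentially) (metis less_asym order_refl)
qed

definition T\<nu> :: "'g \<Rightarrow> 'z \<times> 'z \<Rightarrow> 'z \<times> 'z" where "T\<nu> g y = y + \<omega> g"

lemma mp_\<nu>: "mp_action \<nu> T\<nu>"
  unfolding mp_action_def T\<nu>_def
  by (intro conjI allI ballI prob_\<nu> tr_measurable_\<nu> distr_\<nu>[OF \<omega>_K]) (simp_all add: \<omega>_simps add_ac)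

text \<open>A set invariant under the dense subgroup is almost everywhere invariant under each
  \<open>k \<in> K\<close>, by L1 continuity of translations. Then the double integral of
  \<open>f y * f (y + k)\<close>, with \<open>f\<close> the indicator of the set, equals its measure
  \<open>p\<close> in one order and \<open>p * p\<close> in the other.\<close>

lemma ergodic_\<nu>: "ergodic_action \<nu> T\<nu>"
  unfolding ergodic_action_def
proof (intro conjI ballI impI)
  show "mp_action \<nu> T\<nu>" by (rule mp_\<nu>)
  fix A assume A: "A \<in> sets \<nu>" and inv: "\<forall>g. T\<nu> g -` A \<inter> space \<nu> = A"
  have Ab: "A \<in> sets borel" using A sets_\<nu> by simp
  have invA: "y + \<omega> g \<in> A \<longleftrightarrow> y \<in> A" for y g
  proof -
    have "T\<nu> g -` A = A" using inv[rule_format, of g] by (simp add: space_\<nu>)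
    then have "y \<in> T\<nu> g -` A \<longleftrightarrow> y \<in> A" by simp
    then show ?thesis by (simp only: vimage_eq T\<nu>_def)
  qed
  define f where "f = (\<lambda>y. indicator A y :: real)"
  have fm: "f \<in> borel_measurable \<nu>" unfolding f_def using A by simp
  have fb: "0 \<le> f y" "f y \<le> 1" for y by (auto simp: f_def indicator_def)
  define p where "p = (\<integral>y. f y \<partial>\<nu>)"
  have pA: "p = measure \<nu> A" unfolding p_def f_def using A by simp
  have keyK: "AE y in \<nu>. f (y + k) = f y" if k: "k \<in> K" for k
  proof -
    obtain g where g: "(\<lambda>n. \<omega> (g n)) \<longlonglongrightarrow> k" using K_seq[OF k] by blast
    \<comment> \<open>These elements tend to 0, yet on \<open>A\<close> each translation by
      \<open>d n\<close> acts exactly as the one by \<open>k\<close>. So the vanishing limit is that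
      of a constant sequence.\<close>
    define d where "d = (\<lambda>n. k + \<omega> (- g n))"
    have "d \<longlonglongrightarrow> k + - k" unfolding d_def \<omega>_simps by (intro tendsto_add_pair tendsto_neg_pair g tendsto_const)
    then have d0: "d \<longlonglongrightarrow> 0" by simp
    have dK: "d n \<in> K" for n unfolding d_def by (intro K_add k \<omega>_K)
    interpret near_identity \<nu> "\<lambda>n y. y + d n" by (rule near_identity_\<nu>[OF dK d0])
    have "(\<lambda>n. \<integral>y. norm (complex_of_real (indicator A (y + d n)) - complex_of_real (indicator A y)) \<partial>\<nu>) \<longlonglongrightarrow> 0"
      using L1c_set[OF Ab] by (simp add: L1c_def)
    moreover have "indicator A (y + d n) = f (y + k)" for y n
      using invA[of "y + k" "- g n"] by (auto simp: d_def f_def indicator_def add.assoc)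
    ultimately have "(\<lambda>n::nat. \<integral>y. norm (complex_of_real (f (y + k)) - complex_of_real (f y)) \<partial>\<nu>) \<longlonglongrightarrow> 0"
      by (simp add: f_def)
    then have "(\<integral>y. norm (complex_of_real (f (y + k)) - complex_of_real (f y)) \<partial>\<nu>) = 0"
      by (simp add: LIMSEQ_const_iff)
    then have 0: "(\<integral>y. \<bar>f (y + k) - f y\<bar> \<partial>\<nu>) = 0" by (simp flip: of_real_diff)
    have fkm: "(\<lambda>y. f (y + k)) \<in> borel_measurable \<nu>" by (rule measurable_compose[OF tr_measurable_\<nu> fm])
    have "integrable \<nu> (\<lambda>y. \<bar>f (y + k) - f y\<bar>)"
    proof (rule \<nu>.integrable_const_bound[where B = 1])
      have "\<bar>f (y + k) - f y\<bar> \<le> 1" for y using fb[of y] fb[of "y + k"] by linarith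
      then show "AE y in \<nu>. norm \<bar>f (y + k) - f y\<bar> \<le> 1" by simp
    qed (use fkm fm in simp)
    from integral_nonneg_eq_0_iff_AE[OF this] 0 have "AE y in \<nu>. \<bar>f (y + k) - f y\<bar> = 0" by simp
    then show ?thesis by simp
  qed
  interpret nn: pair_prob_space \<nu> \<nu> ..
  have addm: "(\<lambda>p. f (fst p + snd p)) \<in> borel_measurable (\<nu> \<Otimes>\<^sub>M \<nu>)"
  proof -
    have "fst \<in> measurable (\<nu> \<Otimes>\<^sub>M \<nu>) borel" "snd \<in> measurable (\<nu> \<Otimes>\<^sub>M \<nu>) borel"
      using measurable_fst[of \<nu> \<nu>] measurable_snd[of \<nu> \<nu>] measurable_cong_sets[OF refl sets_\<nu>] by blast+
    from measurable_continuous_pair[OF cZZ cZZ cont_add_pair this]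
    have "(\<lambda>p. fst p + snd p) \<in> measurable (\<nu> \<Otimes>\<^sub>M \<nu>) borel" by simp
    then have "(\<lambda>p. fst p + snd p) \<in> measurable (\<nu> \<Otimes>\<^sub>M \<nu>) \<nu>"
      by (subst measurable_cong_sets[OF refl sets_\<nu>])
    from measurable_compose[OF this fm] show ?thesis .
  qed
  have "integrable (\<nu> \<Otimes>\<^sub>M \<nu>) (\<lambda>(y, k). f y * f (y + k))"
  proof (rule nn.P.integrable_const_bound[where B = 1])
    show "AE x in \<nu> \<Otimes>\<^sub>M \<nu>. norm (case x of (y, k) \<Rightarrow> f y * f (y + k)) \<le> 1"
      using fb by (intro AE_I2) (auto simp: abs_mult mult_le_one)
    have "(\<lambda>x. f (fst x) * f (fst x + snd x)) \<in> borel_measurable (\<nu> \<Otimes>\<^sub>M \<nu>)"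
      using measurable_compose[OF measurable_fst fm] addm by (rule borel_measurable_times)
    then show "(\<lambda>(y, k). f y * f (y + k)) \<in> borel_measurable (\<nu> \<Otimes>\<^sub>M \<nu>)" by (simp add: case_prod_beta')
  qed
  note fub = nn.Fubini_integral[OF this]
  \<comment> \<open>Integrating over \<open>y\<close> first uses almost everywhere invariance of
    \<open>f\<close> under \<open>k\<close>; the other order uses invariance of \<open>\<nu>\<close>
    under translation by \<open>y\<close>. Both rely on almost every point lying in
    \<open>K\<close>.\<close>
  have "(\<integral>k. (\<integral>y. f y * f (y + k) \<partial>\<nu>) \<partial>\<nu>) = (\<integral>k. p \<partial>\<nu>)"
  proof (rule integral_cong_AE)
    show "AE k in \<nu>. (\<integral>y. f y * f (y + k) \<partial>\<nu>) = p"
      using AE_K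
    proof eventually_elim
      case (elim k)
      have "(\<integral>y. f y * f (y + k) \<partial>\<nu>) = (\<integral>y. f y \<partial>\<nu>)"
      proof (rule integral_cong_AE)
        show "AE y in \<nu>. f y * f (y + k) = f y" using keyK[OF elim] by eventually_elim (auto simp: f_def indicator_def)
        show "(\<lambda>y. f y * f (y + k)) \<in> borel_measurable \<nu>"
          using fm measurable_compose[OF tr_measurable_\<nu> fm] by (rule borel_measurable_times)
      qed (rule fm)
      then show ?case by (simp add: p_def)
    qed
    show "(\<lambda>k. \<integral>y. f y * f (y + k) \<partial>\<nu>) \<in> borel_measurable \<nu>"
      using borel_measurable_integrable[OF nn.integrable_snd[OF \<open>integrable (\<nu> \<Otimes>\<^sub>M \<nu>) (\<lambda>(y, k). f y * f (y + k))\<close>]] .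
  qed simp
  moreover have "(\<integral>y. (\<integral>k. f y * f (y + k) \<partial>\<nu>) \<partial>\<nu>) = (\<integral>y. f y * p \<partial>\<nu>)"
  proof (rule integral_cong_AE)
    show "AE y in \<nu>. (\<integral>k. f y * f (y + k) \<partial>\<nu>) = f y * p"
      using AE_K
    proof eventually_elim
      case (elim y)
      then show ?case using integral_tr_\<nu>[OF fm elim] by (simp add: p_def add.commute)
    qed
    show "(\<lambda>y. \<integral>k. f y * f (y + k) \<partial>\<nu>) \<in> borel_measurable \<nu>"
      using borel_measurable_integrable[OF nn.integrable_fst[OF \<open>integrable (\<nu> \<Otimes>\<^sub>M \<nu>) (\<lambda>(y, k). f y * f (y + k))\<close>]] .
    show "(\<lambda>y. f y * p) \<in> borel_measurable \<nu>" using fm by simp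
  qed
  ultimately have "p = p * p" using fub by (simp add: \<nu>.prob_space p_def)
  then have "p = 0 \<or> p = 1" by simp
  then show "emeasure \<nu> A = 0 \<or> emeasure \<nu> A = 1" by (auto simp: pA \<nu>.emeasure_eq_measure)
qed

text \<open>By density the translates of \<open>U\<close> by the countable group
  \<open>range \<omega>\<close> cover \<open>K\<close>, so a null \<open>U\<close> would make
  \<open>K\<close> null.\<close>

lemma \<nu>_nbhd_pos: assumes U: "open U" "0 \<in> U" shows "measure \<nu> U > 0"
proof (rule ccontr)
  assume "\<not> ?thesis"
  then have "measure \<nu> U = 0" using measure_nonneg[of \<nu> U] by linarith
  then have U0: "emeasure \<nu> U = 0" by (simp add: \<nu>.emeasure_eq_measure)
  have Ub: "U \<in> sets borel" using U by simp
  have tr: "emeasure \<nu> ((\<lambda>y. \<omega> g + y) ` U) = 0" for g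
    using haar_\<nu> \<omega>_K[of g] Ub U0 unfolding haar_on_def K_def[symmetric] by metis
  have trs: "(\<lambda>y. \<omega> g + y) ` U \<in> sets \<nu>" for g
  proof -
    have "(\<lambda>y. \<omega> g + y) ` U = (\<lambda>y. y + \<omega> (- g)) -` U" using vimage_tr[of "\<omega> (- g)" U] by (simp add: \<omega>_simps)
    then show ?thesis using open_vimage[OF U(1) cont_tr, of "\<omega> (- g)"] sets_\<nu> by simp
  qed
  have "K \<subseteq> (\<Union>g. (\<lambda>y. \<omega> g + y) ` U)"
  proof
    fix k assume "k \<in> K"
    then obtain g where g: "(\<lambda>n. \<omega> (g n)) \<longlonglongrightarrow> k" using K_seq by blast
    have "(\<lambda>n. k + - \<omega> (g n)) \<longlonglongrightarrow> k + - k" by (intro tendsto_add_pair tendsto_neg_pair g tendsto_const)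
    then have "(\<lambda>n. k - \<omega> (g n)) \<longlonglongrightarrow> 0" by simp
    then have "\<forall>\<^sub>F n in sequentially. k - \<omega> (g n) \<in> U" using U topological_tendstoD by blast
    then obtain n where n: "k - \<omega> (g n) \<in> U" by (auto simp: eventually_sequentially)
    have "k = \<omega> (g n) + (k - \<omega> (g n))" by simp
    then show "k \<in> (\<Union>g. (\<lambda>y. \<omega> g + y) ` U)" using n by blast
  qed
  then have "emeasure \<nu> K \<le> emeasure \<nu> (\<Union>g. (\<lambda>y. \<omega> g + y) ` U)"
    by (rule emeasure_mono) (use trs in auto)
  also have "\<dots> = 0"
    using null_sets_UN[of "\<lambda>g. (\<lambda>y. \<omega> g + y) ` U" \<nu>] tr trs by (simp add: null_sets_def)
  finally show False using haar_\<nu> by (simp add: haar_on_def K_def)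
qed

end

section \<open>Averages over rotations\<close>

context rot_pair
begin

definition pair_prod :: "('z \<Rightarrow> complex) \<Rightarrow> ('z \<Rightarrow> complex) \<Rightarrow> 'z \<Rightarrow> 'z \<times> 'z \<Rightarrow> complex" where
  "pair_prod g1 g2 z y = g1 (z + fst y) * g2 (z + snd y)"

definition haar_avg :: "('z \<Rightarrow> complex) \<Rightarrow> ('z \<Rightarrow> complex) \<Rightarrow> 'z \<Rightarrow> complex" where
  "haar_avg g1 g2 z = (\<integral>y. pair_prod g1 g2 z y \<partial>\<nu>)"

definition orbit_avg :: "'g set \<Rightarrow> ('z \<Rightarrow> complex) \<Rightarrow> ('z \<Rightarrow> complex) \<Rightarrow> 'z \<Rightarrow> 'z \<times> 'z \<Rightarrow> complex" where
  "orbit_avg E g1 g2 z y = (\<Sum>g\<in>E. pair_prod g1 g2 z (y + \<omega> g)) / of_nat (card E)"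

lemma add_measurable:
  "(\<lambda>p. fst p + fst (snd p)) \<in> measurable (m \<Otimes>\<^sub>M \<nu>) borel" "(\<lambda>p. fst p + snd (snd p)) \<in> measurable (m \<Otimes>\<^sub>M \<nu>) borel"
proof -
  have 1: "fst \<in> measurable (m \<Otimes>\<^sub>M \<nu>) borel" and 2: "snd \<in> measurable (m \<Otimes>\<^sub>M \<nu>) borel"
    using measurable_fst[of m \<nu>] measurable_snd[of m \<nu>] measurable_cong_sets[OF refl sets_m] measurable_cong_sets[OF refl sets_\<nu>] by blast+
  have 3: "(fst :: 'z \<times> 'z \<Rightarrow> 'z) \<in> measurable borel borel" "(snd :: 'z \<times> 'z \<Rightarrow> 'z) \<in> measurable borel borel"
    by (intro borel_measurable_continuous_onI continuous_intros)+
  have c: "continuous_on UNIV (\<lambda>p :: 'z \<times> 'z. fst p + snd p)" by (intro continuous_intros)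
  show "(\<lambda>p. fst p + fst (snd p)) \<in> measurable (m \<Otimes>\<^sub>M \<nu>) borel"
    using measurable_continuous_pair[OF cZ cZ c 1 measurable_compose[OF 2 3(1)]] by simp
  show "(\<lambda>p. fst p + snd (snd p)) \<in> measurable (m \<Otimes>\<^sub>M \<nu>) borel"
    using measurable_continuous_pair[OF cZ cZ c 1 measurable_compose[OF 2 3(2)]] by simp
qed

lemma pair_prod_measurable:
  assumes "g1 \<in> borel_measurable borel" "g2 \<in> borel_measurable borel"
  shows "(\<lambda>p. pair_prod g1 g2 (fst p) (snd p)) \<in> borel_measurable (m \<Otimes>\<^sub>M \<nu>)"
  unfolding pair_prod_def
  by (rule borel_measurable_times; rule measurable_compose[OF add_measurable(1) assms(1)] measurable_compose[OF add_measurable(2) assms(2)])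

lemma pair_prod_measurable1:
  assumes "g1 \<in> borel_measurable borel" "g2 \<in> borel_measurable borel"
  shows "(\<lambda>y. pair_prod g1 g2 z y) \<in> borel_measurable \<nu>"
  using measurable_Pair2[OF pair_prod_measurable[OF assms], of z] by (simp add: space_m)

lemma pair_prod_measurable2:
  assumes "g1 \<in> borel_measurable borel" "g2 \<in> borel_measurable borel"
  shows "(\<lambda>z. pair_prod g1 g2 z y) \<in> borel_measurable m"
  using measurable_Pair1[OF pair_prod_measurable[OF assms], of y] by (simp add: space_\<nu>)

lemma haar_avg_measurable:
  assumes "g1 \<in> borel_measurable borel" "g2 \<in> borel_measurable borel"
  shows "haar_avg g1 g2 \<in> borel_measurable m"
  unfolding haar_avg_def using pair_prod_measurable[OF assms]
  by (intro \<nu>.borel_measurable_lebesgue_integral) (simp add: case_prod_beta')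

lemma orbit_avg_measurable:
  assumes "g1 \<in> borel_measurable borel" "g2 \<in> borel_measurable borel"
  shows "(\<lambda>p. orbit_avg E g1 g2 (fst p) (snd p)) \<in> borel_measurable (m \<Otimes>\<^sub>M \<nu>)"
proof -
  have "(\<lambda>p. pair_prod g1 g2 (fst p) (snd p + k)) \<in> borel_measurable (m \<Otimes>\<^sub>M \<nu>)" for k
  proof -
    have "(\<lambda>p. (fst p, snd p + k)) \<in> measurable (m \<Otimes>\<^sub>M \<nu>) (m \<Otimes>\<^sub>M \<nu>)"
      by (intro measurable_Pair measurable_fst measurable_compose[OF measurable_snd tr_measurable_\<nu>])
    from measurable_compose[OF this pair_prod_measurable[OF assms]] show ?thesis by simp
  qed
  then show ?thesis unfolding orbit_avg_def by (intro borel_measurable_divide borel_measurable_sum) auto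
qed

context
  fixes g1 g2 :: "'z \<Rightarrow> complex" and C :: real
  assumes gm: "g1 \<in> borel_measurable borel" "g2 \<in> borel_measurable borel"
    and gC: "\<And>z. norm (g1 z) \<le> C" "\<And>z. norm (g2 z) \<le> C"
begin

lemma C_nonneg: "0 \<le> C" using gC(1) norm_ge_zero order_trans by blast

lemma pair_prod_bound: "norm (pair_prod g1 g2 z y) \<le> C * C"
  unfolding pair_prod_def norm_mult by (intro mult_mono gC C_nonneg) simp

lemma haar_avg_bound: "norm (haar_avg g1 g2 z) \<le> C * C"
proof -
  have "integrable \<nu> (pair_prod g1 g2 z)"
    by (rule \<nu>.integrable_const_bound[where B = "C * C"]) (use pair_prod_bound pair_prod_measurable1[OF gm] in auto)
  have "norm (haar_avg g1 g2 z) \<le> (\<integral>y. norm (pair_prod g1 g2 z y) \<partial>\<nu>)" unfolding haar_avg_def by (rule integral_norm_bound)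
  also have "\<dots> \<le> (\<integral>y. C * C \<partial>\<nu>)" by (intro integral_mono) (use \<open>integrable \<nu> (pair_prod g1 g2 z)\<close> pair_prod_bound in auto)
  finally show ?thesis by (simp add: \<nu>.prob_space)
qed

lemma orbit_avg_bound: assumes "finite E" "E \<noteq> {}" shows "norm (orbit_avg E g1 g2 z y) \<le> C * C"
proof -
  have "norm (\<Sum>g\<in>E. pair_prod g1 g2 z (y + \<omega> g)) \<le> real (card E) * (C * C)"
    by (intro order_trans[OF norm_sum] sum_bounded_above pair_prod_bound)
  then show ?thesis using assms by (simp add: orbit_avg_def norm_divide divide_le_eq card_gt_0_iff mult.commute)
qed

lemma diff_bound: assumes "finite E" "E \<noteq> {}" shows "norm (orbit_avg E g1 g2 z y - haar_avg g1 g2 z) \<le> 2 * (C * C)"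
  using norm_triangle_ineq4[of "orbit_avg E g1 g2 z y" "haar_avg g1 g2 z"] orbit_avg_bound[OF assms, of z y] haar_avg_bound[of z] by linarith

lemma diff_measurable: "(\<lambda>p. norm (orbit_avg E g1 g2 (fst p) (snd p) - haar_avg g1 g2 (fst p))) \<in> borel_measurable (m \<Otimes>\<^sub>M \<nu>)"
  by (rule measurable_compose[OF _ borel_measurable_norm])
    (intro borel_measurable_diff orbit_avg_measurable[OF gm] measurable_compose[OF measurable_fst haar_avg_measurable[OF gm]])

lemma diff_integrable_m: assumes "finite E" "E \<noteq> {}" shows "integrable m (\<lambda>z. norm (orbit_avg E g1 g2 z y - haar_avg g1 g2 z))"
proof (rule m.integrable_const_bound[where B = "2 * (C * C)"])
  show "(\<lambda>z. norm (orbit_avg E g1 g2 z y - haar_avg g1 g2 z)) \<in> borel_measurable m"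
    using measurable_Pair1[OF diff_measurable, of y E] by (simp add: space_\<nu>)
qed (use diff_bound[OF assms] in auto)

text \<open>With \<open>z\<close> fixed, the orbit average is an ergodic average of a bounded
  function of \<open>y\<close> alone, and ergodicity of \<open>\<nu>\<close> turns its limit into
  the integral.\<close>

lemma fibre_average:
  assumes F: "folner F"
  shows "(\<lambda>N. \<integral>y. norm (orbit_avg (F N) g1 g2 z y - haar_avg g1 g2 z) \<partial>\<nu>) \<longlonglongrightarrow> 0"
proof -
  interpret N: mp_system \<nu> T\<nu> by (rule mp_system.intro[OF mp_\<nu>])
  have H: "pair_prod g1 g2 z \<in> bfun \<nu>"
    by (rule bfunI[where C = "C * C"]) (use pair_prod_measurable1[OF gm] pair_prod_bound space_\<nu> in auto)
  let ?D = "\<lambda>N. N.L.avg (F N) (\<lambda>g. koop \<nu> T\<nu> g (pair_prod g1 g2 z)) - N.cst (\<integral>y. pair_prod g1 g2 z y \<partial>\<nu>)"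
  have lim: "(\<lambda>N. N.L.nrm (?D N)) \<longlonglongrightarrow> 0" by (rule N.mean_ergodic[OF ergodic_\<nu> folner_asymp_inv[OF F] H])
  have eq: "?D N y = orbit_avg (F N) g1 g2 z y - haar_avg g1 g2 z" for N y
    by (simp add: N.avg_apply koop_def N.cst_def space_\<nu> orbit_avg_def haar_avg_def T\<nu>_def)
  have DV: "?D N \<in> bfun \<nu>" for N using H by simp
  show ?thesis
  proof (rule null_squeeze[OF lim])
    show "(\<integral>y. norm (orbit_avg (F N) g1 g2 z y - haar_avg g1 g2 z) \<partial>\<nu>) \<le> N.L.nrm (?D N)" for N
      using N.l1_le_nrm[OF DV, of N] unfolding eq .
  qed simp
qed

text \<open>Moving the starting point from \<open>y\<close> to 0 translates the arguments of
  \<open>g1\<close> and \<open>g2\<close>. In L1 over \<open>z\<close> the cost of each term is the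
  same for all \<open>g\<close>, as the extra translation by \<open>\<omega> g\<close> is absorbed
  by invariance of \<open>m\<close>; hence the bound is uniform over the averaging sets.\<close>

lemma shift_bound:
  assumes E: "finite E" "E \<noteq> {}"
  shows "(\<integral>z. norm (orbit_avg E g1 g2 z 0 - haar_avg g1 g2 z) \<partial>m) \<le> (\<integral>z. norm (orbit_avg E g1 g2 z y - haar_avg g1 g2 z) \<partial>m) +
     C * ((\<integral>z. norm (g1 (z + fst y) - g1 z) \<partial>m) + (\<integral>z. norm (g2 (z + snd y) - g2 z) \<partial>m))"
proof -
  have gmm: "g1 \<in> borel_measurable m" "g2 \<in> borel_measurable m"
    using gm measurable_cong_sets[OF sets_m refl] by blast+
  have gtr: "(\<lambda>z. g (z + a)) \<in> borel_measurable m" if "g \<in> borel_measurable m" for g :: "'z \<Rightarrow> complex" and a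
    by (rule measurable_compose[OF tr_measurable_m that])
  have dm: "(\<lambda>z. norm (g (z + b) - g (z + a))) \<in> borel_measurable m" if "g \<in> {g1, g2}" for g a b
    using gtr gmm that by auto
  have di: "integrable m (\<lambda>z. norm (g (z + b) - g (z + a)))" if g: "g \<in> {g1, g2}" for g a b
  proof (rule m.integrable_const_bound[where B = "2 * C"])
    have "norm (g (z + b) - g (z + a)) \<le> 2 * C" for z
      using norm_triangle_ineq4[of "g (z + b)" "g (z + a)"] gC[of "z + b"] gC[of "z + a"] g by auto
    then show "AE z in m. norm (norm (g (z + b) - g (z + a))) \<le> 2 * C" by simp
  qed (rule dm[OF g])
  have tr: "(\<integral>z. norm (g (z + (a + b)) - g (z + a)) \<partial>m) = (\<integral>z. norm (g (z + b) - g z) \<partial>m)" if g: "g \<in> {g1, g2}" for g a b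
    using integral_tr_m[of "\<lambda>z. norm (g (z + b) - g z)" a] dm[OF g, of b 0] by (simp add: add.assoc)
  let ?t = "(\<integral>z. norm (g1 (z + fst y) - g1 z) \<partial>m) + (\<integral>z. norm (g2 (z + snd y) - g2 z) \<partial>m)"
  have Hi: "integrable m (\<lambda>z. norm (pair_prod g1 g2 z k - pair_prod g1 g2 z l))" for k l
  proof (rule m.integrable_const_bound[where B = "2 * (C * C)"])
    have "norm (pair_prod g1 g2 z k - pair_prod g1 g2 z l) \<le> 2 * (C * C)" for z
      using norm_triangle_ineq4[of "pair_prod g1 g2 z k" "pair_prod g1 g2 z l"] pair_prod_bound[of z k] pair_prod_bound[of z l] by linarith
    then show "AE z in m. norm (norm (pair_prod g1 g2 z k - pair_prod g1 g2 z l)) \<le> 2 * (C * C)" by simp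
    show "(\<lambda>z. norm (pair_prod g1 g2 z k - pair_prod g1 g2 z l)) \<in> borel_measurable m"
      by (rule measurable_compose[OF _ borel_measurable_norm]) (intro borel_measurable_diff pair_prod_measurable2 gm)
  qed
  have one: "(\<integral>z. norm (pair_prod g1 g2 z (\<omega> g) - pair_prod g1 g2 z (y + \<omega> g)) \<partial>m) \<le> C * ?t" for g
  proof -
    define a b where "a = fst (\<omega> g)" and "b = snd (\<omega> g)"
    have pt: "norm (pair_prod g1 g2 z (\<omega> g) - pair_prod g1 g2 z (y + \<omega> g)) \<le>
        C * norm (g1 (z + (a + fst y)) - g1 (z + a)) + C * norm (g2 (z + (b + snd y)) - g2 (z + b))" for z
    proof -
      let ?p = "g1 (z + a)" and ?q = "g2 (z + b)" and ?p' = "g1 (z + (a + fst y))" and ?q' = "g2 (z + (b + snd y))"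
      have "pair_prod g1 g2 z (\<omega> g) - pair_prod g1 g2 z (y + \<omega> g) = ?p * ?q - ?p' * ?q'"
        by (simp add: pair_prod_def a_def b_def add_ac)
      also have "\<dots> = - ((?p' - ?p) * ?q) - ?p' * (?q' - ?q)" by (simp add: algebra_simps)
      also have "norm \<dots> \<le> norm (?p' - ?p) * norm ?q + norm ?p' * norm (?q' - ?q)"
        using norm_triangle_ineq4[of "- ((?p' - ?p) * ?q)" "?p' * (?q' - ?q)"] by (simp add: norm_mult)
      also have "\<dots> \<le> norm (?p' - ?p) * C + C * norm (?q' - ?q)"
        by (intro add_mono mult_left_mono mult_right_mono gC) auto
      finally show ?thesis by (simp add: mult.commute)
    qed
    have "(\<integral>z. norm (pair_prod g1 g2 z (\<omega> g) - pair_prod g1 g2 z (y + \<omega> g)) \<partial>m) \<le>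
        (\<integral>z. C * norm (g1 (z + (a + fst y)) - g1 (z + a)) + C * norm (g2 (z + (b + snd y)) - g2 (z + b)) \<partial>m)"
      by (intro integral_mono Hi pt Bochner_Integration.integrable_add integrable_mult_right di) auto
    also have "\<dots> = C * ?t"
      using di[of g1 "a + fst y" a] di[of g2 "b + snd y" b] tr[of g1 a "fst y"] tr[of g2 b "snd y"] by (simp add: ring_distribs)
    finally show ?thesis .
  qed
  have cE: "real (card E) > 0" using E by (simp add: card_gt_0_iff)
  have pt2: "norm (orbit_avg E g1 g2 z 0 - haar_avg g1 g2 z) \<le> norm (orbit_avg E g1 g2 z y - haar_avg g1 g2 z) +
     (\<Sum>g\<in>E. norm (pair_prod g1 g2 z (\<omega> g) - pair_prod g1 g2 z (y + \<omega> g))) / real (card E)" for z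
  proof -
    have "norm (orbit_avg E g1 g2 z 0 - orbit_avg E g1 g2 z y) \<le> (\<Sum>g\<in>E. norm (pair_prod g1 g2 z (\<omega> g) - pair_prod g1 g2 z (y + \<omega> g))) / real (card E)"
    proof -
      have "orbit_avg E g1 g2 z 0 - orbit_avg E g1 g2 z y = (\<Sum>g\<in>E. pair_prod g1 g2 z (\<omega> g) - pair_prod g1 g2 z (y + \<omega> g)) / of_nat (card E)"
        by (simp add: orbit_avg_def sum_subtractf diff_divide_distrib)
      then show ?thesis by (simp add: norm_divide divide_right_mono norm_sum)
    qed
    moreover have "norm (orbit_avg E g1 g2 z 0 - haar_avg g1 g2 z) \<le> norm (orbit_avg E g1 g2 z y - haar_avg g1 g2 z) + norm (orbit_avg E g1 g2 z 0 - orbit_avg E g1 g2 z y)"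
      using norm_triangle_ineq[of "orbit_avg E g1 g2 z y - haar_avg g1 g2 z" "orbit_avg E g1 g2 z 0 - orbit_avg E g1 g2 z y"] by simp
    ultimately show ?thesis by linarith
  qed
  have si: "integrable m (\<lambda>z. (\<Sum>g\<in>E. norm (pair_prod g1 g2 z (\<omega> g) - pair_prod g1 g2 z (y + \<omega> g))) / real (card E))"
    by (intro integrable_divide Bochner_Integration.integrable_sum Hi)
  have "(\<integral>z. norm (orbit_avg E g1 g2 z 0 - haar_avg g1 g2 z) \<partial>m) \<le> (\<integral>z. norm (orbit_avg E g1 g2 z y - haar_avg g1 g2 z) +
     (\<Sum>g\<in>E. norm (pair_prod g1 g2 z (\<omega> g) - pair_prod g1 g2 z (y + \<omega> g))) / real (card E) \<partial>m)"
    by (intro integral_mono pt2 Bochner_Integration.integrable_add diff_integrable_m[OF E] si)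
  also have "\<dots> = (\<integral>z. norm (orbit_avg E g1 g2 z y - haar_avg g1 g2 z) \<partial>m) + (\<Sum>g\<in>E. (\<integral>z. norm (pair_prod g1 g2 z (\<omega> g) - pair_prod g1 g2 z (y + \<omega> g)) \<partial>m)) / real (card E)"
    using diff_integrable_m[OF E, of y] si Hi by (simp add: Bochner_Integration.integral_sum)
  also have "(\<Sum>g\<in>E. (\<integral>z. norm (pair_prod g1 g2 z (\<omega> g) - pair_prod g1 g2 z (y + \<omega> g)) \<partial>m)) / real (card E) \<le> C * ?t"
  proof -
    have "(\<Sum>g\<in>E. (\<integral>z. norm (pair_prod g1 g2 z (\<omega> g) - pair_prod g1 g2 z (y + \<omega> g)) \<partial>m)) \<le> real (card E) * (C * ?t)"
      by (rule sum_bounded_above) (rule one)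
    then show ?thesis using cE by (simp add: pos_divide_le_eq mult.commute)
  qed
  finally show ?thesis by simp
qed

text \<open>The error integrated over \<open>z\<close> and \<open>y\<close> tends to zero by
  \<open>fibre_average\<close> and dominated convergence. On a neighbourhood \<open>U\<close> of 0,
  of positive measure, \<open>shift_bound\<close> compares the error at 0 with that at
  \<open>y\<close>, so a large error at 0 would keep the double integral away from zero.\<close>

theorem average_at_zero_L1:
  assumes F: "folner F"
  shows "(\<lambda>N. \<integral>z. norm (orbit_avg (F N) g1 g2 z 0 - haar_avg g1 g2 z) \<partial>m) \<longlonglongrightarrow> 0"
proof -
  have fin: "finite (F N)" "F N \<noteq> {}" for N using F by (auto simp: folner_def)
  let ?d = "\<lambda>N z y. norm (orbit_avg (F N) g1 g2 z y - haar_avg g1 g2 z)"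
  have dm: "(\<lambda>(z, y). ?d N z y) \<in> borel_measurable (m \<Otimes>\<^sub>M \<nu>)" for N
    using diff_measurable[of "F N"] by (simp add: case_prod_beta')
  have dI: "integrable (m \<Otimes>\<^sub>M \<nu>) (\<lambda>(z, y). ?d N z y)" for N
    by (rule mn.P.integrable_const_bound[where B = "2 * (C * C)", OF _ dm]) (use diff_bound[OF fin] in auto)
  have d1: "integrable \<nu> (\<lambda>y. ?d N z y)" for N z
  proof (rule \<nu>.integrable_const_bound[where B = "2 * (C * C)"])
    show "(\<lambda>y. ?d N z y) \<in> borel_measurable \<nu>" using measurable_Pair2[OF diff_measurable, of z "F N"] by (simp add: space_m)
  qed (use diff_bound[OF fin] in auto)
  have "(\<lambda>N. \<integral>z. (\<integral>y. ?d N z y \<partial>\<nu>) \<partial>m) \<longlonglongrightarrow> (\<integral>z. 0 \<partial>m)"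
  proof (rule integral_dominated_convergence[where w = "\<lambda>_. 2 * (C * C)"])
    show "(\<lambda>z. \<integral>y. ?d N z y \<partial>\<nu>) \<in> borel_measurable m" for N
      using borel_measurable_integrable[OF mn.integrable_fst[OF dI]] .
    show "AE z in m. (\<lambda>N. \<integral>y. ?d N z y \<partial>\<nu>) \<longlonglongrightarrow> 0" using fibre_average[OF F] by simp
    show "AE z in m. norm (\<integral>y. ?d N z y \<partial>\<nu>) \<le> 2 * (C * C)" for N
    proof (rule AE_I2)
      fix z
      have "(\<integral>y. ?d N z y \<partial>\<nu>) \<le> (\<integral>y. 2 * (C * C) \<partial>\<nu>)" by (intro integral_mono d1) (use diff_bound[OF fin] in auto)
      then show "norm (\<integral>y. ?d N z y \<partial>\<nu>) \<le> 2 * (C * C)" by (simp add: \<nu>.prob_space)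
    qed
  qed auto
  then have lim: "(\<lambda>N. \<integral>y. (\<integral>z. ?d N z y \<partial>m) \<partial>\<nu>) \<longlonglongrightarrow> 0"
    using mn.Fubini_integral[OF dI] by simp
  have gi: "integrable m g1" "integrable m g2"
    using gC gm measurable_cong_sets[OF sets_m refl] by (auto intro!: m.integrable_const_bound[where B = C])
  show ?thesis
  proof (rule tendsto_0_le_approx)
    fix e :: real assume e: "e > 0"
    \<comment> \<open>Makes \<open>C * (\<eta> + \<eta>) \<le> e / 2\<close>; adding 1 to
      \<open>C\<close> avoids division by zero.\<close>
    define \<eta> where "\<eta> = e / 2 / (C + 1) / 2"
    have \<eta>: "\<eta> > 0" "C * (\<eta> + \<eta>) \<le> e / 2"
    proof -
      show "\<eta> > 0" using e C_nonneg by (simp add: \<eta>_def)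
      have "\<eta> + \<eta> = e / 2 / (C + 1)" unfolding \<eta>_def by (rule field_sum_of_halves)
      then have "C * (\<eta> + \<eta>) = e / 2 * (C / (C + 1))" by simp
      also have "\<dots> \<le> e / 2 * 1" by (intro mult_left_mono) (use e C_nonneg in auto)
      finally show "C * (\<eta> + \<eta>) \<le> e / 2" by simp
    qed
    obtain d1 where d1: "d1 > 0" "\<And>a. dist a 0 < d1 \<Longrightarrow> (\<integral>z. norm (g1 (z + a) - g1 z) \<partial>m) \<le> \<eta>"
      using L1_modulus[OF gi(1) \<eta>(1)] by blast
    obtain d2 where d2: "d2 > 0" "\<And>a. dist a 0 < d2 \<Longrightarrow> (\<integral>z. norm (g2 (z + a) - g2 z) \<partial>m) \<le> \<eta>"
      using L1_modulus[OF gi(2) \<eta>(1)] by blast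
    define U where "U = ball (0::'z) d1 \<times> ball (0::'z) d2"
    have "open U" unfolding U_def by (intro open_Times open_ball)
    moreover have "0 \<in> U" using d1 d2 by (simp add: U_def zero_prod_def)
    ultimately have mU: "measure \<nu> U > 0" by (rule \<nu>_nbhd_pos)
    have Us: "U \<in> sets \<nu>" using \<open>open U\<close> sets_\<nu> by simp
    have "\<forall>\<^sub>F N in sequentially. (\<integral>y. (\<integral>z. ?d N z y \<partial>m) \<partial>\<nu>) < e / 2 * measure \<nu> U"
      by (rule order_tendstoD(2)[OF lim]) (use e mU in simp)
    then show "\<forall>\<^sub>F N in sequentially. (\<integral>z. ?d N z 0 \<partial>m) \<le> e"
    proof eventually_elim
      case (elim N)
      let ?D = "\<lambda>y. \<integral>z. ?d N z y \<partial>m"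
      have Di: "integrable \<nu> ?D" by (rule mn.integrable_snd[OF dI])
      \<comment> \<open>On \<open>U\<close> this is the shift estimate, off \<open>U\<close>
        nonnegativity of the error. Integrating over \<open>y\<close> gives a Markov type bound for
        \<open>?D 0\<close>.\<close>
      have "indicator U y * (?D 0 - e / 2) \<le> ?D y" for y
      proof (cases "y \<in> U")
        case True
        then have "(\<integral>z. norm (g1 (z + fst y) - g1 z) \<partial>m) \<le> \<eta>" "(\<integral>z. norm (g2 (z + snd y) - g2 z) \<partial>m) \<le> \<eta>"
          by (auto simp: U_def mem_Times_iff dist_commute intro!: d1 d2)
        then have "C * ((\<integral>z. norm (g1 (z + fst y) - g1 z) \<partial>m) + (\<integral>z. norm (g2 (z + snd y) - g2 z) \<partial>m)) \<le> C * (\<eta> + \<eta>)"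
          by (intro mult_left_mono add_mono C_nonneg)
        then show ?thesis using shift_bound[OF fin, of N y] \<eta>(2) True by simp
      next
        case False
        then show ?thesis by simp
      qed
      then have "(\<integral>y. indicator U y * (?D 0 - e / 2) \<partial>\<nu>) \<le> (\<integral>y. ?D y \<partial>\<nu>)"
        by (intro integral_mono Di integrable_mult_left integrable_real_indicator Us) (auto simp: \<nu>.emeasure_eq_measure)
      then have "measure \<nu> U * (?D 0 - e / 2) \<le> (\<integral>y. ?D y \<partial>\<nu>)" using Us by simp
      also have "\<dots> < measure \<nu> U * (e / 2)" using elim by (simp add: mult.commute)
      finally have "?D 0 - e / 2 < e / 2" using mU by simp
      then show ?case by simp
    qed
  qed simp
qed

text \<open>The differences are bounded by \<open>2 * (C * C)\<close>, so their squares are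
  dominated by a multiple of the L1 error.\<close>

theorem average_at_zero_L2:
  assumes F: "folner F"
  shows "(\<lambda>N. \<integral>z. (norm (orbit_avg (F N) g1 g2 z 0 - haar_avg g1 g2 z))\<^sup>2 \<partial>m) \<longlonglongrightarrow> 0"
proof (rule null_squeeze)
  have fin: "finite (F N)" "F N \<noteq> {}" for N using F by (auto simp: folner_def)
  have "(\<lambda>N. (2 * (C * C)) * (\<integral>z. norm (orbit_avg (F N) g1 g2 z 0 - haar_avg g1 g2 z) \<partial>m)) \<longlonglongrightarrow> (2 * (C * C)) * 0"
    by (intro tendsto_intros average_at_zero_L1 F)
  then show "(\<lambda>N. (2 * (C * C)) * (\<integral>z. norm (orbit_avg (F N) g1 g2 z 0 - haar_avg g1 g2 z) \<partial>m)) \<longlonglongrightarrow> 0" by simp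
  show "(\<integral>z. (norm (orbit_avg (F N) g1 g2 z 0 - haar_avg g1 g2 z))\<^sup>2 \<partial>m) \<le> (2 * (C * C)) * (\<integral>z. norm (orbit_avg (F N) g1 g2 z 0 - haar_avg g1 g2 z) \<partial>m)" for N
  proof -
    let ?f = "\<lambda>z. norm (orbit_avg (F N) g1 g2 z 0 - haar_avg g1 g2 z)"
    have i: "integrable m ?f" by (rule diff_integrable_m[OF fin])
    have le: "(?f z)\<^sup>2 \<le> (2 * (C * C)) * ?f z" for z
      unfolding power2_eq_square by (intro mult_right_mono diff_bound[OF fin]) simp
    have fm: "(\<lambda>z. (?f z)\<^sup>2) \<in> borel_measurable m" using borel_measurable_integrable[OF i] by (rule borel_measurable_power)
    have "integrable m (\<lambda>z. (?f z)\<^sup>2)"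
      by (rule Bochner_Integration.integrable_bound[OF integrable_mult_right[OF i, of "2 * (C * C)"] fm]) (use le in auto)
    then have "(\<integral>z. (?f z)\<^sup>2 \<partial>m) \<le> (\<integral>z. (2 * (C * C)) * ?f z \<partial>m)"
      by (intro integral_mono le integrable_mult_right i)
    then show ?thesis by simp
  qed
qed simp

end

text \<open>For each fixed \<open>y\<close> the equality holds for almost every \<open>z\<close>, as
  translations preserve \<open>m\<close>; exchanging the two quantifiers is Fubini for null sets,
  with \<open>add_measurable\<close> providing joint measurability.\<close>

lemma AE_shift:
  fixes ft g :: "'z \<Rightarrow> complex"
  assumes "AE z in m. ft z = g z" "ft \<in> borel_measurable borel" "g \<in> borel_measurable borel"
  shows "AE z in m. AE y in \<nu>. ft (z + fst y) = g (z + fst y)" "AE z in m. AE y in \<nu>. ft (z + snd y) = g (z + snd y)"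
    "AE z in m. ft (z + a) = g (z + a)"
proof -
  show tr: "AE z in m. ft (z + a) = g (z + a)" for a
    by (rule AE_distrD[where M' = m, OF tr_measurable_m]) (subst distr_m, rule assms(1))
  have ms: "{z. ft z = g z} \<in> sets borel" using assms(2,3) by measurable
  have "(AE z in m. AE y in \<nu>. ft (z + fst y) = g (z + fst y)) = (AE y in \<nu>. AE z in m. ft (z + fst y) = g (z + fst y))"
  proof (rule mn.AE_commute)
    show "{x \<in> space (m \<Otimes>\<^sub>M \<nu>). ft (fst x + fst (snd x)) = g (fst x + fst (snd x))} \<in> sets (m \<Otimes>\<^sub>M \<nu>)"
      using measurable_sets[OF add_measurable(1) ms] by (simp add: vimage_def Int_def conj_commute)
  qed
  then show "AE z in m. AE y in \<nu>. ft (z + fst y) = g (z + fst y)" using tr by simp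
  have "(AE z in m. AE y in \<nu>. ft (z + snd y) = g (z + snd y)) = (AE y in \<nu>. AE z in m. ft (z + snd y) = g (z + snd y))"
  proof (rule mn.AE_commute)
    show "{x \<in> space (m \<Otimes>\<^sub>M \<nu>). ft (fst x + snd (snd x)) = g (fst x + snd (snd x))} \<in> sets (m \<Otimes>\<^sub>M \<nu>)"
      using measurable_sets[OF add_measurable(2) ms] by (simp add: vimage_def Int_def conj_commute)
  qed
  then show "AE z in m. AE y in \<nu>. ft (z + snd y) = g (z + snd y)" using tr by simp
qed

lemma AE_haar_avg:
  assumes "AE z in m. ft1 z = g1 z" "AE z in m. ft2 z = g2 z"
    and meas: "ft1 \<in> borel_measurable borel" "ft2 \<in> borel_measurable borel" "g1 \<in> borel_measurable borel" "g2 \<in> borel_measurable borel"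
  shows "AE z in m. (\<integral>w. ft1 (z + fst w) * ft2 (z + snd w) \<partial>\<nu>) = haar_avg g1 g2 z"
  using AE_shift(1)[OF assms(1) meas(1,3)] AE_shift(2)[OF assms(2) meas(2,4)]
proof eventually_elim
  case (elim z)
  have "(\<integral>w. pair_prod ft1 ft2 z w \<partial>\<nu>) = (\<integral>w. pair_prod g1 g2 z w \<partial>\<nu>)"
  proof (rule integral_cong_AE)
    show "AE w in \<nu>. pair_prod ft1 ft2 z w = pair_prod g1 g2 z w" using elim by eventually_elim (simp add: pair_prod_def)
  qed (intro pair_prod_measurable1 meas)+
  then show ?case by (simp add: haar_avg_def pair_prod_def)
qed

end

section \<open>The main theorem\<close>

lemma Linfty_bfun:
  assumes "Linfty M f" shows "\<exists>f'\<in>bfun M. AE x in M. f x = f' x"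
proof -
  obtain C where C: "AE x in M. norm (f x) \<le> C" and fm [measurable]: "f \<in> borel_measurable M"
    using assms by (auto simp: Linfty_def)
  define f' where "f' = (\<lambda>x. if x \<in> space M then (if norm (f x) \<le> C then f x else 0) else 0)"
  have "(\<lambda>x. if norm (f x) \<le> C then f x else 0) \<in> borel_measurable M" by measurable
  then have "f' \<in> borel_measurable M" by (rule measurable_cong[THEN iffD1, rotated]) (simp add: f'_def)
  then have "f' \<in> bfun M" by (rule bfunI[where C = "max C 0"]) (auto simp: f'_def)
  moreover have "AE x in M. f x = f' x" using C AE_space by eventually_elim (simp add: f'_def)
  ultimately show ?thesis by blast
qed

text \<open>A function whose means over all sets of positive measure lie in a closed ball takes its
  values there almost everywhere. The means of \<open>ft\<close> are means of \<open>f\<close> over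
  preimages, hence bounded by \<open>C\<close>.\<close>

lemma cond_exp_bounded:
  fixes \<pi> :: "'a \<Rightarrow> 'z::topological_space"
  assumes M: "prob_space M" and \<pi>: "\<pi> \<in> measurable M borel" and m: "distr M borel \<pi> = m"
    and f: "Linfty M f" and ft: "cond_exp_on_factor M \<pi> f ft"
  shows "\<exists>g C. g \<in> borel_measurable borel \<and> (\<forall>z. norm (g z) \<le> C) \<and> (AE z in m. ft z = g z)"
proof -
  interpret M: prob_space M by (rule M)
  interpret m: prob_space m unfolding m[symmetric] by (rule M.prob_space_distr[OF \<pi>])
  have sm: "sets m = sets borel" using m by auto
  obtain C where C: "AE x in M. norm (f x) \<le> C" and fm [measurable]: "f \<in> borel_measurable M"
    using f by (auto simp: Linfty_def)
  have ftm: "ft \<in> borel_measurable borel" and fti: "integrable M (\<lambda>x. ft (\<pi> x))"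
    and fteq: "\<And>A. A \<in> sets borel \<Longrightarrow> (LINT x:(\<pi> -` A \<inter> space M)|M. f x) = (LINT x:(\<pi> -` A \<inter> space M)|M. ft (\<pi> x))"
    using ft by (auto simp: cond_exp_on_factor_def)
  have im: "integrable m ft" unfolding m[symmetric] using integrable_distr_eq[OF \<pi> ftm] fti by simp
  have "AE z in m. ft z \<in> cball 0 C"
  proof (rule m.averaging_theorem[OF im closed_cball])
    fix A assume A: "A \<in> sets m" and pos: "measure m A > 0"
    have Ab: "A \<in> sets borel" using A sm by simp
    let ?B = "\<pi> -` A \<inter> space M"
    have B: "?B \<in> sets M" by (rule measurable_sets[OF \<pi> Ab])
    have mB: "measure m A = measure M ?B" unfolding m[symmetric] by (rule measure_distr[OF \<pi> Ab])
    have "set_lebesgue_integral m A ft = (\<integral>x. indicator A (\<pi> x) *\<^sub>R ft (\<pi> x) \<partial>M)"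
      unfolding m[symmetric] set_lebesgue_integral_def
      by (rule integral_distr[OF \<pi>]) (use ftm Ab in measurable)
    also have "\<dots> = (LINT x:?B|M. ft (\<pi> x))"
      unfolding set_lebesgue_integral_def by (rule Bochner_Integration.integral_cong) (auto simp: indicator_def)
    also have "\<dots> = (LINT x:?B|M. f x)" using fteq[OF Ab] by simp
    finally have eq: "set_lebesgue_integral m A ft = (\<integral>x. indicator ?B x *\<^sub>R f x \<partial>M)" by (simp add: set_lebesgue_integral_def)
    have iB: "integrable M (\<lambda>x. indicator ?B x * C)"
      by (intro integrable_mult_left integrable_real_indicator B) (simp add: M.emeasure_eq_measure)
    have ae: "AE x in M. norm (indicator ?B x *\<^sub>R f x) \<le> indicator ?B x * C"
      using C by eventually_elim (auto simp: indicator_def)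
    have "integrable M (\<lambda>x. indicator ?B x *\<^sub>R f x)"
    proof (rule Bochner_Integration.integrable_bound[OF iB])
      show "(\<lambda>x. indicator ?B x *\<^sub>R f x) \<in> borel_measurable M" using B by measurable
      show "AE x in M. norm (indicator ?B x *\<^sub>R f x) \<le> norm (indicator ?B x * C)" using ae by eventually_elim auto
    qed
    then have "norm (\<integral>x. indicator ?B x *\<^sub>R f x \<partial>M) \<le> (\<integral>x. indicator ?B x * C \<partial>M)"
      by (intro order_trans[OF integral_norm_bound] integral_mono_AE integrable_norm iB ae)
    also have "\<dots> = measure m A * C" using B mB by simp
    finally have "norm (set_lebesgue_integral m A ft) \<le> measure m A * C" unfolding eq .
    then show "(1 / measure m A) *\<^sub>R set_lebesgue_integral m A ft \<in> cball 0 C"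
      using pos by (simp add: pos_divide_le_eq mult.commute)
  qed
  then have ae: "AE z in m. norm (ft z) \<le> C" by simp
  define g where "g = (\<lambda>z. if norm (ft z) \<le> C then ft z else 0)"
  have "g \<in> borel_measurable borel" unfolding g_def using ftm by measurable
  moreover have "norm (g z) \<le> max C 0" for z by (auto simp: g_def)
  moreover have "AE z in m. ft z = g z" using ae by eventually_elim (simp add: g_def)
  ultimately show ?thesis by blast
qed

context mp_system
begin

lemma cond_exp_null:
  assumes \<pi>: "\<pi> \<in> measurable M borel" and ff: "f' \<in> bfun M" "AE x in M. f x = f' x" "f \<in> borel_measurable M"
    and ft: "cond_exp_on_factor M \<pi> f ft" and a: "a \<in> bfun M" "AE x in M. ft (\<pi> x) = a x" and A: "A \<in> sets borel"
  shows "(LINT x:(\<pi> -` A \<inter> space M)|M. (f' - a) x) = 0"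
proof -
  let ?B = "\<pi> -` A \<inter> space M"
  have B [measurable]: "?B \<in> sets M" by (rule measurable_sets[OF \<pi> A])
  have ftm: "(\<lambda>x. ft (\<pi> x)) \<in> borel_measurable M" and fteq: "(LINT x:?B|M. f x) = (LINT x:?B|M. ft (\<pi> x))"
    using ft A by (auto simp: cond_exp_on_factor_def)
  have [measurable]: "f' \<in> borel_measurable M" "a \<in> borel_measurable M" "f \<in> borel_measurable M" "(\<lambda>x. ft (\<pi> x)) \<in> borel_measurable M"
    using ff a ftm by (auto simp: bfun_def)
  have i: "integrable M (\<lambda>x. indicator ?B x *\<^sub>R u x)" if "u \<in> bfun M" for u :: "'a \<Rightarrow> complex"
    using integrable_mult_indicator[OF B bfun_integrable[OF that]] .
  have "(LINT x:?B|M. (f' - a) x) = (LINT x:?B|M. f' x) - (LINT x:?B|M. a x)"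
    using i[OF ff(1)] i[OF a(1)] by (simp add: set_lebesgue_integral_def scaleR_diff_right)
  also have "(LINT x:?B|M. f' x) = (LINT x:?B|M. f x)"
    unfolding set_lebesgue_integral_def
  proof (rule integral_cong_AE)
    show "AE x in M. indicator ?B x *\<^sub>R f' x = indicator ?B x *\<^sub>R f x" using ff(2) by eventually_elim simp
  qed measurable
  also have "(LINT x:?B|M. a x) = (LINT x:?B|M. ft (\<pi> x))"
    unfolding set_lebesgue_integral_def
  proof (rule integral_cong_AE)
    show "AE x in M. indicator ?B x *\<^sub>R a x = indicator ?B x *\<^sub>R ft (\<pi> x)" using a(2) by eventually_elim simp
  qed measurable
  finally show ?thesis using fteq by simp
qed

text \<open>Telescoping \<open>f1 * f2 - a1 * a2\<close> into
  \<open>(f1 - a1) * f2 + a1 * (f2 - a2)\<close> gives each term one factor orthogonal to the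
  eigenfunctions. The correlations used are along \<phi> for the first term and along \<psi> for the
  second, which is where their images need finite index; the index of the difference enters through
  \<open>weak_mixing_average\<close>.\<close>

theorem characteristic_factor:
  fixes \<phi> \<psi> :: "'g \<Rightarrow> 'g"
  assumes erg: "ergodic_action M T" and kron: "kronecker_factor M T m \<alpha> \<pi>"
    and hom: "additive_hom \<phi>" "additive_hom \<psi>"
    and fi: "finite_index (range \<phi>)" "finite_index (range \<psi>)" "finite_index (range (\<lambda>g. \<psi> g - \<phi> g))"
    and F: "folner F" and f: "f1 \<in> bfun M" "f2 \<in> bfun M" and a: "a1 \<in> bfun M" "a2 \<in> bfun M"
    and n1: "\<And>A. A \<in> sets borel \<Longrightarrow> (LINT x:(\<pi> -` A \<inter> space M)|M. (f1 - a1) x) = 0"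
    and n2: "\<And>A. A \<in> sets borel \<Longrightarrow> (LINT x:(\<pi> -` A \<inter> space M)|M. (f2 - a2) x) = 0"
  shows "(\<lambda>N. L.nrm (L.avg (F N) (\<lambda>g. koop M T (\<phi> g) f1 * koop M T (\<psi> g) f2) -
                    L.avg (F N) (\<lambda>g. koop M T (\<phi> g) a1 * koop M T (\<psi> g) a2))) \<longlonglongrightarrow> 0"
proof -
  have b: "f1 - a1 \<in> bfun M" "f2 - a2 \<in> bfun M" using f a by auto
  have c1: "(\<lambda>N. corr (F N) \<phi> (f1 - a1)) \<longlonglongrightarrow> 0"
    by (rule corr_null[OF F hom(1) fi(1) b(1)]) (rule eigenfunction_orthogonal[OF erg kron b(1) n1])
  have c2: "(\<lambda>N. corr (F N) \<psi> (f2 - a2)) \<longlonglongrightarrow> 0"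
    by (rule corr_null[OF F hom(2) fi(2) b(2)]) (rule eigenfunction_orthogonal[OF erg kron b(2) n2])
  let ?p = "\<lambda>N. L.avg (F N) (\<lambda>g. koop M T (\<phi> g) (f1 - a1) * koop M T (\<psi> g) f2)"
  let ?q = "\<lambda>N. L.avg (F N) (\<lambda>g. koop M T (\<phi> g) a1 * koop M T (\<psi> g) (f2 - a2))"
  have l1: "(\<lambda>N. L.nrm (?p N)) \<longlonglongrightarrow> 0" by (rule weak_mixing_average[OF erg F hom fi(3) b(1) f(2)]) (use c1 in simp)
  have l2: "(\<lambda>N. L.nrm (?q N)) \<longlonglongrightarrow> 0" by (rule weak_mixing_average[OF erg F hom fi(3) a(1) b(2)]) (use c2 in simp)
  have pV: "?p N \<in> bfun M" and qV: "?q N \<in> bfun M" for N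
    using f a b by (auto intro!: L.avg_V bfun_mult)
  have "(\<lambda>N. L.nrm (?p N) + L.nrm (?q N)) \<longlonglongrightarrow> 0" using tendsto_add[OF l1 l2] by simp
  then show ?thesis
  proof (rule null_squeeze)
    fix N
    have "L.avg (F N) (\<lambda>g. koop M T (\<phi> g) f1 * koop M T (\<psi> g) f2) - L.avg (F N) (\<lambda>g. koop M T (\<phi> g) a1 * koop M T (\<psi> g) a2) = ?p N + ?q N"
    proof -
      have "koop M T k f1 * koop M T l f2 - koop M T k a1 * koop M T l a2 =
          koop M T k (f1 - a1) * koop M T l f2 + koop M T k a1 * koop M T l (f2 - a2)" for k l
        by (rule ext) (simp add: koop_def algebra_simps)
      then show ?thesis by (simp add: L.avg_diff) (simp add: L.avg_def sum.distrib L.scale_right_distrib)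
    qed
    then show "L.nrm (L.avg (F N) (\<lambda>g. koop M T (\<phi> g) f1 * koop M T (\<psi> g) f2) - L.avg (F N) (\<lambda>g. koop M T (\<phi> g) a1 * koop M T (\<psi> g) a2))
      \<le> L.nrm (?p N) + L.nrm (?q N)"
      using L.nrm_triangle[OF pV qV] by simp
    show "0 \<le> L.nrm (L.avg (F N) (\<lambda>g. koop M T (\<phi> g) f1 * koop M T (\<psi> g) f2) - L.avg (F N) (\<lambda>g. koop M T (\<phi> g) a1 * koop M T (\<psi> g) a2))"
      using f a by (intro L.nrm_nonneg L.V_closed L.avg_V bfun_mult) auto
  qed
qed

end

theorem theorem3p1:
  fixes M :: "'a measure"
    and T :: "'g::{countable,ab_group_add} \<Rightarrow> 'a \<Rightarrow> 'a"
    and m :: "'z::{topological_ab_group_add,metric_space} measure"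
    and \<alpha> :: "'g \<Rightarrow> 'z"
    and \<pi> :: "'a \<Rightarrow> 'z"
    and \<phi> \<psi> :: "'g \<Rightarrow> 'g"
    and \<nu> :: "('z \<times> 'z) measure"
    and f1 f2 :: "'a \<Rightarrow> complex"
    and ft1 ft2 :: "'z \<Rightarrow> complex"
  assumes erg: "ergodic_action M T"
    and kron: "kronecker_factor M T m \<alpha> \<pi>"
    and hom_phi: "additive_hom \<phi>" and hom_psi: "additive_hom \<psi>"
    and fi_phi: "finite_index (range \<phi>)"
    and fi_psi: "finite_index (range \<psi>)"
    and fi_diff: "finite_index (range (\<lambda>g. \<psi> g - \<phi> g))"
    and haar: "haar_on (closure (range (\<lambda>g. (\<alpha> (\<phi> g), \<alpha> (\<psi> g))))) \<nu>"
    and f1: "Linfty M f1" and f2: "Linfty M f2"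
    and ft1: "cond_exp_on_factor M \<pi> f1 ft1"
    and ft2: "cond_exp_on_factor M \<pi> f2 ft2"
  shows "UC_lim M (\<lambda>g x. f1 (T (\<phi> g) x) * f2 (T (\<psi> g) x))
           (\<lambda>x. \<integral>w. ft1 (\<pi> x + fst w) * ft2 (\<pi> x + snd w) \<partial>\<nu>)
       \<and> UC_lim m (\<lambda>g z. ft1 (z + \<alpha> (\<phi> g)) * ft2 (z + \<alpha> (\<psi> g)))
           (\<lambda>z. \<integral>w. ft1 (z + fst w) * ft2 (z + snd w) \<partial>\<nu>)"
proof -
  interpret S: mp_system M T using erg by (intro mp_system.intro) (simp add: ergodic_action_def)
  have rot: "rotation_factor M T m \<alpha> \<pi>" using kron by (simp add: kronecker_factor_def)
  then have cZ: "compact (UNIV :: 'z set)" and haar_m: "haar_on UNIV m" and hom_\<alpha>: "additive_hom \<alpha>"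
    and \<pi>: "\<pi> \<in> measurable M borel" and dm: "distr M borel \<pi> = m"
    and equi: "\<And>g. AE x in M. \<pi> (T g x) = \<pi> x + \<alpha> g"
    by (auto simp: rotation_factor_def)
  let ?\<omega> = "\<lambda>g. (\<alpha> (\<phi> g), \<alpha> (\<psi> g))"
  interpret R: rot_pair m ?\<omega> \<nu>
    by (unfold_locales) (use cZ haar_m haar hom_\<alpha> hom_phi hom_psi in \<open>auto simp: additive_hom_def\<close>)
  have pM: "prob_space M" by (rule S.prob_space_axioms)
  \<comment> \<open>The estimates on the compact group need functions bounded at every point; the
    given versions of the conditional expectations are bounded only almost everywhere.\<close>
  obtain g1 C1 where g1: "g1 \<in> borel_measurable borel" "\<forall>z. norm (g1 z) \<le> C1" "AE z in m. ft1 z = g1 z"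
    using cond_exp_bounded[OF pM \<pi> dm f1 ft1] by blast
  obtain g2 C2 where g2: "g2 \<in> borel_measurable borel" "\<forall>z. norm (g2 z) \<le> C2" "AE z in m. ft2 z = g2 z"
    using cond_exp_bounded[OF pM \<pi> dm f2 ft2] by blast
  define C where "C = max C1 C2"
  have gC: "norm (g1 z) \<le> C" "norm (g2 z) \<le> C" for z using g1(2) g2(2) by (auto simp: C_def intro: le_max_iff_disj[THEN iffD2])
  have ftm: "ft1 \<in> borel_measurable borel" "ft2 \<in> borel_measurable borel"
    using ft1 ft2 by (auto simp: cond_exp_on_factor_def)
  note L2 = R.average_at_zero_L2[OF g1(1) g2(1) gC]
  note vI = R.AE_haar_avg[OF g1(3) g2(3) ftm g1(1) g2(1)]
  let ?A = "\<lambda>F N z. R.orbit_avg (F N) g1 g2 z 0"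
  let ?I = "R.haar_avg g1 g2"
  have orbit_avg_0: "R.orbit_avg E g1 g2 z 0 = (\<Sum>g\<in>E. g1 (z + \<alpha> (\<phi> g)) * g2 (z + \<alpha> (\<psi> g))) / of_nat (card E)" for E z
    by (simp add: R.orbit_avg_def R.pair_prod_def)
  have \<pi>m: "\<pi> \<in> measurable M m" using \<pi> measurable_cong_sets[OF refl R.sets_m] by blast
  have dm': "distr M m \<pi> = m" using dm distr_cong[OF refl R.sets_m, of M \<pi> \<pi>] by simp
  have AEpi: "AE x in M. P (\<pi> x)" if "AE z in m. P z" for P
    by (rule AE_distrD[OF \<pi>m]) (subst dm', rule that)
  have Am: "(\<lambda>z. R.orbit_avg E g1 g2 z 0) \<in> borel_measurable m" for E
    using measurable_Pair1[OF R.orbit_avg_measurable[OF g1(1) g2(1)], of 0] by (simp add: R.space_\<nu>)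
  have Im: "?I \<in> borel_measurable m" by (rule R.haar_avg_measurable[OF g1(1) g2(1)])
  have sqm: "(\<lambda>z. (norm (R.orbit_avg E g1 g2 z 0 - ?I z))\<^sup>2) \<in> borel_measurable m" for E
    using Am[of E] Im by measurable
  have sqi: "integrable m (\<lambda>z. (norm (R.orbit_avg E g1 g2 z 0 - ?I z))\<^sup>2)" if E: "finite E" "E \<noteq> {}" for E
  proof (rule R.m.integrable_const_bound[where B = "(2 * (C * C))\<^sup>2", OF _ sqm])
    have "(norm (R.orbit_avg E g1 g2 z 0 - ?I z))\<^sup>2 \<le> (2 * (C * C))\<^sup>2" for z
      by (intro power_mono R.diff_bound[OF g1(1) g2(1) gC E]) simp
    then show "AE z in m. norm ((norm (R.orbit_avg E g1 g2 z 0 - ?I z))\<^sup>2) \<le> (2 * (C * C))\<^sup>2"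
      by (intro AE_I2) (simp only: real_norm_def abs_power2)
  qed
  have fin: "finite (F N)" "F N \<noteq> {}" if "folner F" for F :: "nat \<Rightarrow> 'g set" and N
    using that by (auto simp: folner_def)
  have part2: "UC_lim m (\<lambda>g z. ft1 (z + \<alpha> (\<phi> g)) * ft2 (z + \<alpha> (\<psi> g))) (\<lambda>z. \<integral>w. ft1 (z + fst w) * ft2 (z + snd w) \<partial>\<nu>)"
    unfolding UC_lim_def L2_tendsto_def
  proof (intro allI impI)
    fix F :: "nat \<Rightarrow> 'g set" assume F: "folner F"
    have eq: "(\<integral>\<^sup>+ z. ennreal ((norm ((\<Sum>g\<in>F N. ft1 (z + \<alpha> (\<phi> g)) * ft2 (z + \<alpha> (\<psi> g))) / of_nat (card (F N)) -
        (\<integral>w. ft1 (z + fst w) * ft2 (z + snd w) \<partial>\<nu>)))\<^sup>2) \<partial>m) = ennreal (\<integral>z. (norm (?A F N z - ?I z))\<^sup>2 \<partial>m)" for N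
    proof -
      have "AE z in m. \<forall>g\<in>F N. ft1 (z + \<alpha> (\<phi> g)) = g1 (z + \<alpha> (\<phi> g)) \<and> ft2 (z + \<alpha> (\<psi> g)) = g2 (z + \<alpha> (\<psi> g))"
        using R.AE_shift(3)[OF g1(3) ftm(1) g1(1)] R.AE_shift(3)[OF g2(3) ftm(2) g2(1)]
        by (subst AE_finite_all[OF fin(1)[OF F]]) auto
      then have "AE z in m. ennreal ((norm ((\<Sum>g\<in>F N. ft1 (z + \<alpha> (\<phi> g)) * ft2 (z + \<alpha> (\<psi> g))) / of_nat (card (F N)) -
        (\<integral>w. ft1 (z + fst w) * ft2 (z + snd w) \<partial>\<nu>)))\<^sup>2) = ennreal ((norm (?A F N z - ?I z))\<^sup>2)"
        using vI by eventually_elim (simp add: orbit_avg_0)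
      then have "(\<integral>\<^sup>+ z. ennreal ((norm ((\<Sum>g\<in>F N. ft1 (z + \<alpha> (\<phi> g)) * ft2 (z + \<alpha> (\<psi> g))) / of_nat (card (F N)) -
        (\<integral>w. ft1 (z + fst w) * ft2 (z + snd w) \<partial>\<nu>)))\<^sup>2) \<partial>m) = (\<integral>\<^sup>+ z. ennreal ((norm (?A F N z - ?I z))\<^sup>2) \<partial>m)"
        by (rule nn_integral_cong_AE)
      also have "\<dots> = ennreal (\<integral>z. (norm (?A F N z - ?I z))\<^sup>2 \<partial>m)"
        by (rule nn_integral_eq_integral[OF sqi[OF fin[OF F]]]) simp
      finally show ?thesis .
    qed
    show "(\<lambda>N. \<integral>\<^sup>+ z. ennreal ((norm ((\<Sum>g\<in>F N. ft1 (z + \<alpha> (\<phi> g)) * ft2 (z + \<alpha> (\<psi> g))) / of_nat (card (F N)) -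
        (\<integral>w. ft1 (z + fst w) * ft2 (z + snd w) \<partial>\<nu>)))\<^sup>2) \<partial>m) \<longlonglongrightarrow> 0"
      unfolding eq using tendsto_ennrealI[OF L2[OF F]] by simp
  qed
  obtain h1 where h1: "h1 \<in> bfun M" "AE x in M. f1 x = h1 x" using Linfty_bfun[OF f1] by blast
  obtain h2 where h2: "h2 \<in> bfun M" "AE x in M. f2 x = h2 x" using Linfty_bfun[OF f2] by blast
  \<comment> \<open>The conditional expectation lifted back to the system, in the bounded form that
    vanishes off the space.\<close>
  define a1 where "a1 = (\<lambda>x. if x \<in> space M then g1 (\<pi> x) else 0)"
  define a2 where "a2 = (\<lambda>x. if x \<in> space M then g2 (\<pi> x) else 0)"
  have restr: "(\<lambda>x. if x \<in> space M then q (\<pi> x) else 0) \<in> bfun M"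
    if q: "q \<in> borel_measurable m" "\<And>z. norm (q z) \<le> D" for q :: "'z \<Rightarrow> complex" and D
  proof (rule bfunI[where C = "max D 0"])
    show "(\<lambda>x. if x \<in> space M then q (\<pi> x) else 0) \<in> borel_measurable M"
      by (rule measurable_cong[THEN iffD1, OF _ measurable_compose[OF \<pi>m q(1)]]) simp
  qed (use q(2) in \<open>auto simp: le_max_iff_disj\<close>)
  have gmm: "g1 \<in> borel_measurable m" "g2 \<in> borel_measurable m"
    using g1(1) g2(1) measurable_cong_sets[OF R.sets_m refl] by blast+
  have a: "a1 \<in> bfun M" "a2 \<in> bfun M" unfolding a1_def a2_def by (rule restr[OF _ gC(1)] restr[OF _ gC(2)], rule gmm)+
  define IM where "IM = (\<lambda>x. if x \<in> space M then ?I (\<pi> x) else 0)"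
  have IMV: "IM \<in> bfun M" unfolding IM_def by (rule restr[OF Im R.haar_avg_bound[OF g1(1) g2(1) gC]])
  have fa: "AE x in M. ft1 (\<pi> x) = a1 x" "AE x in M. ft2 (\<pi> x) = a2 x"
    using AEpi[OF g1(3)] AEpi[OF g2(3)] AE_space by (eventually_elim, simp add: a1_def a2_def)+
  have fm: "f1 \<in> borel_measurable M" "f2 \<in> borel_measurable M" using f1 f2 by (auto simp: Linfty_def)
  have part1: "UC_lim M (\<lambda>g x. f1 (T (\<phi> g) x) * f2 (T (\<psi> g) x)) (\<lambda>x. \<integral>w. ft1 (\<pi> x + fst w) * ft2 (\<pi> x + snd w) \<partial>\<nu>)"
    unfolding UC_lim_def L2_tendsto_def
  proof (intro allI impI)
    fix F :: "nat \<Rightarrow> 'g set" assume F: "folner F"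
    let ?f = "\<lambda>N. S.L.avg (F N) (\<lambda>g. koop M T (\<phi> g) h1 * koop M T (\<psi> g) h2)"
    let ?a = "\<lambda>N. S.L.avg (F N) (\<lambda>g. koop M T (\<phi> g) a1 * koop M T (\<psi> g) a2)"
    have fV: "?f N \<in> bfun M" and aV: "?a N \<in> bfun M" for N
      using h1 h2 a by (auto intro!: S.L.avg_V bfun_mult)
    have l1: "(\<lambda>N. S.L.nrm (?f N - ?a N)) \<longlonglongrightarrow> 0"
      by (rule S.characteristic_factor[OF erg kron hom_phi hom_psi fi_phi fi_psi fi_diff F h1(1) h2(1) a])
        (rule S.cond_exp_null[OF \<pi> h1 fm(1) ft1 a(1) fa(1)] S.cond_exp_null[OF \<pi> h2 fm(2) ft2 a(2) fa(2)], assumption)+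
    \<comment> \<open>For the lifted functions the error on the system is that on the compact group,
      transported by \<open>\<pi>\<close>.\<close>
    have "(S.L.nrm (?a N - IM))\<^sup>2 = (\<integral>z. (norm (?A F N z - ?I z))\<^sup>2 \<partial>m)" for N
    proof -
      \<comment> \<open>Equivariance has an exceptional null set for each \<open>g\<close>; the
        finite set \<open>F N\<close> leaves a null union.\<close>
      have "AE x in M. \<forall>g\<in>F N. \<pi> (T (\<phi> g) x) = \<pi> x + \<alpha> (\<phi> g) \<and> \<pi> (T (\<psi> g) x) = \<pi> x + \<alpha> (\<psi> g)"
        using equi by (subst AE_finite_all[OF fin(1)[OF F]]) auto
      then have ae: "AE x in M. (norm ((?a N - IM) x))\<^sup>2 = (norm (?A F N (\<pi> x) - ?I (\<pi> x)))\<^sup>2"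
        using AE_space
        by eventually_elim (simp add: S.avg_apply koop_def a1_def a2_def IM_def orbit_avg_0 S.T_space)
      have "(S.L.nrm (?a N - IM))\<^sup>2 = (\<integral>x. (norm ((?a N - IM) x))\<^sup>2 \<partial>M)"
        by (rule S.nrm_sq_integral) (use aV IMV in auto)
      also have "\<dots> = (\<integral>x. (norm (?A F N (\<pi> x) - ?I (\<pi> x)))\<^sup>2 \<partial>M)"
      proof (rule integral_cong_AE[OF _ _ ae])
        show "(\<lambda>x. (norm ((?a N - IM) x))\<^sup>2) \<in> borel_measurable M"
          using borel_measurable_integrable[OF S.bfun_sq_integrable[of "?a N - IM"]] aV IMV by simp
        show "(\<lambda>x. (norm (?A F N (\<pi> x) - ?I (\<pi> x)))\<^sup>2) \<in> borel_measurable M"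
          by (rule measurable_compose[OF \<pi>m sqm])
      qed
      also have "\<dots> = (\<integral>z. (norm (?A F N z - ?I z))\<^sup>2 \<partial>distr M m \<pi>)"
        by (rule integral_distr[OF \<pi>m sqm, symmetric])
      finally show ?thesis by (simp add: dm')
    qed
    then have "(\<lambda>N. (S.L.nrm (?a N - IM))\<^sup>2) \<longlonglongrightarrow> 0" using L2[OF F] by simp
    then have "(\<lambda>N. sqrt ((S.L.nrm (?a N - IM))\<^sup>2)) \<longlonglongrightarrow> sqrt 0" by (rule tendsto_real_sqrt)
    then have l2: "(\<lambda>N. S.L.nrm (?a N - IM)) \<longlonglongrightarrow> 0" using aV IMV by simp
    have l12: "(\<lambda>N. S.L.nrm (?f N - ?a N) + S.L.nrm (?a N - IM)) \<longlonglongrightarrow> 0" using tendsto_add[OF l1 l2] by simp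
    have "(\<lambda>N. S.L.nrm (?f N - IM)) \<longlonglongrightarrow> 0"
      by (rule null_squeeze[OF l12]) (use S.L.nrm_triangle3[OF fV aV IMV] fV IMV in auto)
    then have "(\<lambda>N. (S.L.nrm (?f N - IM))\<^sup>2) \<longlonglongrightarrow> 0\<^sup>2" by (rule tendsto_power)
    then have lim: "(\<lambda>N. ennreal ((S.L.nrm (?f N - IM))\<^sup>2)) \<longlonglongrightarrow> 0" using tendsto_ennrealI by fastforce
    have eq: "(\<integral>\<^sup>+ x. ennreal ((norm ((\<Sum>g\<in>F N. f1 (T (\<phi> g) x) * f2 (T (\<psi> g) x)) / of_nat (card (F N)) -
        (\<integral>w. ft1 (\<pi> x + fst w) * ft2 (\<pi> x + snd w) \<partial>\<nu>)))\<^sup>2) \<partial>M) = ennreal ((S.L.nrm (?f N - IM))\<^sup>2)" for N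
    proof -
      have "AE x in M. \<forall>g\<in>F N. f1 (T (\<phi> g) x) = h1 (T (\<phi> g) x) \<and> f2 (T (\<psi> g) x) = h2 (T (\<psi> g) x)"
        using S.AE_T[OF h1(2)] S.AE_T[OF h2(2)] by (subst AE_finite_all[OF fin(1)[OF F]]) auto
      then have "AE x in M. ennreal ((norm ((\<Sum>g\<in>F N. f1 (T (\<phi> g) x) * f2 (T (\<psi> g) x)) / of_nat (card (F N)) -
        (\<integral>w. ft1 (\<pi> x + fst w) * ft2 (\<pi> x + snd w) \<partial>\<nu>)))\<^sup>2) = ennreal ((norm ((?f N - IM) x))\<^sup>2)"
        using AEpi[OF vI] AE_space
        by eventually_elim (simp add: S.avg_apply koop_def IM_def)
      then have "(\<integral>\<^sup>+ x. ennreal ((norm ((\<Sum>g\<in>F N. f1 (T (\<phi> g) x) * f2 (T (\<psi> g) x)) / of_nat (card (F N)) -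
        (\<integral>w. ft1 (\<pi> x + fst w) * ft2 (\<pi> x + snd w) \<partial>\<nu>)))\<^sup>2) \<partial>M) = (\<integral>\<^sup>+ x. ennreal ((norm ((?f N - IM) x))\<^sup>2) \<partial>M)"
        by (rule nn_integral_cong_AE)
      also have "\<dots> = ennreal (\<integral>x. (norm ((?f N - IM) x))\<^sup>2 \<partial>M)"
        by (rule nn_integral_eq_integral[OF S.bfun_sq_integrable[OF S.L.V_closed(3)[OF fV IMV]]]) simp
      finally show ?thesis using S.nrm_sq_integral[of "?f N - IM"] fV IMV by simp
    qed
    show "(\<lambda>N. \<integral>\<^sup>+ x. ennreal ((norm ((\<Sum>g\<in>F N. f1 (T (\<phi> g) x) * f2 (T (\<psi> g) x)) / of_nat (card (F N)) -
        (\<integral>w. ft1 (\<pi> x + fst w) * ft2 (\<pi> x + snd w) \<partial>\<nu>)))\<^sup>2) \<partial>M) \<longlonglongrightarrow> 0"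
      unfolding eq by (rule lim)
  qed
  from part1 part2 show ?thesis ..
qed

end
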